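(* Let $k=k(N)$ be any sequence of integers with $1\le k(N)\le N/2$ and $k(N)\to\infty$ as $N\to\infty$. Then for all $u>0$ $$0<\liminf_{N\to\infty}\mathbf d^{N,k}(N^2u)\le\limsup_{N\to\infty}\mathbf d^{N,k}(N^2u)<1,$$ and $$\lim_{s\to\infty}\limsup_{N\to\infty}\mathbf d^{N,k}(N^2s)=0.$$
   Context: Let $\mathbb Z_N=\mathbb Z/N\mathbb Z$, let $k\in\{1,\dots,N-1\}$, and let $\Omega_{N,k}=\{\eta\in\{0,1\}^{\mathbb Z_N} : \sum_{x}\eta(x)=k\}$. For $\eta\in\Omega_{N,k}$ and $x\in\mathbb Z_N$ let $\eta^x$ be the configuration obtained from $\eta$ by exchanging the contents of sites $x$ and $x+1$. The simple exclusion process is the continuous-time Markov chain on $\Omega_{N,k}$ with generator $(\mathcal L f)(\eta)=\sum_{x\in\mathbb Z_N}\big(f(\eta^x)-f(\eta)\big)$. Its unique invariant probability is the uniform measure $\mu$ on $\Omega_{N,k}$. $P_t^\chi$ denotes the law at time $t$ of the chain started from $\chi$. Total variation distance is $\|\alpha-\beta\|_{TV}=\frac12\sum_{\omega}|\alpha(\omega)-\beta(\omega)|$. The typical distance to equilibrium is $$\mathbf d^{N,k}(t)=\frac1{\#\Omega_{N,k}}\sum_{\chi\in\Omega_{N,k}}\|P_t^\chi-\mu\|_{TV}.$$ *)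

theory Defs
  imports Complex_Main "HOL-Library.FuncSet" "HOL-Library.Extended_Real"
    "HOL-Library.Indicator_Function" "HOL-Combinatorics.Transposition"
begin

text \<open>Sites of \<open>\<int>\<^sub>N\<close> are represented by \<open>{..<N}\<close> with addition modulo \<open>N\<close>; configurations are
  extensional functions on it.\<close>

definition config_space :: "nat \<Rightarrow> nat \<Rightarrow> (nat \<Rightarrow> nat) set" where
  "config_space N k = {\<eta> \<in> {..<N} \<rightarrow>\<^sub>E {0, 1}. (\<Sum>x<N. \<eta> x) = k}"

definition exchange :: "nat \<Rightarrow> nat \<Rightarrow> (nat \<Rightarrow> nat) \<Rightarrow> (nat \<Rightarrow> nat)" where
  "exchange N x \<eta> = \<eta> \<circ> transpose x ((x + 1) mod N)"

definition sep_generator :: "nat \<Rightarrow> ((nat \<Rightarrow> nat) \<Rightarrow> real) \<Rightarrow> (nat \<Rightarrow> nat) \<Rightarrow> real" where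
  "sep_generator N f \<eta> = (\<Sum>x<N. f (exchange N x \<eta>) - f \<eta>)"

text \<open>The Markov semigroup \<open>exp (t L)\<close>, as the power series of the bounded operator \<open>L\<close>; it
  converges on bounded \<open>f\<close> and solves the Kolmogorov equation, see \<open>summable_sep_semigroup\<close> and
  \<open>sep_semigroup_kolmogorov\<close> below. The law at time \<open>t\<close> started from \<open>\<chi>\<close> has mass function
  \<open>\<omega> \<mapsto> (exp (t L) 1\<^bsub>{\<omega>}\<^esub>) (\<chi>)\<close>.\<close>

definition sep_semigroup ::
  "nat \<Rightarrow> real \<Rightarrow> ((nat \<Rightarrow> nat) \<Rightarrow> real) \<Rightarrow> (nat \<Rightarrow> nat) \<Rightarrow> real" where
  "sep_semigroup N t f \<eta> = (\<Sum>n. (sep_generator N ^^ n) f \<eta> / fact n * t ^ n)"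

definition sep_law :: "nat \<Rightarrow> real \<Rightarrow> (nat \<Rightarrow> nat) \<Rightarrow> (nat \<Rightarrow> nat) \<Rightarrow> real" where
  "sep_law N t \<chi> \<omega> = sep_semigroup N t (indicator {\<omega>}) \<chi>"

definition uniform_mass :: "'a set \<Rightarrow> 'a \<Rightarrow> real" where
  "uniform_mass A \<omega> = indicator A \<omega> / real (card A)"

definition tv_dist :: "'a set \<Rightarrow> ('a \<Rightarrow> real) \<Rightarrow> ('a \<Rightarrow> real) \<Rightarrow> real" where
  "tv_dist A \<alpha> \<beta> = (1/2) * (\<Sum>\<omega>\<in>A. \<bar>\<alpha> \<omega> - \<beta> \<omega>\<bar>)"

definition typical_dist :: "nat \<Rightarrow> nat \<Rightarrow> real \<Rightarrow> real" where
  "typical_dist N k t =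
     1 / real (card (config_space N k)) *
       (\<Sum>\<chi>\<in>config_space N k.
          tv_dist (config_space N k) (sep_law N t \<chi>) (uniform_mass (config_space N k)))"

lemma sep_generator_funpow_bound:
  assumes "\<And>\<eta>. \<bar>f \<eta>\<bar> \<le> C"
  shows "\<bar>(sep_generator N ^^ n) f \<eta>\<bar> \<le> C * (2 * real N) ^ n"
proof (induction n arbitrary: \<eta>)
  case 0
  then show ?case using assms by simp
next
  case (Suc n)
  let ?g = "(sep_generator N ^^ n) f"
  have "\<bar>sep_generator N ?g \<eta>\<bar> \<le> (\<Sum>x<N. \<bar>?g (exchange N x \<eta>) - ?g \<eta>\<bar>)"
    unfolding sep_generator_def by (rule sum_abs)
  also have "\<dots> \<le> (\<Sum>x<N. 2 * (C * (2 * real N) ^ n))"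
  proof (rule sum_mono)
    fix x
    show "\<bar>?g (exchange N x \<eta>) - ?g \<eta>\<bar> \<le> 2 * (C * (2 * real N) ^ n)"
      using Suc.IH[of "exchange N x \<eta>"] Suc.IH[of \<eta>] by linarith
  qed
  also have "\<dots> = C * (2 * real N) ^ Suc n" by simp
  finally show ?case by simp
qed

lemma summable_sep_semigroup:
  assumes "\<And>\<eta>. \<bar>f \<eta>\<bar> \<le> C"
  shows "summable (\<lambda>n. (sep_generator N ^^ n) f \<eta> / fact n * t ^ n)"
proof (rule summable_comparison_test')
  show "summable (\<lambda>n. C * (inverse (fact n) * (2 * real N * \<bar>t\<bar>) ^ n))"
    by (intro summable_mult summable_exp)
  fix n :: nat assume "n \<ge> 0"
  have "\<bar>(sep_generator N ^^ n) f \<eta>\<bar> * \<bar>t\<bar> ^ n / fact n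
      \<le> C * (2 * real N) ^ n * \<bar>t\<bar> ^ n / fact n"
    by (intro divide_right_mono mult_right_mono sep_generator_funpow_bound assms) auto
  then show "norm ((sep_generator N ^^ n) f \<eta> / fact n * t ^ n)
      \<le> C * (inverse (fact n) * (2 * real N * \<bar>t\<bar>) ^ n)"
    by (simp add: abs_mult power_abs power_mult_distrib field_simps)
qed

lemma sep_semigroup_0: "sep_semigroup N 0 f \<eta> = f \<eta>"
  using powser_zero[of "\<lambda>n. (sep_generator N ^^ n) f \<eta> / fact n"]
  by (simp add: sep_semigroup_def)

lemma sep_semigroup_kolmogorov:
  assumes "\<And>\<eta>. \<bar>f \<eta>\<bar> \<le> C"
  shows "((\<lambda>t. sep_semigroup N t f \<eta>) has_real_derivative
            sep_generator N (sep_semigroup N t f) \<eta>) (at t)"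
proof -
  note S = summable_sep_semigroup[of f C N, OF assms]
  let ?c = "\<lambda>\<eta> n. (sep_generator N ^^ n) f \<eta> / fact n"
  have "((\<lambda>t. \<Sum>n. ?c \<eta> n * t ^ n) has_real_derivative (\<Sum>n. diffs (?c \<eta>) n * t ^ n)) (at t)"
    by (rule termdiffs_strong_converges_everywhere) (rule S)
  moreover have "sep_generator N (sep_semigroup N t f) \<eta> =
      (\<Sum>x<N. \<Sum>n. ?c (exchange N x \<eta>) n * t ^ n - ?c \<eta> n * t ^ n)"
    unfolding sep_generator_def[of N "sep_semigroup N t f"] sep_semigroup_def
    by (intro sum.cong refl suminf_diff S)
  moreover have "\<dots> = (\<Sum>n. \<Sum>x<N. ?c (exchange N x \<eta>) n * t ^ n - ?c \<eta> n * t ^ n)"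
    by (intro suminf_sum[symmetric] summable_diff S)
  moreover have "(\<Sum>x<N. ?c (exchange N x \<eta>) n * t ^ n - ?c \<eta> n * t ^ n)
      = diffs (?c \<eta>) n * t ^ n" for n
  proof -
    have "diffs (?c \<eta>) n = sep_generator N ((sep_generator N ^^ n) f) \<eta> / fact n"
      by (simp add: diffs_def del: of_nat_Suc)
    then show ?thesis
      by (simp add: sep_generator_def[of N "(sep_generator N ^^ n) f"]
          sum_distrib_right sum_divide_distrib left_diff_distrib diff_divide_distrib)
  qed
  ultimately show ?thesis by (simp add: sep_semigroup_def)
qed

end

(*
  Functions on subsets of an interval carry the raising and lowering operators of sl(2), which commute with
  all exchanges. The trace of the semigroup on configurations with k particles is at most the sum of
  exp (- t E) over the highest weight eigenvectors. To bound this sum, cut the interval into halves L and R: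
  H >= 2/3 (H_L + H_R) + C / (3 n^3), where C sums 1 - (exchange of x and y) over x in L and y in R. By the
  Casimir identity C is explicit on a product of multiplets, whose highest weight vectors occupy distinct
  levels, so the sum for n is at most the product of the sums for the two halves times a geometric series.
  The recursion closes at times of order n^2 uniformly in k. Averaged over the initial state, the chi^2
  distance is the trace minus 1, whence both upper bounds. The lower bound tests against the slowest Fourier
  mode of the density, whose fourth moment is controlled by its second moment.
*)

theory Submission
  imports Defs "HOL-Analysis.Function_Topology" "HOL-Analysis.L2_Norm" "HOL-Analysis.Convex"
begin

section \<open>The spectral theorem on finite sets\<close>

text \<open>A gap of order \<open>N^-2\<close> alone is not enough: the trace has
  \<open>N choose k\<close> terms, and bounding each of them by the gap would need times longer than
  \<open>N^2\<close> by a factor \<open>log (N choose k)\<close>. The bound becomes free of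
  \<open>k\<close> because a multiplet has at most one vector on each level, so it is charged once,
  at its highest weight vector, whatever \<open>k\<close> is. In the recursion, fusing multiplets of
  levels \<open>j1\<close> and \<open>j2\<close> into one of level \<open>j\<close> costs at least
  \<open>(j - j1 - j2) / (6 n^2)\<close> beyond two thirds of their energies; this cost is what sums
  to a geometric series.

  The Hamiltonians of the whole and of the halves do not commute. Only their quadratic forms are
  compared, in a basis adapted to the halves, and convexity of \<open>exp\<close> (Peierls'
  inequality) turns this into a bound on sums of exponentials. The same device passes from the cycle
  to the segment.

  Halves have length at most \<open>2 n / 3\<close> and receive time \<open>2 t / 3\<close>, so
  \<open>n^2 / t\<close> shrinks by the factor \<open>2/3\<close>. As
  \<open>2 * (2/3) > 1 > 2 * (2/3)^2\<close>, an exponent quadratic in \<open>n^2 / t\<close> closes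
  the recursion where a linear one would not.\<close>

definition ip :: "'a set \<Rightarrow> ('a \<Rightarrow> real) \<Rightarrow> ('a \<Rightarrow> real) \<Rightarrow> real" where
  "ip S f g = (\<Sum>x\<in>S. f x * g x)"

lemma ip_commute: "ip S f g = ip S g f"
  by (simp add: ip_def mult.commute)

lemma ip_add_left: "ip S (\<lambda>x. f x + g x) h = ip S f h + ip S g h"
  by (simp add: ip_def algebra_simps sum.distrib)

lemma ip_diff_left: "ip S (\<lambda>x. f x - g x) h = ip S f h - ip S g h"
  by (simp add: ip_def algebra_simps sum_subtractf)

lemma ip_scale_left: "ip S (\<lambda>x. c * f x) h = c * ip S f h"
  by (simp add: ip_def algebra_simps sum_distrib_left)

lemma ip_comb_left: "ip S (\<lambda>x. a * f x + b * g x) h = a * ip S f h + b * ip S g h"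
  by (simp add: ip_add_left ip_scale_left)

lemma ip_comb_right: "ip S h (\<lambda>x. a * f x + b * g x) = a * ip S h f + b * ip S h g"
  by (metis ip_comb_left ip_commute)

lemma ip_diff_right: "ip S h (\<lambda>x. f x - g x) = ip S h f - ip S h g"
  by (metis ip_diff_left ip_commute)

lemma ip_scale_right: "ip S h (\<lambda>x. c * f x) = c * ip S h f"
  by (metis ip_scale_left ip_commute)

lemma ip_sum_left: "ip S (\<lambda>x. \<Sum>i\<in>I. f i x) h = (\<Sum>i\<in>I. ip S (f i) h)"
  by (simp add: ip_def sum_distrib_right) (rule sum.swap)

lemma ip_sum_right: "ip S h (\<lambda>x. \<Sum>i\<in>I. f i x) = (\<Sum>i\<in>I. ip S h (f i))"
  unfolding ip_commute[of S h] by (rule ip_sum_left)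

lemma ip_cong: "(\<And>x. x \<in> S \<Longrightarrow> f x = f' x) \<Longrightarrow> (\<And>x. x \<in> S \<Longrightarrow> g x = g' x) \<Longrightarrow> ip S f g = ip S f' g'"
  by (simp add: ip_def)

lemma ip_self_nonneg: "0 \<le> ip S f f"
  by (simp add: ip_def sum_nonneg)

lemma ip_self_eq_0: "finite S \<Longrightarrow> ip S f f = 0 \<Longrightarrow> x \<in> S \<Longrightarrow> f x = 0"
  by (simp add: ip_def sum_nonneg_eq_0_iff)

lemma ip_delta: "finite S \<Longrightarrow> x \<in> S \<Longrightarrow> ip S (indicator {x}) f = f x"
  by (simp add: ip_def indicator_def if_distrib sum.delta' cong: if_cong)

definition orthonormal :: "'a set \<Rightarrow> ('a \<Rightarrow> real) set \<Rightarrow> bool" where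
  "orthonormal S B \<longleftrightarrow> finite B \<and> (\<forall>b\<in>B. \<forall>c\<in>B. ip S b c = (if b = c then 1 else 0))"

lemma bessel:
  assumes "orthonormal S B"
  shows "(\<Sum>b\<in>B. (ip S f b)\<^sup>2) \<le> ip S f f"
proof -
  let ?p = "\<lambda>x. \<Sum>b\<in>B. ip S f b * b x"
  have fin: "finite B" using assms by (simp add: orthonormal_def)
  have fp: "ip S f ?p = (\<Sum>b\<in>B. (ip S f b)\<^sup>2)"
    by (simp add: ip_sum_right ip_scale_right power2_eq_square)
  have pp: "ip S ?p ?p = (\<Sum>b\<in>B. (ip S f b)\<^sup>2)"
  proof -
    have "ip S ?p ?p = (\<Sum>b\<in>B. \<Sum>c\<in>B. ip S f b * ip S f c * ip S b c)"
      unfolding ip_sum_right ip_sum_left ip_scale_right ip_scale_left sum_distrib_left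
      by (intro sum.cong refl) (simp add: ip_commute)
    also have "\<dots> = (\<Sum>b\<in>B. \<Sum>c\<in>B. if b = c then ip S f b * ip S f c else 0)"
      using assms by (intro sum.cong refl) (simp add: orthonormal_def)
    also have "\<dots> = (\<Sum>b\<in>B. (ip S f b)\<^sup>2)"
      using fin by (simp add: power2_eq_square)
    finally show ?thesis .
  qed
  have "0 \<le> ip S (\<lambda>x. f x - ?p x) (\<lambda>x. f x - ?p x)" by (rule ip_self_nonneg)
  also have "\<dots> = ip S f f - 2 * ip S f ?p + ip S ?p ?p"
    by (simp add: ip_diff_left ip_diff_right ip_commute)
  finally show ?thesis using fp pp by simp
qed

text \<open>Bessel's inequality for the indicator of each point, summed over the points. This bound
  is what guarantees a maximal orthonormal family later.\<close>

lemma orthonormal_card: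
  assumes "finite S" "orthonormal S B"
  shows "card B \<le> card S"
proof -
  have "real (card B) = (\<Sum>b\<in>B. ip S b b)"
    using assms by (simp add: orthonormal_def)
  also have "\<dots> = (\<Sum>x\<in>S. \<Sum>b\<in>B. (b x)\<^sup>2)"
    by (simp add: ip_def power2_eq_square) (rule sum.swap)
  also have "\<dots> \<le> (\<Sum>x\<in>S. 1)"
  proof (rule sum_mono)
    fix x assume x: "x \<in> S"
    have "(\<Sum>b\<in>B. (b x)\<^sup>2) = (\<Sum>b\<in>B. (ip S (indicator {x}) b)\<^sup>2)"
      using x assms by (simp add: ip_delta)
    also have "\<dots> \<le> ip S (indicator {x}) (indicator {x})" by (rule bessel) fact
    finally show "(\<Sum>b\<in>B. (b x)\<^sup>2) \<le> 1" using x assms by (simp add: ip_delta)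
  qed
  finally show ?thesis by simp
qed

text \<open>The first-order condition at a maximum: otherwise a small \<open>e\<close> of the sign
  of \<open>a\<close> would violate the inequality.\<close>

lemma linear_term_eq_0:
  fixes a c :: real
  assumes "\<And>e. e * a \<le> e\<^sup>2 * c"
  shows "a = 0"
proof (rule ccontr)
  assume "a \<noteq> 0"
  define d where "d = \<bar>c\<bar> + 1"
  have d: "d > 0" "c < d" by (auto simp: d_def)
  have "a / d * a \<le> (a / d)\<^sup>2 * c" by (rule assms)
  also have "\<dots> < (a / d)\<^sup>2 * d" using \<open>a \<noteq> 0\<close> d by (intro mult_strict_left_mono) auto
  also have "\<dots> = a / d * a" using d by (simp add: power2_eq_square)
  finally show False by simp
qed

text \<open>The Rayleigh quotient attains its maximum on the unit sphere of \<open>V\<close>, and a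
  maximiser is an eigenvector. Functions live on the whole type; since members of \<open>V\<close>
  vanish off \<open>S\<close>, the sphere is still compact in the product topology and the
  eigenvalue equation holds at every point.\<close>

lemma rayleigh_eigenvector:
  assumes S: "finite S" and supp: "\<And>f x. f \<in> V \<Longrightarrow> x \<notin> S \<Longrightarrow> f x = 0"
    and comb: "\<And>f g a b. f \<in> V \<Longrightarrow> g \<in> V \<Longrightarrow> (\<lambda>x. a * f x + b * g x) \<in> V"
    and V: "closed V"
    and AV: "\<And>f. f \<in> V \<Longrightarrow> A f \<in> V"
    and sym: "\<And>f g. f \<in> V \<Longrightarrow> g \<in> V \<Longrightarrow> ip S (A f) g = ip S f (A g)"
    and lin: "\<And>f g a b. A (\<lambda>x. a * f x + b * g x) = (\<lambda>x. a * A f x + b * A g x)"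
    and cont: "\<And>x. continuous_on UNIV (\<lambda>f. A f x)"
    and h: "h \<in> V" "y \<in> S" "h y \<noteq> 0"
  shows "\<exists>f\<in>V. ip S f f = 1 \<and> (\<exists>c. \<forall>x. A f x = c * f x)"
proof -
  define U where "U = {f \<in> V. ip S f f = 1}"
  have ipcont: "continuous_on UNIV (\<lambda>f. ip S (F f) (G f))"
    if "\<And>x. continuous_on UNIV (\<lambda>f. F f x)" "\<And>x. continuous_on UNIV (\<lambda>f. G f x)"
    for F G :: "('a \<Rightarrow> real) \<Rightarrow> 'a \<Rightarrow> real"
    unfolding ip_def by (intro continuous_intros that)
  \<comment> \<open>A unit vector has values in \<open>[-1, 1]\<close> on \<open>S\<close> and is
    \<open>0\<close> elsewhere, so the sphere lies in a product of compact sets, which is compact by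
    Tychonoff.\<close>
  define box :: "'a \<Rightarrow> real set" where "box x = (if x \<in> S then {-1..1} else {0})" for x
  have "compactin (product_topology (\<lambda>_. euclidean) UNIV) (PiE UNIV box)"
    unfolding compactin_PiE by (auto simp: box_def)
  then have box: "compact (PiE UNIV box)"
    by (simp add: euclidean_product_topology)
  have Usub: "U \<subseteq> PiE UNIV box"
  proof
    fix f assume f: "f \<in> U"
    have "f x \<in> box x" for x
    proof (cases "x \<in> S")
      case True
      have "(f x)\<^sup>2 \<le> ip S f f" unfolding ip_def power2_eq_square
        using True S by (intro member_le_sum) auto
      then have "\<bar>f x\<bar> \<le> 1" using f by (simp add: U_def abs_square_le_1)
      then show ?thesis using True by (auto simp: box_def)
    qed (use f supp in \<open>auto simp: box_def U_def\<close>)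
    then show "f \<in> PiE UNIV box" by auto
  qed
  have "closed {f. ip S f f = 1}"
    by (intro closed_Collect_eq ipcont continuous_intros) auto
  from closed_Int[OF V this] have "closed U"
    by (simp add: U_def Int_def)
  then have U: "compact U"
    using compact_Int_closed[OF box] Usub by (metis inf.absorb2)
  have hn: "ip S h h > 0"
    using ip_self_nonneg[of S h] ip_self_eq_0[OF S, of h y] h by fastforce
  have norm: "(\<lambda>x. (1 / sqrt (ip S g g)) * g x) \<in> U" if "g \<in> V" "ip S g g > 0" for g
  proof -
    have "(\<lambda>x. (1 / sqrt (ip S g g)) * g x) \<in> V"
      using comb[of g g "1 / sqrt (ip S g g)" 0] that by simp
    moreover have "(1 / sqrt (ip S g g)) * ((1 / sqrt (ip S g g)) * ip S g g) = 1"
      using that by (simp add: field_simps)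
    ultimately show ?thesis unfolding U_def mem_Collect_eq ip_scale_left ip_scale_right by blast
  qed
  have "U \<noteq> {}" using norm[OF h(1) hn] by blast
  then obtain f where f: "f \<in> U" and max: "\<And>g. g \<in> U \<Longrightarrow> ip S g (A g) \<le> ip S f (A f)"
    using continuous_attains_sup[OF U _ continuous_on_subset[OF ipcont[of "\<lambda>f. f" A]], OF _ _ cont]
    by auto
  have fV: "f \<in> V" and f1: "ip S f f = 1" using f by (auto simp: U_def)
  define m where "m = ip S f (A f)"
  have upper: "ip S g (A g) \<le> m * ip S g g" if g: "g \<in> V" for g
  proof (cases "ip S g g > 0")
    case True
    let ?c = "1 / sqrt (ip S g g)"
    have A': "A (\<lambda>x. ?c * g x) = (\<lambda>x. ?c * A g x)"
      using lin[of ?c g 0 g] by simp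
    have "?c * (?c * ip S g (A g)) \<le> m"
      using max[OF norm[OF g True]] unfolding A' m_def ip_scale_left ip_scale_right .
    then show ?thesis using True by (simp add: field_simps)
  next
    case False
    then have 0: "ip S g g = 0" using ip_self_nonneg[of S g] by simp
    then have "ip S g (A g) = 0" using ip_self_eq_0[OF S 0] by (simp add: ip_def)
    then show ?thesis using 0 by simp
  qed
  \<comment> \<open>The residual of the eigenvalue equation is orthogonal to \<open>f\<close>.
    Perturbing \<open>f\<close> by \<open>e * g\<close> cannot increase the quotient, so the term
    linear in \<open>e\<close> vanishes, and that term is twice the squared norm of
    \<open>g\<close>.\<close>
  define g where "g = (\<lambda>x. 1 * A f x + (- m) * f x)"
  have gV: "g \<in> V" unfolding g_def by (intro comb AV fV)
  have gf: "ip S g f = 0" using f1 unfolding g_def ip_comb_left m_def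
    by (simp add: ip_commute)
  have "e * (2 * ip S g (A f)) \<le> e\<^sup>2 * (m * ip S g g - ip S g (A g))" for e
  proof -
    have c: "(\<lambda>x. 1 * f x + e * g x) \<in> V" by (intro comb fV gV)
    have gAf: "ip S f (A g) = ip S g (A f)" using sym[OF gV fV] by (metis ip_commute)
    have "ip S f (A f) + e * ip S g (A f) + e * (ip S f (A g) + e * ip S g (A g))
       \<le> m * (ip S f f + 2 * e * ip S g f + e * e * ip S g g)"
      using upper[OF c] unfolding lin ip_comb_left ip_comb_right
      by (simp add: algebra_simps ip_commute)
    then show ?thesis unfolding gAf gf f1 m_def[symmetric]
      by (simp add: power2_eq_square algebra_simps)
  qed
  from linear_term_eq_0[OF this] have gAf: "ip S g (A f) = 0" by simp
  have "ip S g g = 1 * ip S g (A f) + (- m) * ip S g f"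
    by (subst (2) g_def) (rule ip_comb_right)
  then have "ip S g g = 0" using gAf gf by simp
  then have "g x = 0" for x
    using ip_self_eq_0[OF S] supp[OF gV] by blast
  then have "A f x = m * f x" for x
    by (simp add: g_def)
  then show ?thesis using fV f1 by blast
qed

text \<open>Take an orthonormal family of eigenvectors of maximal size. If some \<open>f\<close>
  were not expanded by it, the orthogonal complement \<open>W\<close>, invariant because
  \<open>A\<close> is symmetric, would be nonzero and contain one more eigenvector.\<close>

lemma orthonormal_eigenbasis:
  assumes S: "finite S" and supp: "\<And>f x. f \<in> V \<Longrightarrow> x \<notin> S \<Longrightarrow> f x = 0"
    and comb: "\<And>f g a b. f \<in> V \<Longrightarrow> g \<in> V \<Longrightarrow> (\<lambda>x. a * f x + b * g x) \<in> V"
    and V: "closed V"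
    and AV: "\<And>f. f \<in> V \<Longrightarrow> A f \<in> V"
    and sym: "\<And>f g. f \<in> V \<Longrightarrow> g \<in> V \<Longrightarrow> ip S (A f) g = ip S f (A g)"
    and lin: "\<And>f g a b. A (\<lambda>x. a * f x + b * g x) = (\<lambda>x. a * A f x + b * A g x)"
    and cont: "\<And>x. continuous_on UNIV (\<lambda>f. A f x)"
  shows "\<exists>B \<subseteq> V. orthonormal S B \<and> (\<forall>b\<in>B. \<forall>x. A b x = ip S b (A b) * b x) \<and>
           (\<forall>f\<in>V. \<forall>x\<in>S. f x = (\<Sum>b\<in>B. ip S f b * b x))"
proof -
  define good where "good B \<longleftrightarrow> B \<subseteq> V \<and> orthonormal S B \<and> (\<forall>b\<in>B. \<forall>x. A b x = ip S b (A b) * b x)" for B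
  have "good {}" by (simp add: good_def orthonormal_def)
  moreover have "\<forall>B. good B \<longrightarrow> card B < Suc (card S)"
    using orthonormal_card[OF S] by (auto simp: good_def less_Suc_eq_le)
  ultimately obtain B where B: "good B" and mx: "\<And>B'. good B' \<Longrightarrow> card B' \<le> card B"
    using ex_has_greatest_nat[of good "{}" card "Suc (card S)"] by blast
  have on: "orthonormal S B" and BV: "B \<subseteq> V" and fin: "finite B"
    and eig: "\<And>b x. b \<in> B \<Longrightarrow> A b x = ip S b (A b) * b x"
    using B by (auto simp: good_def orthonormal_def)
  have "f y = (\<Sum>b\<in>B. ip S f b * b y)" if f: "f \<in> V" and y: "y \<in> S" for f y
  proof (rule ccontr)
    assume ne: "f y \<noteq> (\<Sum>b\<in>B. ip S f b * b y)"
    define W where "W = {g \<in> V. \<forall>b\<in>B. ip S g b = 0}"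
    have proj: "(\<lambda>x. f x - (\<Sum>b\<in>C. ip S f b * b x)) \<in> V" if "C \<subseteq> B" for C
      using finite_subset[OF that fin] that
    proof (induction C rule: finite_induct)
      case empty
      then show ?case using f by simp
    next
      case (insert c C)
      have "(\<lambda>x. 1 * (f x - (\<Sum>b\<in>C. ip S f b * b x)) + (- ip S f c) * c x) \<in> V"
        using insert BV by (intro comb) auto
      then show ?case using insert by (simp add: algebra_simps)
    qed
    define h where "h = (\<lambda>x. f x - (\<Sum>b\<in>B. ip S f b * b x))"
    have hV: "h \<in> V" unfolding h_def by (rule proj) simp
    have "ip S h c = 0" if c: "c \<in> B" for c
    proof -
      have "ip S h c = ip S f c - (\<Sum>b\<in>B. ip S f b * ip S b c)"
        by (simp add: h_def ip_diff_left ip_sum_left ip_scale_left)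
      also have "(\<Sum>b\<in>B. ip S f b * ip S b c) = (\<Sum>b\<in>B. if b = c then ip S f b else 0)"
        using on c by (intro sum.cong) (auto simp: orthonormal_def)
      finally show ?thesis using c fin by simp
    qed
    then have hW: "h \<in> W" using hV by (simp add: W_def)
    have "\<exists>g\<in>W. ip S g g = 1 \<and> (\<exists>c. \<forall>x. A g x = c * g x)"
    proof (rule rayleigh_eigenvector[where S = S and h = h and y = y])
      have "W = V \<inter> (\<Inter>b\<in>B. {g. ip S g b = 0})" by (auto simp: W_def)
      moreover have "closed {g. ip S g b = 0}" for b
        unfolding ip_def by (intro closed_Collect_eq continuous_intros) auto
      ultimately show "closed W" using V by auto
      show "A g \<in> W" if "g \<in> W" for g
      proof -
        have "ip S (A g) b = 0" if b: "b \<in> B" for b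
        proof -
          have "ip S (A g) b = ip S g (A b)" using \<open>g \<in> W\<close> b BV by (intro sym) (auto simp: W_def)
          also have "\<dots> = ip S g (\<lambda>x. ip S b (A b) * b x)" using eig[OF b] by (intro ip_cong) auto
          also have "\<dots> = 0" using \<open>g \<in> W\<close> b by (simp add: ip_scale_right W_def)
          finally show ?thesis .
        qed
        then show ?thesis using that AV by (auto simp: W_def)
      qed
    qed (use S supp comb lin cont sym hW y ne in \<open>auto simp: W_def ip_comb_left h_def\<close>)
    then obtain g c where g: "g \<in> W" "ip S g g = 1" "\<And>x. A g x = c * g x" by blast
    have "ip S g (A g) = c" using g by (simp add: ip_scale_right cong: ip_cong)
    moreover have gb: "ip S g b = 0" "ip S b g = 0" if "b \<in> B" for b
      using g that by (auto simp: W_def ip_commute)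
    moreover have "g \<notin> B" using gb g(2) by fastforce
    ultimately have "good (insert g B)"
      using B g by (auto simp: good_def orthonormal_def W_def)
    from mx[OF this] show False using \<open>g \<notin> B\<close> fin by simp
  qed
  then show ?thesis using B by (auto simp: good_def)
qed

section \<open>Exchange, raising and lowering operators\<close>

text \<open>The sign makes this a nonnegative operator, minus the generator of exchanges along
  \<open>P\<close>. Pairs are ordered, so \<open>X \<times> X\<close> counts every exchange twice
  and the diagonal contributes nothing.\<close>

definition exch :: "('a \<times> 'a) set \<Rightarrow> ('a set \<Rightarrow> real) \<Rightarrow> 'a set \<Rightarrow> real" where
  "exch P f A = (\<Sum>(x,y)\<in>P. f A - f (transpose x y ` A))"

text \<open>Functions are coefficient vectors over the basis of subsets. Hence the operator that
  creates a particle evaluates \<open>f\<close> at sets with one particle fewer.\<close>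

definition raise :: "'a set \<Rightarrow> ('a set \<Rightarrow> real) \<Rightarrow> 'a set \<Rightarrow> real" where
  "raise X f A = (\<Sum>x\<in>X \<inter> A. f (A - {x}))"

definition lower :: "'a set \<Rightarrow> ('a set \<Rightarrow> real) \<Rightarrow> 'a set \<Rightarrow> real" where
  "lower X f A = (\<Sum>x\<in>X - A. f (insert x A))"

lemma transpose_image_invol [simp]: "transpose x y ` (transpose x y ` A) = A"
  by (simp add: image_image)

lemma transpose_image_swap: "x \<in> A \<Longrightarrow> y \<notin> A \<Longrightarrow> transpose x y ` A = insert y (A - {x})"
  by (auto simp: transpose_def image_iff)

lemma transpose_image_subset_iff: "x \<in> X \<Longrightarrow> y \<in> X \<Longrightarrow> transpose x y ` A \<subseteq> X \<longleftrightarrow> A \<subseteq> X"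
  by (metis image_mono transpose_image_eq transpose_image_invol)

lemma card_transpose_image [simp]: "card (transpose x y ` A) = card A"
  by (rule card_image) simp

lemma sum_Pow_transpose:
  assumes "x \<in> X" "y \<in> X"
  shows "(\<Sum>A\<in>Pow X. g (transpose x y ` A)) = (\<Sum>A\<in>Pow X. g A)"
  by (rule sum.reindex_bij_witness[where i = "image (transpose x y)" and j = "image (transpose x y)"])
     (use assms in \<open>auto simp: transpose_image_subset_iff\<close>)

lemma exch_comb: "exch P (\<lambda>A. a * f A + b * g A) = (\<lambda>A. a * exch P f A + b * exch P g A)"
  unfolding exch_def by (rule ext) (simp add: sum_distrib_left sum.distrib[symmetric] case_prod_unfold algebra_simps)

lemma exch_scale: "exch P (\<lambda>A. a * f A) = (\<lambda>A. a * exch P f A)"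
  using exch_comb[of P a f 0 f] by simp

text \<open>Each exchange is an involution of \<open>Pow X\<close>; averaging the sum with its
  reindexed copy gives the Dirichlet form with the factor \<open>1/2\<close>.\<close>

lemma ip_exch:
  assumes "P \<subseteq> X \<times> X"
  shows "ip (Pow X) f (exch P g)
    = (\<Sum>(x,y)\<in>P. \<Sum>A\<in>Pow X. (f A - f (transpose x y ` A)) * (g A - g (transpose x y ` A))) / 2"
proof -
  have *: "(\<Sum>A\<in>Pow X. f A * (g A - g (transpose x y ` A)))
     = (\<Sum>A\<in>Pow X. (f A - f (transpose x y ` A)) * (g A - g (transpose x y ` A))) / 2"
    if "(x, y) \<in> P" for x y
  proof -
    have "(\<Sum>A\<in>Pow X. f A * (g A - g (transpose x y ` A)))
       = (\<Sum>A\<in>Pow X. f (transpose x y ` A) * (g (transpose x y ` A) - g A))"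
      using sum_Pow_transpose[of x X y "\<lambda>A. f A * (g A - g (transpose x y ` A))"] that assms by auto
    moreover have "(\<Sum>A\<in>Pow X. (f A - f (transpose x y ` A)) * (g A - g (transpose x y ` A)))
       = (\<Sum>A\<in>Pow X. f A * (g A - g (transpose x y ` A)))
         + (\<Sum>A\<in>Pow X. f (transpose x y ` A) * (g (transpose x y ` A) - g A))"
      unfolding sum.distrib[symmetric] by (intro sum.cong refl) (simp add: algebra_simps)
    ultimately show ?thesis by simp
  qed
  have "ip (Pow X) f (exch P g) = (\<Sum>(x,y)\<in>P. \<Sum>A\<in>Pow X. f A * (g A - g (transpose x y ` A)))"
    unfolding ip_def exch_def sum_distrib_left
    by (subst sum.swap) (simp add: case_prod_unfold)
  also have "\<dots> = (\<Sum>(x,y)\<in>P. (\<Sum>A\<in>Pow X. (f A - f (transpose x y ` A)) * (g A - g (transpose x y ` A))) / 2)"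
    by (rule sum.cong) (use * in auto)
  finally show ?thesis by (simp add: sum_divide_distrib case_prod_unfold)
qed

lemma exch_sym: "P \<subseteq> X \<times> X \<Longrightarrow> ip (Pow X) (exch P f) g = ip (Pow X) f (exch P g)"
  by (subst ip_commute) (simp add: ip_exch mult.commute)

lemma exch_energy:
  "P \<subseteq> X \<times> X \<Longrightarrow> ip (Pow X) f (exch P f)
    = (\<Sum>(x,y)\<in>P. \<Sum>A\<in>Pow X. (f A - f (transpose x y ` A))\<^sup>2) / 2"
  by (simp add: ip_exch power2_eq_square)

lemma exch_energy_nonneg: "P \<subseteq> X \<times> X \<Longrightarrow> 0 \<le> ip (Pow X) f (exch P f)"
  by (simp add: exch_energy sum_nonneg case_prod_unfold)

lemma exch_energy_mono:
  "finite Q \<Longrightarrow> P \<subseteq> Q \<Longrightarrow> Q \<subseteq> X \<times> X \<Longrightarrow> ip (Pow X) f (exch P f) \<le> ip (Pow X) f (exch Q f)"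
  by (subst (1 2) exch_energy) (auto intro!: divide_right_mono sum_mono2 sum_nonneg)

lemma exch_Un:
  "finite P \<Longrightarrow> finite Q \<Longrightarrow> P \<inter> Q = {} \<Longrightarrow> exch (P \<union> Q) f A = exch P f A + exch Q f A"
  by (simp add: exch_def sum.union_disjoint)

lemma raise_comb: "raise X (\<lambda>A. a * f A + b * g A) = (\<lambda>A. a * raise X f A + b * raise X g A)"
  unfolding raise_def by (rule ext) (simp add: sum_distrib_left sum.distrib)

lemma raise_scale: "raise X (\<lambda>A. a * f A) = (\<lambda>A. a * raise X f A)"
  using raise_comb[of X a f 0 f] by simp

lemma lower_comb: "lower X (\<lambda>A. a * f A + b * g A) = (\<lambda>A. a * lower X f A + b * lower X g A)"
  unfolding lower_def by (rule ext) (simp add: sum_distrib_left sum.distrib)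

lemma raise_adjoint:
  assumes "finite X"
  shows "ip (Pow X) (raise X f) g = ip (Pow X) f (lower X g)"
proof -
  have fin: "finite A" if "A \<subseteq> X" for A using that assms by (rule finite_subset)
  have "ip (Pow X) (raise X f) g = (\<Sum>(A,x)\<in>Sigma (Pow X) (\<lambda>A. A). f (A - {x}) * g A)"
    unfolding ip_def raise_def sum_distrib_right
    by (subst sum.Sigma) (use fin assms in \<open>auto simp: Int_absorb1 intro!: sum.cong\<close>)
  also have "\<dots> = (\<Sum>(A,x)\<in>Sigma (Pow X) (\<lambda>A. X - A). f A * g (insert x A))"
    by (rule sum.reindex_bij_witness[where i = "\<lambda>(A,x). (insert x A, x)" and j = "\<lambda>(A,x). (A - {x}, x)"])
       (auto simp: insert_absorb)
  also have "\<dots> = ip (Pow X) f (lower X g)"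
    unfolding ip_def lower_def sum_distrib_left
    by (rule sum.Sigma[symmetric]) (use fin assms in auto)
  finally show ?thesis .
qed

lemma raise_lower:
  assumes "finite X" "A \<subseteq> X"
  shows "raise X (lower X f) A = real (card A) * f A + (\<Sum>x\<in>A. \<Sum>y\<in>X - A. f (insert y (A - {x})))"
proof -
  have "lower X f (A - {x}) = f A + (\<Sum>y\<in>X - A. f (insert y (A - {x})))" if "x \<in> A" for x
  proof -
    have "X - (A - {x}) = insert x (X - A)" using that assms by auto
    then show ?thesis using that assms by (simp add: lower_def insert_absorb)
  qed
  then show ?thesis using assms by (simp add: raise_def sum.distrib Int_absorb1)
qed

text \<open>The relation \<open>[e, f] = h\<close> of sl(2), with \<open>lower\<close> as
  \<open>e\<close>, \<open>raise\<close> as \<open>f\<close> and weight \<open>n - 2 j\<close> on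
  level \<open>j\<close>. The terms moving a particle agree in both orders; only the diagonal terms
  \<open>n - card A\<close> and \<open>card A\<close> differ.\<close>

lemma lower_raise:
  assumes "finite X" "A \<subseteq> X"
  shows "lower X (raise X f) A = raise X (lower X f) A + (real (card X) - 2 * real (card A)) * f A"
proof -
  have finA: "finite A" using assms finite_subset by blast
  have "raise X f (insert y A) = f A + (\<Sum>x\<in>A. f (insert y (A - {x})))" if "y \<in> X - A" for y
  proof -
    have "insert y A - {x} = insert y (A - {x})" if "x \<in> A" for x using that \<open>y \<in> X - A\<close> by auto
    moreover have "X \<inter> insert y A = insert y A" using that assms by auto
    ultimately show ?thesis using that finA by (simp add: raise_def cong: sum.cong)
  qed
  then have "lower X (raise X f) A = real (card (X - A)) * f A + (\<Sum>y\<in>X-A. \<Sum>x\<in>A. f (insert y (A - {x})))"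
    by (simp add: lower_def sum.distrib)
  also have "real (card (X - A)) = real (card X) - real (card A)"
    using assms by (simp add: card_Diff_subset finA card_mono of_nat_diff)
  finally show ?thesis
    unfolding raise_lower[OF assms] by (subst (asm) sum.swap) (simp add: algebra_simps)
qed

lemma raise_transpose:
  assumes "x \<in> X" "y \<in> X"
  shows "raise X f (transpose x y ` A) = raise X (\<lambda>B. f (transpose x y ` B)) A"
proof -
  have *: "X \<inter> transpose x y ` A = transpose x y ` (X \<inter> A)"
    using transpose_image_eq[of x X y] assms by (simp add: image_Int)
  have "raise X f (transpose x y ` A) = (\<Sum>z\<in>X \<inter> A. f (transpose x y ` A - {transpose x y z}))"
    unfolding raise_def * by (subst sum.reindex) auto
  also have "\<dots> = (\<Sum>z\<in>X \<inter> A. f (transpose x y ` (A - {z})))"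
    by (simp add: image_set_diff)
  finally show ?thesis by (simp add: raise_def)
qed

lemma lower_transpose:
  assumes "x \<in> X" "y \<in> X"
  shows "lower X f (transpose x y ` A) = lower X (\<lambda>B. f (transpose x y ` B)) A"
proof -
  have *: "X - transpose x y ` A = transpose x y ` (X - A)"
    using transpose_image_eq[of x X y] assms by (simp add: image_set_diff)
  show ?thesis
    unfolding lower_def * by (subst sum.reindex) auto
qed

text \<open>\<open>raise X\<close> sums over all sites of \<open>X\<close> and is therefore
  invariant under permutations of \<open>X\<close>. The energy is thus constant along a
  multiplet.\<close>

lemma exch_raise:
  assumes "P \<subseteq> X \<times> X"
  shows "exch P (raise X f) = raise X (exch P f)"
proof
  fix A
  have "exch P (raise X f) A = (\<Sum>p\<in>P. \<Sum>z\<in>X \<inter> A. f (A - {z}) - f (transpose (fst p) (snd p) ` (A - {z})))"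
    unfolding exch_def case_prod_unfold
  proof (rule sum.cong[OF refl])
    fix p assume "p \<in> P"
    then have "fst p \<in> X" "snd p \<in> X" using assms by auto
    then show "raise X f A - raise X f (transpose (fst p) (snd p) ` A) =
         (\<Sum>z\<in>X \<inter> A. f (A - {z}) - f (transpose (fst p) (snd p) ` (A - {z})))"
      unfolding raise_transpose[OF \<open>fst p \<in> X\<close> \<open>snd p \<in> X\<close>] by (simp add: raise_def sum_subtractf)
  qed
  also have "\<dots> = raise X (exch P f) A"
    by (subst sum.swap) (simp add: raise_def exch_def case_prod_unfold)
  finally show "exch P (raise X f) A = raise X (exch P f) A" .
qed

lemma exch_lower:
  assumes "P \<subseteq> X \<times> X"
  shows "exch P (lower X f) = lower X (exch P f)"
proof
  fix A
  have "exch P (lower X f) A = (\<Sum>p\<in>P. \<Sum>z\<in>X-A. f (insert z A) - f (transpose (fst p) (snd p) ` (insert z A)))"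
    unfolding exch_def case_prod_unfold
  proof (rule sum.cong[OF refl])
    fix p assume "p \<in> P"
    then have "fst p \<in> X" "snd p \<in> X" using assms by auto
    then show "lower X f A - lower X f (transpose (fst p) (snd p) ` A) =
         (\<Sum>z\<in>X - A. f (insert z A) - f (transpose (fst p) (snd p) ` insert z A))"
      unfolding lower_transpose[OF \<open>fst p \<in> X\<close> \<open>snd p \<in> X\<close>] by (simp add: lower_def sum_subtractf)
  qed
  also have "\<dots> = lower X (exch P f) A"
    by (subst sum.swap) (simp add: lower_def exch_def case_prod_unfold)
  finally show "exch P (lower X f) A = lower X (exch P f) A" .
qed

text \<open>Exchanges of two occupied or two empty sites do nothing. The others occur in both
  orders, whence the factor \<open>2\<close>, and move a particle out of \<open>A\<close> exactly as
  the off-diagonal part of \<open>raise X (lower X f)\<close> does.\<close>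

lemma casimir:
  assumes X: "finite X" "A \<subseteq> X"
  shows "exch (X \<times> X) f A
    = 2 * (real (card A) * (real (card X) - real (card A) + 1) * f A - raise X (lower X f) A)"
proof -
  have finA: "finite A" using assms finite_subset by blast
  let ?d = "\<lambda>x y. f A - f (transpose x y ` A)"
  let ?c = "\<Sum>x\<in>A. \<Sum>y\<in>X - A. ?d x y"
  have split: "(\<Sum>y\<in>X. g y) = (\<Sum>y\<in>A. g y) + (\<Sum>y\<in>X - A. g y)" for g :: "'a \<Rightarrow> real"
    using X by (metis sum.subset_diff add.commute)
  have 0: "(\<Sum>x\<in>A. \<Sum>y\<in>A. ?d x y) = 0" "(\<Sum>x\<in>X-A. \<Sum>y\<in>X-A. ?d x y) = 0"
    by (auto intro!: sum.neutral simp: transpose_image_eq)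
  have "exch (X \<times> X) f A = (\<Sum>x\<in>X. \<Sum>y\<in>X. ?d x y)"
    by (simp add: exch_def sum.cartesian_product)
  also have "\<dots> = (\<Sum>x\<in>A. \<Sum>y\<in>X-A. ?d x y) + (\<Sum>x\<in>X-A. \<Sum>y\<in>A. ?d x y)"
    unfolding split sum.distrib using 0 by simp
  also have "(\<Sum>x\<in>X-A. \<Sum>y\<in>A. ?d x y) = ?c"
    by (subst sum.swap) (simp add: transpose_commute)
  finally have "exch (X \<times> X) f A = 2 * ?c" by simp
  also have "?c = (\<Sum>x\<in>A. \<Sum>y\<in>X - A. f A - f (insert y (A - {x})))"
    by (intro sum.cong refl) (simp add: transpose_image_swap)
  also have "\<dots> = real (card A) * real (card (X - A)) * f A - (\<Sum>x\<in>A. \<Sum>y\<in>X - A. f (insert y (A - {x})))"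
    by (simp add: sum_subtractf)
  also have "real (card (X - A)) = real (card X) - real (card A)"
    using assms by (simp add: card_Diff_subset finA card_mono of_nat_diff)
  finally show ?thesis
    unfolding raise_lower[OF X] by (simp add: algebra_simps)
qed

section \<open>Multiplets\<close>

definition leveled :: "'a set \<Rightarrow> nat \<Rightarrow> ('a set \<Rightarrow> real) \<Rightarrow> bool" where
  "leveled X j f \<longleftrightarrow> (\<forall>A. \<not> (A \<subseteq> X \<and> card A = j) \<longrightarrow> f A = 0)"

definition highest :: "'a set \<Rightarrow> nat \<Rightarrow> ('a set \<Rightarrow> real) set" where
  "highest X j = {f. leveled X j f \<and> (\<forall>A. lower X f A = 0)}"

text \<open>The eigenvalue is written as the energy of the unit vector \<open>b\<close>, so that no
  separate spectrum has to be carried along.\<close>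

definition eigenfamily :: "'a set \<Rightarrow> ('a \<times> 'a) set \<Rightarrow> (nat \<Rightarrow> ('a set \<Rightarrow> real) set) \<Rightarrow> bool" where
  "eigenfamily X P B \<longleftrightarrow> (\<forall>j. B j \<subseteq> highest X j \<and> orthonormal (Pow X) (B j) \<and>
     (\<forall>b\<in>B j. \<forall>A. exch P b A = ip (Pow X) b (exch P b) * b A) \<and>
     (\<forall>f\<in>highest X j. \<forall>A\<in>Pow X. f A = (\<Sum>b\<in>B j. ip (Pow X) f b * b A)))"

lemma leveled_comb: "leveled X j f \<Longrightarrow> leveled X j g \<Longrightarrow> leveled X j (\<lambda>A. a * f A + b * g A)"
  by (simp add: leveled_def)

lemma highest_comb:
  "f \<in> highest X j \<Longrightarrow> g \<in> highest X j \<Longrightarrow> (\<lambda>A. a * f A + b * g A) \<in> highest X j"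
  by (simp add: highest_def leveled_comb lower_comb)

lemma leveled_raise:
  assumes "finite X" "leveled X j f"
  shows "leveled X (Suc j) (raise X f)"
  unfolding leveled_def
proof (intro allI impI)
  fix A assume A: "\<not> (A \<subseteq> X \<and> card A = Suc j)"
  have "f (A - {x}) = 0" if "x \<in> X \<inter> A" for x
  proof -
    have "\<not> (A - {x} \<subseteq> X \<and> card (A - {x}) = j)"
    proof
      assume *: "A - {x} \<subseteq> X \<and> card (A - {x}) = j"
      then have "A \<subseteq> X" using that by auto
      moreover have "finite A" using \<open>A \<subseteq> X\<close> assms(1) finite_subset by blast
      then have "card A = Suc j" using * that by (metis IntD2 card_Suc_Diff1)
      ultimately show False using A by blast
    qed
    then show ?thesis using assms(2) by (auto simp: leveled_def)
  qed
  then show "raise X f A = 0" by (simp add: raise_def)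
qed

lemma leveled_raise_funpow:
  "finite X \<Longrightarrow> leveled X j f \<Longrightarrow> leveled X (j + a) ((raise X ^^ a) f)"
  by (induction a) (auto intro: leveled_raise)

lemma leveled_lower:
  assumes "finite X" "leveled X (Suc j) f"
  shows "leveled X j (lower X f)"
  unfolding leveled_def
proof (intro allI impI)
  fix A assume A: "\<not> (A \<subseteq> X \<and> card A = j)"
  have "f (insert x A) = 0" if "x \<in> X - A" for x
  proof -
    have "\<not> (insert x A \<subseteq> X \<and> card (insert x A) = Suc j)"
    proof
      assume *: "insert x A \<subseteq> X \<and> card (insert x A) = Suc j"
      then have "finite A" using assms(1) by (meson finite_subset insert_subset)
      then show False using A * that by auto
    qed
    then show ?thesis using assms(2) by (auto simp: leveled_def)
  qed
  then show "lower X f A = 0" by (simp add: lower_def)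
qed

lemma lower_outside: "leveled X j f \<Longrightarrow> \<not> A \<subseteq> X \<Longrightarrow> lower X f A = 0"
  by (auto simp: lower_def leveled_def intro!: sum.neutral)

lemma leveled_0_highest: "finite X \<Longrightarrow> leveled X 0 f \<Longrightarrow> f \<in> highest X 0"
  unfolding highest_def
proof (intro CollectI conjI allI)
  fix A assume "finite X" and f: "leveled X 0 f"
  have "f (insert x A) = 0" for x
  proof (cases "insert x A \<subseteq> X")
    case True
    then have "finite (insert x A)" using \<open>finite X\<close> by (rule finite_subset)
    then have "card (insert x A) \<noteq> 0" by (metis card_0_eq insert_not_empty)
    then show ?thesis using f by (simp add: leveled_def)
  next
    case False
    then show ?thesis using f unfolding leveled_def by blast
  qed
  then show "lower X f A = 0" by (simp add: lower_def)
qed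

lemma leveled_exch: "P \<subseteq> X \<times> X \<Longrightarrow> leveled X j f \<Longrightarrow> leveled X j (exch P f)"
  unfolding leveled_def exch_def
proof (intro allI impI sum.neutral ballI, clarify)
  fix A x y
  assume "P \<subseteq> X \<times> X" and f: "\<forall>A. \<not> (A \<subseteq> X \<and> card A = j) \<longrightarrow> f A = 0"
    and A: "\<not> (A \<subseteq> X \<and> card A = j)" and "(x, y) \<in> P"
  then have "\<not> (transpose x y ` A \<subseteq> X \<and> card (transpose x y ` A) = j)"
    by (metis SigmaD1 SigmaD2 card_transpose_image subsetD transpose_image_subset_iff)
  then show "f A - f (transpose x y ` A) = 0" using f A by simp
qed

lemma ip_leveled_ne: "leveled X j f \<Longrightarrow> leveled X k g \<Longrightarrow> j \<noteq> k \<Longrightarrow> ip (Pow X) f g = 0"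
  unfolding ip_def by (rule sum.neutral) (auto simp: leveled_def)

lemma continuous_on_exch: "continuous_on UNIV (\<lambda>f. exch P f A)"
  unfolding exch_def case_prod_unfold by (intro continuous_intros continuous_on_product_coordinates)

lemma closed_highest: "closed (highest X j)"
proof -
  have "highest X j = (\<Inter>A\<in>{A. \<not> (A \<subseteq> X \<and> card A = j)}. {f. f A = 0}) \<inter> (\<Inter>A. {f. lower X f A = 0})"
    by (auto simp: highest_def leveled_def)
  moreover have "closed {f. f A = (0::real)}" for A :: "'a set"
    by (intro closed_Collect_eq continuous_intros continuous_on_product_coordinates)
  moreover have "closed {f. lower X f A = 0}" for A
    unfolding lower_def by (intro closed_Collect_eq continuous_intros continuous_on_product_coordinates)
  ultimately show ?thesis by (simp only:) (intro closed_Int closed_INT ballI)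
qed

lemma eigenfamily_exists:
  assumes "finite X" "P \<subseteq> X \<times> X"
  shows "\<exists>B. eigenfamily X P B"
proof -
  have "\<exists>B \<subseteq> highest X j. orthonormal (Pow X) B \<and> (\<forall>b\<in>B. \<forall>A. exch P b A = ip (Pow X) b (exch P b) * b A) \<and>
     (\<forall>f\<in>highest X j. \<forall>A\<in>Pow X. f A = (\<Sum>b\<in>B. ip (Pow X) f b * b A))" for j
  proof (rule orthonormal_eigenbasis)
    show "exch P f \<in> highest X j" if "f \<in> highest X j" for f
    proof -
      have "lower X (exch P f) A = 0" for A
        unfolding exch_lower[OF assms(2), symmetric] using that by (simp add: exch_def highest_def)
      then show ?thesis using that leveled_exch[OF assms(2)] by (auto simp: highest_def)
    qed
    show "finite (Pow X)" using assms by simp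
    show "f A = 0" if "f \<in> highest X j" "A \<notin> Pow X" for f A
      using that by (auto simp: highest_def leveled_def)
    show "(\<lambda>A. a * f A + b * g A) \<in> highest X j" if "f \<in> highest X j" "g \<in> highest X j" for f g a b
      using that by (rule highest_comb)
    show "closed (highest X j)" by (rule closed_highest)
    show "ip (Pow X) (exch P f) g = ip (Pow X) f (exch P g)" for f g
      by (rule exch_sym) fact
    show "exch P (\<lambda>A. a * f A + b * g A) = (\<lambda>A. a * exch P f A + b * exch P g A)" for f g a b
      by (rule exch_comb)
    show "continuous_on UNIV (\<lambda>f. exch P f A)" for A by (rule continuous_on_exch)
  qed
  then show ?thesis unfolding eigenfamily_def by (intro choice allI)
qed

text \<open>The factor in \<open>lower (raise\<^sup>a f) = a (n - 2 j - a + 1) raise\<^sup>a\<^sup>-\<^sup>1 f\<close> for \<open>f\<close> of highest weight at level \<open>j\<close>.\<close>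

definition ladder :: "nat \<Rightarrow> nat \<Rightarrow> nat \<Rightarrow> real" where
  "ladder n j a = real a * (real n - 2 * real j - real a + 1)"

lemma lower_raise_funpow:
  assumes X: "finite X" and f: "f \<in> highest X j" and A: "A \<subseteq> X"
  shows "lower X ((raise X ^^ Suc a) f) A = ladder (card X) j (Suc a) * (raise X ^^ a) f A"
  using A
proof (induction a arbitrary: A)
  case 0
  have "raise X (lower X f) A = 0" using f by (simp add: highest_def raise_def)
  moreover have "card A = j \<or> f A = 0" using f by (auto simp: highest_def leveled_def)
  ultimately show ?case using lower_raise[OF X 0, of f] by (auto simp: ladder_def)
next
  case (Suc a)
  let ?g = "(raise X ^^ Suc a) f"
  have "raise X (lower X ?g) A = ladder (card X) j (Suc a) * raise X ((raise X ^^ a) f) A"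
    unfolding raise_def[of _ "lower X ?g"] raise_def[of _ "(raise X ^^ a) f"] sum_distrib_left
    by (rule sum.cong[OF refl], rule Suc.IH) (use Suc.prems in auto)
  moreover have "card A = j + Suc a \<or> ?g A = 0"
    using leveled_raise_funpow[OF X, of j f "Suc a"] f by (auto simp: highest_def leveled_def)
  ultimately show ?case using lower_raise[OF X Suc.prems, of ?g]
    by (auto simp: ladder_def algebra_simps)
qed

lemma ip_raise_funpow_Suc:
  assumes X: "finite X" and g: "g \<in> highest X j'"
  shows "ip (Pow X) ((raise X ^^ Suc a) f) ((raise X ^^ Suc b) g)
    = ladder (card X) j' (Suc b) * ip (Pow X) ((raise X ^^ a) f) ((raise X ^^ b) g)"
proof -
  have "ip (Pow X) ((raise X ^^ Suc a) f) ((raise X ^^ Suc b) g)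
     = ip (Pow X) ((raise X ^^ a) f) (lower X ((raise X ^^ Suc b) g))"
    using raise_adjoint[OF X] by simp
  also have "\<dots> = ip (Pow X) ((raise X ^^ a) f) (\<lambda>A. ladder (card X) j' (Suc b) * (raise X ^^ b) g A)"
    by (intro ip_cong refl lower_raise_funpow assms) auto
  finally show ?thesis by (simp add: ip_scale_right)
qed

text \<open>Moving one \<open>raise\<close> across as \<open>lower\<close> strips a step from both
  sides at the price of a ladder factor; with unequal exponents a \<open>lower\<close> finally hits
  a highest weight vector.\<close>

lemma ip_raise_funpow:
  assumes X: "finite X" and f: "f \<in> highest X j" and g: "g \<in> highest X j'"
  shows "ip (Pow X) ((raise X ^^ a) f) ((raise X ^^ b) g)
    = (if a = b then (\<Prod>i<b. ladder (card X) j' (Suc i)) * ip (Pow X) f g else 0)"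
proof (induction b arbitrary: a)
  case 0
  have "ip (Pow X) ((raise X ^^ Suc a) f) g = 0" for a
  proof -
    have "ip (Pow X) ((raise X ^^ Suc a) f) g = ip (Pow X) ((raise X ^^ a) f) (lower X g)"
      using raise_adjoint[OF X] by simp
    then show ?thesis using g by (simp add: highest_def ip_def)
  qed
  then show ?case by (cases a) auto
next
  case (Suc b)
  show ?case
  proof (cases a)
    case 0
    have "ip (Pow X) f ((raise X ^^ Suc b) g) = ip (Pow X) (lower X f) ((raise X ^^ b) g)"
      using raise_adjoint[OF X] by (simp add: ip_commute)
    then show ?thesis using f 0 by (simp add: highest_def ip_def)
  next
    case (Suc a')
    then show ?thesis using ip_raise_funpow_Suc[OF X g, of a' f b] Suc.IH[of a'] by simp
  qed
qed

text \<open>Beyond the top of the multiplet the norm is \<open>0\<close>, and division by zero makes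
  the vector \<open>0\<close>. This lets \<open>a\<close> range over the same index set for all
  multiplets.\<close>

definition multiplet :: "'a set \<Rightarrow> ('a set \<Rightarrow> real) \<Rightarrow> nat \<Rightarrow> 'a set \<Rightarrow> real" where
  "multiplet X f a = (\<lambda>A. (1 / sqrt (ip (Pow X) ((raise X ^^ a) f) ((raise X ^^ a) f))) * (raise X ^^ a) f A)"

lemma leveled_multiplet:
  "finite X \<Longrightarrow> leveled X j f \<Longrightarrow> leveled X (j + a) (multiplet X f a)"
  using leveled_raise_funpow[of X j f a] by (simp add: leveled_def multiplet_def)

lemma ip_multiplet_orth:
  assumes "finite X" "f \<in> highest X j" "g \<in> highest X j'" "a \<noteq> b \<or> ip (Pow X) f g = 0"
  shows "ip (Pow X) (multiplet X f a) (multiplet X g b) = 0"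
  using assms(4) unfolding multiplet_def ip_scale_left ip_scale_right ip_raise_funpow[OF assms(1-3)] by auto

lemma ip_multiplet_self:
  assumes "finite X" "f \<in> highest X j" "A \<subseteq> X" "multiplet X f a A \<noteq> 0"
  shows "ip (Pow X) (multiplet X f a) (multiplet X f a) = 1"
proof -
  let ?g = "(raise X ^^ a) f"
  have "ip (Pow X) ?g ?g \<noteq> 0" using assms(4) by (auto simp: multiplet_def)
  then show ?thesis using ip_self_nonneg[of "Pow X" ?g]
    unfolding multiplet_def ip_scale_left ip_scale_right by simp
qed

lemma multiplet_0: "ip (Pow X) f f = 1 \<Longrightarrow> multiplet X f 0 = f"
  by (simp add: multiplet_def)

text \<open>The factor is the ratio of consecutive norms; it is positive as long as all ladder
  factors up to step \<open>a + 1\<close> are, that is, before the top of the multiplet.\<close>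

lemma raise_multiplet:
  assumes X: "finite X" and f: "f \<in> highest X j" "ip (Pow X) f f = 1"
  obtains r where "\<And>A. A \<subseteq> X \<Longrightarrow> raise X (multiplet X f a) A = r * multiplet X f (Suc a) A"
    "a + 2 * j < card X \<Longrightarrow> r \<noteq> 0"
proof -
  let ?g = "\<lambda>a. (raise X ^^ a) f"
  let ?N = "\<lambda>a. ip (Pow X) (?g a) (?g a)"
  let ?r = "sqrt (?N (Suc a)) / sqrt (?N a)"
  have "raise X (multiplet X f a) A = ?r * multiplet X f (Suc a) A" if A: "A \<subseteq> X" for A
  proof (cases "?N (Suc a) = 0")
    case True
    then have "?g (Suc a) A = 0" using ip_self_eq_0[of "Pow X"] A X by blast
    then show ?thesis unfolding multiplet_def raise_scale by simp
  next
    case False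
    then show ?thesis unfolding multiplet_def raise_scale by simp
  qed
  moreover have "?r \<noteq> 0" if "a + 2 * j < card X"
  proof -
    have "?N b > 0" if "b \<le> Suc a" for b
    proof -
      have "ladder (card X) j (Suc i) > 0" if "i < b" for i
        using that \<open>b \<le> Suc a\<close> \<open>a + 2 * j < card X\<close> by (simp add: ladder_def)
      then show ?thesis unfolding ip_raise_funpow[OF X f(1) f(1)] f(2) by (auto intro: prod_pos)
    qed
    from this[of a] this[of "Suc a"] show ?thesis by simp
  qed
  ultimately show ?thesis using that by blast
qed

text \<open>The squared norm of \<open>raise X f\<close> is \<open>n - 2 j\<close> and cannot be
  negative.\<close>

lemma highest_level_le:
  assumes X: "finite X" and f: "f \<in> highest X j" "ip (Pow X) f f = 1"
  shows "2 * j \<le> card X"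
proof (rule ccontr)
  assume "\<not> 2 * j \<le> card X"
  then have "ladder (card X) j (Suc 0) < 0" by (simp add: ladder_def)
  then show False
    using ip_self_nonneg[of "Pow X" "(raise X ^^ 1) f"] f(2) unfolding ip_raise_funpow[OF X f(1) f(1)] by simp
qed

text \<open>The ladder factor at step \<open>n - 2 j + 1\<close> is zero, so all norms from there on
  vanish.\<close>

lemma multiplet_overflow:
  assumes X: "finite X" and f: "f \<in> highest X j" "ip (Pow X) f f = 1"
    and a: "card X < a + 2 * j" and A: "A \<subseteq> X"
  shows "multiplet X f a A = 0"
proof -
  have j: "2 * j \<le> card X" using X f by (rule highest_level_le)
  let ?i = "card X - 2 * j"
  have "?i < a" "ladder (card X) j (Suc ?i) = 0" using a j by (auto simp: ladder_def of_nat_diff)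
  then have "(\<Prod>i<a. ladder (card X) j (Suc i)) = 0" by (auto intro!: prod_zero)
  then have "ip (Pow X) ((raise X ^^ a) f) ((raise X ^^ a) f) = 0"
    unfolding ip_raise_funpow[OF X f(1) f(1)] by simp
  then show ?thesis by (simp add: multiplet_def)
qed

lemma exch_multiplet:
  assumes "P \<subseteq> X \<times> X" "\<And>A. exch P f A = c * f A"
  shows "exch P (multiplet X f a) A = c * multiplet X f a A"
proof -
  have "exch P ((raise X ^^ a) f) A = c * (raise X ^^ a) f A" for A
  proof (induction a arbitrary: A)
    case (Suc a)
    have "exch P ((raise X ^^ a) f) = (\<lambda>A. c * (raise X ^^ a) f A)" using Suc by (rule ext)
    then have "exch P (raise X ((raise X ^^ a) f)) A = raise X (\<lambda>A. c * (raise X ^^ a) f A) A"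
      unfolding exch_raise[OF assms(1)] by (rule arg_cong)
    then show ?case by (simp add: raise_scale)
  qed (use assms in simp)
  then show ?thesis unfolding multiplet_def exch_scale by simp
qed

lemma casimir_highest:
  assumes "finite X" "f \<in> highest X j"
  shows "exch (X \<times> X) f A = 2 * (real j * (real (card X) - real j + 1)) * f A"
proof (cases "A \<subseteq> X \<and> card A = j")
  case True
  then show ?thesis using casimir[OF assms(1), of A f] assms(2) by (simp add: highest_def raise_def)
next
  case False
  then have "exch (X \<times> X) f A = 0" "f A = 0"
    using leveled_exch[of "X \<times> X" X j f] assms(2) by (auto simp: highest_def leveled_def)
  then show ?thesis by simp
qed

section \<open>Completeness of the multiplets generated by an eigenfamily\<close>

context
  fixes X :: "'a set" and P and B
  assumes X: "finite X" and B: "eigenfamily X P B"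
begin

lemma eigenfamily_highest: "f \<in> B j \<Longrightarrow> f \<in> highest X j"
  using B by (auto simp: eigenfamily_def)

lemma eigenfamily_leveled: "f \<in> B j \<Longrightarrow> leveled X j f"
  using B by (auto simp: eigenfamily_def highest_def)

lemma eigenfamily_finite: "finite (B j)"
  using B by (auto simp: eigenfamily_def orthonormal_def)

lemma eigenfamily_norm: "f \<in> B j \<Longrightarrow> ip (Pow X) f f = 1"
  using B by (auto simp: eigenfamily_def orthonormal_def)

lemma eigenfamily_orth: "f \<in> B j \<Longrightarrow> g \<in> B j' \<Longrightarrow> f \<noteq> g \<or> j \<noteq> j' \<Longrightarrow> ip (Pow X) f g = 0"
  using B eigenfamily_leveled ip_leveled_ne by (metis eigenfamily_def orthonormal_def)

lemma eigenfamily_expand: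
  "f \<in> highest X j \<Longrightarrow> A \<subseteq> X \<Longrightarrow> f A = (\<Sum>b\<in>B j. ip (Pow X) f b * b A)"
  using B by (auto simp: eigenfamily_def)

text \<open>Orthonormality in a form that tolerates zero vectors: the extra factor
  \<open>multiplet X g b A\<close> makes both sides vanish when the second vector is zero, where its
  norm would be \<open>0\<close> instead of \<open>1\<close>.\<close>

lemma ip_multiplet:
  assumes f: "f \<in> B j" and g: "g \<in> B j'" and A: "A \<subseteq> X"
  shows "ip (Pow X) (multiplet X f a) (multiplet X g b) * multiplet X g b A
    = (if f = g \<and> j = j' \<and> a = b then multiplet X g b A else 0)"
proof (cases "f = g \<and> j = j' \<and> a = b")
  case True
  then show ?thesis using ip_multiplet_self[OF X eigenfamily_highest[OF f] A, of a] by auto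
next
  case False
  then have "ip (Pow X) (multiplet X f a) (multiplet X g b) = 0"
    using ip_multiplet_orth[OF X eigenfamily_highest[OF f] eigenfamily_highest[OF g], of a b]
      eigenfamily_orth[OF f g] by blast
  then show ?thesis using False by auto
qed

text \<open>Subtract from \<open>F\<close> its components in the multiplets starting below level
  \<open>k\<close>. The remainder \<open>R\<close> turns out to be of highest weight, so the
  eigenbasis of level \<open>k\<close> expands it.\<close>

lemma leveled_expand:
  assumes "leveled X k F" "A \<subseteq> X"
  shows "F A = (\<Sum>j\<le>k. \<Sum>f\<in>B j. ip (Pow X) F (multiplet X f (k - j)) * multiplet X f (k - j) A)"
  using assms
proof (induction k arbitrary: F A rule: less_induct)
  case (less k)
  let ?v = "\<lambda>j f. multiplet X f (k - j)"
  let ?I = "Sigma {..<k} B"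
  define R where "R = (\<lambda>A. F A - (\<Sum>(j,f)\<in>?I. ip (Pow X) F (?v j f) * ?v j f A))"
  have sumI: "(\<Sum>(j,f)\<in>?I. G j f) = (\<Sum>j<k. \<Sum>f\<in>B j. G j f)" for G :: "nat \<Rightarrow> ('a set \<Rightarrow> real) \<Rightarrow> real"
    by (rule sum.Sigma[symmetric]) (auto simp: eigenfamily_finite)
  have lv: "leveled X k (?v j f)" if "j \<le> k" "f \<in> B j" for j f
    using leveled_multiplet[OF X eigenfamily_leveled[OF that(2)], of "k - j"] that by simp
  have levR: "leveled X k R"
  proof -
    have "R A = 0" if A: "\<not> (A \<subseteq> X \<and> card A = k)" for A
    proof -
      have "F A = 0" using less.prems(1) A unfolding leveled_def by blast
      moreover have "?v j f A = 0" if "j < k" "f \<in> B j" for j f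
        using lv[of j f] that A unfolding leveled_def by simp
      ultimately show ?thesis unfolding R_def by (auto intro!: sum.neutral)
    qed
    then show ?thesis by (simp add: leveled_def)
  qed
  have ipR: "ip (Pow X) R (?v j f) = ip (Pow X) F (?v j f) - (if j < k then ip (Pow X) F (?v j f) else 0)"
    if j: "j \<le> k" and f: "f \<in> B j" for j f
  proof -
    have "ip (Pow X) R (?v j f) = ip (Pow X) F (?v j f)
        - (\<Sum>(j',g)\<in>?I. ip (Pow X) F (?v j' g) * ip (Pow X) (?v j' g) (?v j f))"
      unfolding R_def ip_diff_left case_prod_unfold ip_sum_left ip_scale_left ..
    also have "(\<Sum>(j',g)\<in>?I. ip (Pow X) F (?v j' g) * ip (Pow X) (?v j' g) (?v j f))
      = (\<Sum>p\<in>?I. if p = (j, f) then ip (Pow X) F (?v j f) else 0)"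
    proof (rule sum.cong[OF refl])
      fix p assume "p \<in> ?I"
      then obtain j' g where p: "p = (j', g)" and j': "j' < k" and g: "g \<in> B j'" by auto
      have "ip (Pow X) F (?v j' g) * ip (Pow X) (?v j' g) (?v j f)
        = ip (Pow X) F (\<lambda>A. ip (Pow X) (?v j f) (?v j' g) * ?v j' g A)"
        by (simp add: ip_scale_right ip_commute)
      also have "\<dots> = ip (Pow X) F (\<lambda>A. if f = g \<and> j = j' \<and> k - j = k - j' then ?v j' g A else 0)"
        by (rule ip_cong) (auto simp: ip_multiplet[OF f g])
      finally show "(case p of (j', g) \<Rightarrow> ip (Pow X) F (?v j' g) * ip (Pow X) (?v j' g) (?v j f))
          = (if p = (j, f) then ip (Pow X) F (?v j f) else 0)"
        unfolding p by (auto simp: ip_def)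
    qed
    also have "\<dots> = (if j < k then ip (Pow X) F (?v j f) else 0)"
      using f by (subst sum.delta) (auto intro!: finite_SigmaI eigenfamily_finite)
    finally show ?thesis .
  qed
  have "R \<in> highest X k"
  proof (cases k)
    case 0
    then show ?thesis using levR leveled_0_highest[OF X] by simp
  next
    case (Suc m)
    \<comment> \<open>The squared norm of \<open>?D\<close> is the inner product of \<open>R\<close>
      with \<open>raise X ?D\<close>. By induction \<open>?D\<close> is a combination of multiplet
      vectors on level \<open>m\<close>; raised, they are the level \<open>k\<close> vectors of the
      same multiplets, to which \<open>R\<close> is orthogonal by construction.\<close>
    let ?D = "lower X R"
    have lev: "leveled X m ?D" using levR Suc X by (auto intro: leveled_lower)
    let ?w = "\<lambda>j f. multiplet X f (m - j)"
    have "raise X ?D A = (\<Sum>(j,f)\<in>?I. ip (Pow X) ?D (?w j f) * raise X (?w j f) A)" if "A \<subseteq> X" for A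
    proof -
      have "raise X ?D A = (\<Sum>x\<in>X \<inter> A. \<Sum>(j,f)\<in>?I. ip (Pow X) ?D (?w j f) * ?w j f (A - {x}))"
        unfolding raise_def[of _ ?D] sumI using that Suc
        by (intro sum.cong[OF refl]) (subst less.IH[of m, OF _ lev], auto simp: lessThan_Suc_atMost)
      then show ?thesis unfolding raise_def[of _ "multiplet _ _ _"]
        by (subst (asm) sum.swap) (simp add: sum_distrib_left case_prod_unfold)
    qed
    then have "ip (Pow X) R (raise X ?D)
      = ip (Pow X) R (\<lambda>A. \<Sum>(j,f)\<in>?I. ip (Pow X) ?D (?w j f) * raise X (?w j f) A)"
      by (intro ip_cong) auto
    also have "\<dots> = (\<Sum>(j,f)\<in>?I. ip (Pow X) ?D (?w j f) * ip (Pow X) R (raise X (?w j f)))"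
      unfolding case_prod_unfold ip_sum_right ip_scale_right ..
    also have "\<dots> = 0"
    proof (rule sum.neutral, intro ballI)
      fix p assume "p \<in> ?I"
      then obtain j f where p: "p = (j, f)" and j: "j < k" and f: "f \<in> B j" by auto
      obtain r where r: "\<And>A. A \<subseteq> X \<Longrightarrow> raise X (?w j f) A = r * multiplet X f (Suc (m - j)) A"
        using raise_multiplet[OF X eigenfamily_highest[OF f] eigenfamily_norm[OF f]] by metis
      have "ip (Pow X) R (raise X (?w j f)) = ip (Pow X) R (\<lambda>A. r * ?v j f A)"
        using r j Suc by (intro ip_cong) (auto simp: Suc_diff_le)
      also have "\<dots> = 0" using ipR[of j f] j f by (simp add: ip_scale_right)
      finally show "(case p of (j, f) \<Rightarrow> ip (Pow X) ?D (?w j f) * ip (Pow X) R (raise X (?w j f))) = 0"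
        by (simp add: p)
    qed
    finally have "ip (Pow X) ?D ?D = 0"
      using raise_adjoint[OF X, of ?D R] by (simp add: ip_commute)
    then have "?D A = 0" for A
      using ip_self_eq_0[of "Pow X" ?D A] lower_outside[OF levR, of A] X by blast
    then show ?thesis using levR by (simp add: highest_def)
  qed
  then have "R A = (\<Sum>f\<in>B k. ip (Pow X) R f * f A)"
    using less.prems(2) by (rule eigenfamily_expand)
  also have "\<dots> = (\<Sum>f\<in>B k. ip (Pow X) F (?v k f) * ?v k f A)"
    using ipR[of k] by (intro sum.cong refl) (simp add: multiplet_0 eigenfamily_norm)
  finally show ?case
    unfolding R_def sumI lessThan_Suc_atMost[symmetric] by simp
qed

definition multiplet_index :: "(nat \<times> ('a set \<Rightarrow> real) \<times> nat) set" where
  "multiplet_index = Sigma {..card X} (\<lambda>j. B j \<times> {..card X})"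

lemma finite_multiplet_index: "finite multiplet_index"
  unfolding multiplet_index_def by (intro finite_SigmaI finite_cartesian_product eigenfamily_finite) auto

text \<open>Expansion of the indicator of \<open>A\<close>, evaluated at \<open>C\<close>. At most
  one vector of each multiplet lives on the level of \<open>A\<close>.\<close>

lemma multiplet_resolution:
  assumes A: "A \<subseteq> X" and C: "C \<subseteq> X"
  shows "(\<Sum>(j,f,a)\<in>multiplet_index. multiplet X f a A * multiplet X f a C) = (if A = C then 1 else 0)"
proof -
  let ?k = "card A"
  have k: "?k \<le> card X" using X A by (rule card_mono)
  have "(\<Sum>(j,f,a)\<in>multiplet_index. multiplet X f a A * multiplet X f a C)
     = (\<Sum>j\<le>card X. \<Sum>f\<in>B j. \<Sum>a\<le>card X. multiplet X f a A * multiplet X f a C)"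
    unfolding multiplet_index_def
    by (subst sum.Sigma[symmetric]) (auto simp: eigenfamily_finite sum.cartesian_product case_prod_unfold)
  also have "\<dots> = (\<Sum>j\<le>card X. \<Sum>f\<in>B j. if j \<le> ?k then multiplet X f (?k - j) A * multiplet X f (?k - j) C else 0)"
  proof (intro sum.cong refl)
    fix j f assume f: "f \<in> B j"
    have "multiplet X f a A = 0" if "j + a \<noteq> ?k" for a
      using leveled_multiplet[OF X eigenfamily_leveled[OF f], of a] that by (auto simp: leveled_def)
    then have "(\<Sum>a\<le>card X. multiplet X f a A * multiplet X f a C)
      = (\<Sum>a\<le>card X. if a = ?k - j then (if j \<le> ?k then multiplet X f (?k - j) A * multiplet X f (?k - j) C else 0) else 0)"
      by (intro sum.cong refl) auto
    then show "(\<Sum>a\<le>card X. multiplet X f a A * multiplet X f a C)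
       = (if j \<le> ?k then multiplet X f (?k - j) A * multiplet X f (?k - j) C else 0)"
    proof -
      have "?k - j \<le> card X" using k by simp
      then show ?thesis using \<open>_ = (\<Sum>a\<le>card X. if a = ?k - j then _ else 0)\<close> by simp
    qed
  qed
  also have "\<dots> = (\<Sum>j\<le>?k. \<Sum>f\<in>B j. multiplet X f (?k - j) A * multiplet X f (?k - j) C)"
    using k by (intro sum.mono_neutral_cong_right) (auto simp: eigenfamily_finite)
  also have "\<dots> = (\<Sum>j\<le>?k. \<Sum>f\<in>B j. ip (Pow X) (indicator {A}) (multiplet X f (?k - j)) * multiplet X f (?k - j) C)"
    using A X by (simp add: ip_delta)
  also have "\<dots> = indicator {A} C"
    using C A by (intro leveled_expand[symmetric]) (auto simp: leveled_def indicator_def)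
  finally show ?thesis by (auto simp: indicator_def)
qed

end

section \<open>Parseval frames and tensor products\<close>

text \<open>A Parseval frame of the functions on \<open>S\<close>: an orthonormal basis, possibly together with
  zero vectors.\<close>

definition frame :: "'a set \<Rightarrow> 'i set \<Rightarrow> ('i \<Rightarrow> 'a \<Rightarrow> real) \<Rightarrow> bool" where
  "frame S I e \<longleftrightarrow> finite S \<and> finite I \<and>
     (\<forall>x\<in>S. \<forall>y\<in>S. (\<Sum>i\<in>I. e i x * e i y) = (if x = y then 1 else 0))"

lemma frame_parseval:
  assumes "frame S I e"
  shows "(\<Sum>i\<in>I. ip S f (e i) * ip S g (e i)) = ip S f g"
proof -
  have "(\<Sum>i\<in>I. ip S f (e i) * ip S g (e i)) = (\<Sum>i\<in>I. \<Sum>x\<in>S. \<Sum>y\<in>S. f x * g y * (e i x * e i y))"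
    by (simp add: ip_def sum_product mult_ac)
  also have "\<dots> = (\<Sum>x\<in>S. \<Sum>i\<in>I. \<Sum>y\<in>S. f x * g y * (e i x * e i y))"
    by (rule sum.swap)
  also have "\<dots> = (\<Sum>x\<in>S. \<Sum>y\<in>S. \<Sum>i\<in>I. f x * g y * (e i x * e i y))"
    by (intro sum.cong refl sum.swap)
  also have "\<dots> = (\<Sum>x\<in>S. \<Sum>y\<in>S. f x * g y * (\<Sum>i\<in>I. e i x * e i y))"
    by (simp add: sum_distrib_left)
  also have "\<dots> = (\<Sum>x\<in>S. \<Sum>y\<in>S. if x = y then f x * g y else 0)"
    using assms by (intro sum.cong refl) (simp add: frame_def)
  also have "\<dots> = ip S f g"
    using assms by (simp add: ip_def frame_def)
  finally show ?thesis .
qed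

text \<open>Expand the squares of \<open>c i - ip S h (e i)\<close>, which sum to something
  nonnegative; Parseval bounds the squared coefficients of \<open>h\<close> by its norm, even when
  only \<open>J\<close> is kept.\<close>

lemma frame_synthesis:
  assumes fr: "frame S I e" and J: "J \<subseteq> I"
  shows "ip S (\<lambda>x. \<Sum>i\<in>J. c i * e i x) (\<lambda>x. \<Sum>i\<in>J. c i * e i x) \<le> (\<Sum>i\<in>J. (c i)\<^sup>2)"
proof -
  define h where "h = (\<lambda>x. \<Sum>i\<in>J. c i * e i x)"
  have hh: "ip S h h = (\<Sum>i\<in>J. c i * ip S h (e i))"
    by (subst (2) h_def) (simp add: ip_sum_right ip_scale_right)
  have "(\<Sum>i\<in>J. (ip S h (e i))\<^sup>2) \<le> (\<Sum>i\<in>I. (ip S h (e i))\<^sup>2)"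
    using fr J by (intro sum_mono2) (auto simp: frame_def)
  also have "\<dots> = ip S h h" using frame_parseval[OF fr, of h h] by (simp add: power2_eq_square)
  finally have 1: "(\<Sum>i\<in>J. (ip S h (e i))\<^sup>2) \<le> ip S h h" .
  have "0 \<le> (\<Sum>i\<in>J. (c i - ip S h (e i))\<^sup>2)" by (intro sum_nonneg) auto
  also have "\<dots> = (\<Sum>i\<in>J. (c i)\<^sup>2) - 2 * (\<Sum>i\<in>J. c i * ip S h (e i)) + (\<Sum>i\<in>J. (ip S h (e i))\<^sup>2)"
    by (simp add: power2_diff sum.distrib sum_subtractf sum_distrib_left mult.assoc)
  finally show ?thesis using 1 hh unfolding h_def[symmetric] by linarith
qed

lemma frame_sym_eigen:
  assumes fr: "frame S I e" and sym: "\<And>i. i \<in> I \<Longrightarrow> ip S (T f) (e i) = ip S f (T (e i))"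
    and eig: "\<And>i x. i \<in> I \<Longrightarrow> x \<in> S \<Longrightarrow> T (e i) x = c i * e i x"
  shows "ip S f (T f) = (\<Sum>i\<in>I. (ip S f (e i))\<^sup>2 * c i)"
proof -
  have "ip S (T f) (e i) = c i * ip S f (e i)" if "i \<in> I" for i
  proof -
    have "ip S (T f) (e i) = ip S f (\<lambda>x. c i * e i x)"
      unfolding sym[OF that] by (intro ip_cong) (auto simp: eig that)
    then show ?thesis by (simp add: ip_scale_right)
  qed
  then show ?thesis
    using frame_parseval[OF fr, of f "T f"] by (simp add: power2_eq_square mult_ac)
qed

text \<open>The tangent of \<open>exp\<close> at the mean lies below the graph. Applied to squared
  coefficients in a frame as weights, this is Peierls' inequality.\<close>

lemma jensen_exp:
  fixes w b :: "'i \<Rightarrow> real"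
  assumes "finite I" "\<And>i. i \<in> I \<Longrightarrow> 0 \<le> w i" "(\<Sum>i\<in>I. w i) = 1" "(\<Sum>i\<in>I. w i * b i) \<le> m" "0 \<le> t"
  shows "exp (- t * m) \<le> (\<Sum>i\<in>I. w i * exp (- t * b i))"
proof -
  define s where "s = (\<Sum>i\<in>I. w i * b i)"
  have "exp (- t * m) \<le> exp (- t * s)" using assms by (simp add: mult_left_mono s_def)
  also have "\<dots> = exp (- t * s) * (\<Sum>i\<in>I. w i * (1 + (- t * b i - - t * s)))"
  proof -
    have "(\<Sum>i\<in>I. w i * (1 + (- t * b i - - t * s))) = (\<Sum>i\<in>I. w i * (1 + t * s) - t * (w i * b i))"
      by (intro sum.cong refl) (simp add: algebra_simps)
    also have "\<dots> = (\<Sum>i\<in>I. w i) * (1 + t * s) - t * s"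
      unfolding s_def by (simp only: sum_subtractf sum_distrib_left sum_distrib_right)
    finally show ?thesis using assms by simp
  qed
  also have "\<dots> = (\<Sum>i\<in>I. w i * (exp (- t * s) * (1 + (- t * b i - - t * s))))"
    by (simp add: sum_distrib_left mult_ac)
  also have "\<dots> \<le> (\<Sum>i\<in>I. w i * exp (- t * b i))"
  proof (intro sum_mono mult_left_mono assms(2))
    fix i assume "i \<in> I"
    have "exp (- t * s) * (1 + (- t * b i - - t * s)) \<le> exp (- t * s) * exp (- t * b i - - t * s)"
      by (intro mult_left_mono exp_ge_add_one_self) auto
    also have "\<dots> = exp (- t * b i)" by (simp add: exp_add[symmetric])
    finally show "exp (- t * s) * (1 + (- t * b i - - t * s)) \<le> exp (- t * b i)" .
  qed
  finally show ?thesis .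
qed

text \<open>For disjoint \<open>L\<close> and \<open>R\<close> a subset of the union is a pair of
  subsets, so these products span the tensor product of the two function spaces.\<close>

definition tensor :: "'a set \<Rightarrow> 'a set \<Rightarrow> ('a set \<Rightarrow> real) \<Rightarrow> ('a set \<Rightarrow> real) \<Rightarrow> 'a set \<Rightarrow> real" where
  "tensor L R f g A = f (A \<inter> L) * g (A \<inter> R)"

lemma frame_tensor:
  assumes "frame (Pow L) I e" "frame (Pow R) J d" "L \<inter> R = {}"
  shows "frame (Pow (L \<union> R)) (I \<times> J) (\<lambda>(i,j). tensor L R (e i) (d j))"
  unfolding frame_def
proof (intro conjI ballI)
  show "finite (Pow (L \<union> R))" "finite (I \<times> J)" using assms by (auto simp: frame_def)
  fix A C assume A: "A \<in> Pow (L \<union> R)" and C: "C \<in> Pow (L \<union> R)"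
  have "(\<Sum>p\<in>I \<times> J. (case p of (i,j) \<Rightarrow> tensor L R (e i) (d j)) A * (case p of (i,j) \<Rightarrow> tensor L R (e i) (d j)) C)
     = (\<Sum>i\<in>I. e i (A \<inter> L) * e i (C \<inter> L)) * (\<Sum>j\<in>J. d j (A \<inter> R) * d j (C \<inter> R))"
    by (simp add: sum_product sum.cartesian_product tensor_def case_prod_unfold mult_ac)
  also have "\<dots> = (if A \<inter> L = C \<inter> L then 1 else 0) * (if A \<inter> R = C \<inter> R then 1 else 0)"
    using assms by (simp add: frame_def)
  also have "\<dots> = (if A = C then 1 else 0)"
  proof -
    have "A \<inter> L = C \<inter> L \<and> A \<inter> R = C \<inter> R \<longleftrightarrow> A = C" using A C by blast
    then show ?thesis by auto
  qed
  finally show "(\<Sum>p\<in>I \<times> J. (case p of (i,j) \<Rightarrow> tensor L R (e i) (d j)) A * (case p of (i,j) \<Rightarrow> tensor L R (e i) (d j)) C)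
     = (if A = C then 1 else 0)" .
qed

lemma exch_tensor_left:
  assumes "L \<inter> R = {}" "P \<subseteq> L \<times> L"
  shows "exch P (tensor L R f g) A = tensor L R (exch P f) g A"
proof -
  have "transpose x y ` A \<inter> L = transpose x y ` (A \<inter> L)" "transpose x y ` A \<inter> R = A \<inter> R"
    if "(x, y) \<in> P" for x y
  proof -
    have xy: "x \<in> L" "y \<in> L" "x \<notin> R" "y \<notin> R" using assms that by auto
    show "transpose x y ` A \<inter> L = transpose x y ` (A \<inter> L)"
      using transpose_image_eq[of x L y] xy by (simp add: image_Int)
    have "transpose x y ` A \<inter> R = transpose x y ` (A \<inter> R)"
      using transpose_image_eq[of x R y] xy by (simp add: image_Int)
    also have "\<dots> = A \<inter> R" using xy by (intro transpose_image_eq) auto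
    finally show "transpose x y ` A \<inter> R = A \<inter> R" .
  qed
  then show ?thesis
    unfolding exch_def tensor_def sum_distrib_right
    by (intro sum.cong refl) (auto simp: left_diff_distrib)
qed

lemma tensor_swap: "tensor L R f g = tensor R L g f"
  by (rule ext) (simp add: tensor_def)

lemma exch_tensor_right:
  "L \<inter> R = {} \<Longrightarrow> P \<subseteq> R \<times> R \<Longrightarrow> exch P (tensor L R f g) A = tensor L R f (exch P g) A"
  unfolding tensor_swap[of L] by (rule exch_tensor_left) auto

lemma raise_tensor:
  assumes "finite L" "finite R" "L \<inter> R = {}"
  shows "raise (L \<union> R) (tensor L R f g) A = tensor L R (raise L f) g A + tensor L R f (raise R g) A"
proof -
  have "raise (L \<union> R) (tensor L R f g) A
     = (\<Sum>x\<in>L \<inter> A. tensor L R f g (A - {x})) + (\<Sum>x\<in>R \<inter> A. tensor L R f g (A - {x}))"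
    unfolding raise_def Int_Un_distrib2 by (rule sum.union_disjoint) (use assms in auto)
  also have "(\<Sum>x\<in>L \<inter> A. tensor L R f g (A - {x})) = (\<Sum>x\<in>L \<inter> (A \<inter> L). f (A \<inter> L - {x}) * g (A \<inter> R))"
    unfolding tensor_def
  proof (rule sum.cong)
    fix x assume "x \<in> L \<inter> (A \<inter> L)"
    then have "(A - {x}) \<inter> L = A \<inter> L - {x}" "(A - {x}) \<inter> R = A \<inter> R" using assms by auto
    then show "f ((A - {x}) \<inter> L) * g ((A - {x}) \<inter> R) = f (A \<inter> L - {x}) * g (A \<inter> R)" by simp
  qed auto
  also have "(\<Sum>x\<in>R \<inter> A. tensor L R f g (A - {x})) = (\<Sum>x\<in>R \<inter> (A \<inter> R). f (A \<inter> L) * g (A \<inter> R - {x}))"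
    unfolding tensor_def
  proof (rule sum.cong)
    fix x assume "x \<in> R \<inter> (A \<inter> R)"
    then have "(A - {x}) \<inter> R = A \<inter> R - {x}" "(A - {x}) \<inter> L = A \<inter> L" using assms by auto
    then show "f ((A - {x}) \<inter> L) * g ((A - {x}) \<inter> R) = f (A \<inter> L) * g (A \<inter> R - {x})" by simp
  qed auto
  finally show ?thesis by (simp add: tensor_def raise_def sum_distrib_left sum_distrib_right)
qed

lemma tensor_leveled:
  assumes "finite L" "finite R" "L \<inter> R = {}" "leveled L i f" "leveled R j g" "A \<subseteq> L \<union> R" "card A \<noteq> i + j"
  shows "tensor L R f g A = 0"
proof -
  have "(A \<inter> L) \<union> (A \<inter> R) = A" using assms by auto
  moreover have "(A \<inter> L) \<inter> (A \<inter> R) = {}" using assms by auto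
  ultimately have "card A = card (A \<inter> L) + card (A \<inter> R)"
    using card_Un_disjoint[of "A \<inter> L" "A \<inter> R"] assms(1,2) by simp
  then have "card (A \<inter> L) \<noteq> i \<or> card (A \<inter> R) \<noteq> j" using assms(7) by linarith
  then have "f (A \<inter> L) = 0 \<or> g (A \<inter> R) = 0" using assms(4,5) unfolding leveled_def by blast
  then show ?thesis by (auto simp: tensor_def)
qed

section \<open>Splitting the partition function\<close>

text \<open>Half the difference of the Casimir eigenvalues of the whole and of the two halves.
  Writing \<open>j = j1 + j2 + l\<close> splits it into three terms; the first two are nonnegative
  because near balance and \<open>2 * j \<le> n1 + n2\<close> force \<open>j\<close> below both
  \<open>n1\<close> and \<open>n2\<close>.\<close>

lemma casimir_gap:
  fixes n1 n2 j j1 j2 :: nat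
  assumes "n1 \<le> n2" "n2 \<le> Suc n1" "2 * j \<le> n1 + n2" "j1 + j2 \<le> j"
  shows "real (j - j1 - j2) * real (n1 + n2) / 2
    \<le> real j * (real (n1 + n2) - real j + 1) - real j1 * (real n1 - real j1 + 1) - real j2 * (real n2 - real j2 + 1)"
proof -
  obtain l where j: "j = j1 + j2 + l" using assms(4) le_Suc_ex by blast
  have "j \<le> n1" "j \<le> n2" using assms by auto
  have *: "real j * (real (n1 + n2) - real j + 1) - real j1 * (real n1 - real j1 + 1) - real j2 * (real n2 - real j2 + 1)
    = real j1 * (real n2 - real j + real j1) + real j2 * (real n1 - real j + real j2) + real l * (real (n1 + n2) - real j + 1)"
    by (simp add: j algebra_simps)
  have "real l * (real (n1 + n2) / 2) \<le> real l * (real (n1 + n2) - real j + 1)"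
    using assms by (intro mult_left_mono) auto
  moreover have "0 \<le> real j1 * (real n2 - real j + real j1)" "0 \<le> real j2 * (real n1 - real j + real j2)"
    using \<open>j \<le> n1\<close> \<open>j \<le> n2\<close> by (auto intro!: mult_nonneg_nonneg)
  ultimately show ?thesis unfolding * by (simp add: j)
qed

text \<open>Only highest weight vectors enter, each multiplet once; the sum therefore dominates the
  trace on every single level.\<close>

definition partition_fun :: "'a set \<Rightarrow> ('a \<times> 'a) set \<Rightarrow> (nat \<Rightarrow> ('a set \<Rightarrow> real) set) \<Rightarrow> real \<Rightarrow> real" where
  "partition_fun X P B t = (\<Sum>(j,f)\<in>Sigma {..card X} B. exp (- t * ip (Pow X) f (exch P f)))"

lemma frame_multiplet:
  assumes "finite X" "eigenfamily X P B"
  shows "frame (Pow X) (multiplet_index X B) (\<lambda>(j,f,a). multiplet X f a)"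
  using multiplet_resolution[OF assms] finite_multiplet_index[OF assms] assms(1)
  by (simp add: frame_def case_prod_unfold)

lemma exch_cross:
  assumes "finite L" "finite R" "L \<inter> R = {}"
  shows "2 * exch (L \<times> R) F A = exch ((L \<union> R) \<times> (L \<union> R)) F A - exch (L \<times> L) F A - exch (R \<times> R) F A"
proof -
  have "exch (R \<times> L) F A = (\<Sum>p\<in>R \<times> L. F A - F (transpose (snd p) (fst p) ` A))"
    by (simp add: exch_def case_prod_unfold transpose_commute)
  also have "\<dots> = exch (L \<times> R) F A"
    unfolding exch_def
    by (rule sum.reindex_bij_witness[where i = prod.swap and j = prod.swap]) auto
  finally have RL: "exch (R \<times> L) F A = exch (L \<times> R) F A" .
  have "(L \<union> R) \<times> (L \<union> R) = ((L \<times> L) \<union> (R \<times> R)) \<union> ((L \<times> R) \<union> (R \<times> L))" by auto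
  moreover have "exch (((L \<times> L) \<union> (R \<times> R)) \<union> ((L \<times> R) \<union> (R \<times> L))) F A
    = (exch (L \<times> L) F A + exch (R \<times> R) F A) + (exch (L \<times> R) F A + exch (R \<times> L) F A)"
    using assms by (subst exch_Un, auto)+
  ultimately show ?thesis using RL by simp
qed

lemma sum_multiplet_index:
  assumes "finite X" "eigenfamily X P B"
  shows "(\<Sum>(j,f,a)\<in>multiplet_index X B. G j f a) = (\<Sum>(j,f)\<in>Sigma {..card X} B. \<Sum>a\<le>card X. (G j f a :: real))"
  unfolding multiplet_index_def[OF assms]
  by (subst (1 2) sum.Sigma[symmetric])
     (auto simp: eigenfamily_finite[OF assms] sum.cartesian_product case_prod_unfold)

lemma geometric_tail_le:
  fixes q :: real
  assumes "0 \<le> q" "q < 1"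
  shows "(\<Sum>j\<le>n. if s \<le> j then q ^ (j - s) else 0) \<le> 1 / (1 - q)"
proof -
  have "(\<Sum>j\<le>n. if s \<le> j then q ^ (j - s) else 0) = (\<Sum>j\<in>{s..n}. q ^ (j - s))"
    by (intro sum.mono_neutral_cong_right) auto
  also have "\<dots> = (\<Sum>l\<in>(\<lambda>j. j - s) ` {s..n}. q ^ l)"
    by (subst sum.reindex) (auto simp: inj_on_def)
  also have "\<dots> \<le> (\<Sum>l\<le>n. q ^ l)"
    using assms by (intro sum_mono2) auto
  also have "\<dots> = (1 - q ^ Suc n) / (1 - q)"
    using assms by (simp add: sum_gp0)
  also have "\<dots> \<le> 1 / (1 - q)"
    using assms by (intro divide_right_mono) auto
  finally show ?thesis .
qed

text \<open>One step of the recursion, with bonds abstract. \<open>K\<close> is the constant by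
  which all exchanges across the cut are dominated by the energy of the whole.\<close>

locale bisection =
  fixes L R :: "'a set" and EL ER E :: "('a \<times> 'a) set"
    and BL BR B :: "nat \<Rightarrow> ('a set \<Rightarrow> real) set" and K :: real
  assumes finL: "finite L" and finR: "finite R" and disj: "L \<inter> R = {}"
    and EL: "EL \<subseteq> L \<times> L" and ER: "ER \<subseteq> R \<times> R"
    and E: "E \<subseteq> (L \<union> R) \<times> (L \<union> R)" "EL \<union> ER \<subseteq> E"
    and BL: "eigenfamily L EL BL" and BR: "eigenfamily R ER BR" and B: "eigenfamily (L \<union> R) E B"
    and card_LR: "card L \<le> card R" "card R \<le> Suc (card L)"
    and K: "K > 0" "\<And>F. ip (Pow (L \<union> R)) F (exch (L \<times> R) F) \<le> K * ip (Pow (L \<union> R)) F (exch E F)"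
begin

abbreviation (input) "X \<equiv> L \<union> R"
abbreviation (input) "prodvec f a g b \<equiv> tensor L R (multiplet L f a) (multiplet R g b)"
abbreviation (input) "coef F f a g b \<equiv> ip (Pow (L \<union> R)) F (tensor L R (multiplet L f a) (multiplet R g b))"

lemma finX: "finite X" using finL finR by simp

lemma coef_level:
  assumes "leveled X j F" "f \<in> BL j1" "g \<in> BR j2" "j \<noteq> j1 + a + (j2 + b)"
  shows "coef F f a g b = 0"
proof -
  have "F A * prodvec f a g b A = 0" if A: "A \<in> Pow X" for A
  proof (cases "card A = j")
    case True
    then have "prodvec f a g b A = 0"
      using A assms(4) by (intro tensor_leveled[OF finL finR disj])
        (auto intro: leveled_multiplet finL finR eigenfamily_leveled[OF finL BL] eigenfamily_leveled[OF finR BR] assms)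
    then show ?thesis by simp
  next
    case False
    then show ?thesis using assms(1) unfolding leveled_def by simp
  qed
  then show ?thesis unfolding ip_def by (intro sum.neutral) blast
qed

text \<open>\<open>lower\<close> annihilates \<open>F\<close>, so \<open>F\<close> is orthogonal to
  everything raised; raising a product vector raises either of its two factors.\<close>

lemma coef_recursion:
  assumes F: "F \<in> highest X j" and f: "f \<in> BL j1" and g: "g \<in> BR j2"
  obtains r r' where "r * coef F f (Suc a) g b + r' * coef F f a g (Suc b) = 0"
    "a + 2 * j1 < card L \<Longrightarrow> r \<noteq> 0"
proof -
  obtain r where r: "\<And>A. A \<subseteq> L \<Longrightarrow> raise L (multiplet L f a) A = r * multiplet L f (Suc a) A"
    and r0: "a + 2 * j1 < card L \<Longrightarrow> r \<noteq> 0"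
    using raise_multiplet[OF finL eigenfamily_highest[OF finL BL f] eigenfamily_norm[OF finL BL f]] by metis
  obtain r' where r': "\<And>A. A \<subseteq> R \<Longrightarrow> raise R (multiplet R g b) A = r' * multiplet R g (Suc b) A"
    using raise_multiplet[OF finR eigenfamily_highest[OF finR BR g] eigenfamily_norm[OF finR BR g]] by metis
  have "ip (Pow X) F (raise X (prodvec f a g b)) = ip (Pow X) (lower X F) (prodvec f a g b)"
    using raise_adjoint[OF finX] by (simp add: ip_commute)
  also have "\<dots> = 0" using F by (simp add: highest_def ip_def)
  finally have "ip (Pow X) F (raise X (prodvec f a g b)) = 0" .
  moreover have "ip (Pow X) F (raise X (prodvec f a g b))
    = ip (Pow X) F (\<lambda>A. r * prodvec f (Suc a) g b A + r' * prodvec f a g (Suc b) A)"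
    by (intro ip_cong refl) (simp add: raise_tensor[OF finL finR disj] tensor_def r r')
  ultimately have "r * coef F f (Suc a) g b + r' * coef F f a g (Suc b) = 0"
    by (simp only: ip_comb_right)
  then show ?thesis using r0 that by blast
qed

text \<open>The recursion carries the vanishing from \<open>a\<close> to \<open>a + 1\<close> as
  long as \<open>r\<close> is nonzero. At \<open>a = 0\<close> the level of \<open>F\<close> leaves
  only \<open>b = j - j1 - j2\<close>.\<close>

lemma coef_zero:
  assumes F: "F \<in> highest X j" and f: "f \<in> BL j1" and g: "g \<in> BR j2"
    and 0: "coef F f 0 g (j - j1 - j2) = 0"
  shows "coef F f a g b = 0"
proof (induction a arbitrary: b)
  case 0
  show ?case
  proof (cases "j = j1 + 0 + (j2 + b)")
    case True
    then have "b = j - j1 - j2" by simp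
    then show ?thesis using \<open>coef F f 0 g (j - j1 - j2) = 0\<close> by simp
  next
    case False
    then show ?thesis using F by (intro coef_level[OF _ f g]) (auto simp: highest_def)
  qed
next
  case (Suc a)
  show ?case
  proof (cases "a + 2 * j1 < card L")
    case True
    obtain r r' where "r * coef F f (Suc a) g b + r' * coef F f a g (Suc b) = 0" "r \<noteq> 0"
      using coef_recursion[OF F f g] True by metis
    then show ?thesis using Suc.IH[of "Suc b"] by simp
  next
    \<comment> \<open>Past the top of the left multiplet the recursion says nothing, but there the
      product vector itself is zero.\<close>
    case False
    then have "multiplet L f (Suc a) A = 0" if "A \<subseteq> L" for A
      using multiplet_overflow[OF finL eigenfamily_highest[OF finL BL f] eigenfamily_norm[OF finL BL f] _ that]
      by simp
    then show ?thesis unfolding ip_def tensor_def by (intro sum.neutral) simp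
  qed
qed

text \<open>A highest weight vector has, up to a scalar, only one possible component in the product of two
  multiplets.\<close>

lemma sum_coef_le_1:
  assumes f: "f \<in> BL j1" "j1 \<le> card L" and g: "g \<in> BR j2" "j2 \<le> card R"
  shows "(\<Sum>F\<in>B j. \<Sum>a\<le>card L. \<Sum>b\<le>card R. (coef F f a g b)\<^sup>2) \<le> 1"
proof (cases "\<exists>G\<in>B j. coef G f 0 g (j - j1 - j2) \<noteq> 0")
  case False
  then have "(\<Sum>F\<in>B j. \<Sum>a\<le>card L. \<Sum>b\<le>card R. (coef F f a g b)\<^sup>2) = 0"
    using coef_zero[OF eigenfamily_highest[OF finX B] f(1) g(1)] by (intro sum.neutral ballI) auto
  then show ?thesis by simp
next
  case True
  then obtain G where G: "G \<in> B j" and G0: "coef G f 0 g (j - j1 - j2) \<noteq> 0" by blast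
  define s where "s F = coef F f 0 g (j - j1 - j2) / coef G f 0 g (j - j1 - j2)" for F
  have cs: "coef F f a g b = s F * coef G f a g b" if F: "F \<in> B j" for F a b
  proof -
    let ?H = "\<lambda>A. 1 * F A + (- s F) * G A"
    have "?H \<in> highest X j"
      by (intro highest_comb eigenfamily_highest[OF finX B] F G)
    moreover have c: "coef ?H f a g b = 1 * coef F f a g b + (- s F) * coef G f a g b" for a b
      by (rule ip_comb_left)
    moreover have "1 * coef F f 0 g (j - j1 - j2) + (- s F) * coef G f 0 g (j - j1 - j2) = 0"
      using G0 by (simp add: s_def)
    ultimately have "coef ?H f a g b = 0"
      using coef_zero[OF _ f(1) g(1), of ?H j a b] by metis
    then show ?thesis unfolding c by simp
  qed
  define D where "D = {..card L} \<times> {..card R}"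
  have sumD: "(\<Sum>a\<le>card L. \<Sum>b\<le>card R. (coef F f a g b)\<^sup>2) = (\<Sum>(a,b)\<in>D. (coef F f a g b)\<^sup>2)" for F
    by (simp add: D_def sum.cartesian_product)
  \<comment> \<open>The component of \<open>G\<close> in the product of the two multiplets. Every
    \<open>F\<close> in \<open>B j\<close> has a component proportional to it with ratio
    \<open>s F\<close>, hence inner product \<open>s F * n\<close> with \<open>h\<close>.\<close>
  define h where "h = (\<lambda>A. \<Sum>(a,b)\<in>D. coef G f a g b * prodvec f a g b A)"
  define n where "n = (\<Sum>(a,b)\<in>D. (coef G f a g b)\<^sup>2)"
  have n0: "0 \<le> n" unfolding n_def by (auto intro!: sum_nonneg)
  have Fh: "ip (Pow X) F h = s F * n" if "F \<in> B j" for F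
  proof -
    have "ip (Pow X) F h = (\<Sum>(a,b)\<in>D. coef G f a g b * coef F f a g b)"
      unfolding h_def case_prod_unfold ip_sum_right ip_scale_right ..
    then show ?thesis unfolding cs[OF that] n_def
      by (simp add: sum_distrib_left power2_eq_square mult_ac case_prod_unfold)
  qed
  have hn: "ip (Pow X) h h \<le> n"
  proof -
    let ?J = "(\<lambda>(a,b). ((j1,f,a),(j2,g,b))) ` D"
    note fr = frame_tensor[OF frame_multiplet[OF finL BL] frame_multiplet[OF finR BR] disj]
    have inj: "inj_on (\<lambda>(a,b). ((j1,f,a),(j2,g,b))) D" by (auto simp: inj_on_def)
    have J: "?J \<subseteq> multiplet_index L BL \<times> multiplet_index R BR"
      using f g by (auto simp: D_def multiplet_index_def[OF finL BL] multiplet_index_def[OF finR BR])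
    from frame_synthesis[OF fr J, where c = "\<lambda>((j1,f,a),(j2,g,b)). coef G f a g b"]
    show ?thesis
      unfolding sum.reindex[OF inj] h_def n_def by (simp add: case_prod_unfold comp_def)
  qed
  \<comment> \<open>Bessel for \<open>h\<close> along \<open>B j\<close>: the squares
    \<open>(s F * n)^2\<close> sum to at most \<open>n\<close>. Dividing by \<open>n\<close> gives
    the claim, since the total weight is \<open>n\<close> times the sum of the squares of
    \<open>s F\<close>.\<close>
  have "(\<Sum>F\<in>B j. (s F * n)\<^sup>2) = (\<Sum>F\<in>B j. (ip (Pow X) h F)\<^sup>2)"
    by (intro sum.cong refl) (simp add: Fh ip_commute[of _ h])
  also have "\<dots> \<le> ip (Pow X) h h"
    using B by (intro bessel) (auto simp: eigenfamily_def)
  also have "\<dots> \<le> n" by (rule hn)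
  finally have le: "n * (n * (\<Sum>F\<in>B j. (s F)\<^sup>2)) \<le> n * 1"
    by (simp add: sum_distrib_left power_mult_distrib power2_eq_square mult_ac)
  have "(\<Sum>F\<in>B j. \<Sum>a\<le>card L. \<Sum>b\<le>card R. (coef F f a g b)\<^sup>2) = n * (\<Sum>F\<in>B j. (s F)\<^sup>2)"
    unfolding sumD n_def sum_distrib_left sum_distrib_right
    by (intro sum.cong refl) (simp add: cs case_prod_unfold power_mult_distrib sum_distrib_left mult.commute)
  moreover have "n * (\<Sum>F\<in>B j. (s F)\<^sup>2) \<le> 1"
    using le n0 by (cases "n = 0") (auto simp: mult_le_cancel_left)
  ultimately show ?thesis by simp
qed

abbreviation (input) "enL f \<equiv> ip (Pow L) f (exch EL f)"
abbreviation (input) "enR g \<equiv> ip (Pow R) g (exch ER g)"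
abbreviation (input) "enX F \<equiv> ip (Pow (L \<union> R)) F (exch E F)"
abbreviation (input) "indices \<equiv> multiplet_index L BL \<times> multiplet_index R BR"

text \<open>Two thirds of the energy dominate the energies inside the halves; the last third
  dominates the exchanges across the cut divided by \<open>3 * K\<close>. The resulting form is
  diagonal in the product frame, with weights summing to \<open>1\<close>, so Jensen's inequality
  applies.\<close>

lemma exp_energy_le:
  assumes F: "F \<in> B j" and t: "0 \<le> t"
  shows "exp (- t * enX F) \<le> (\<Sum>((j1,f,a),(j2,g,b))\<in>indices. (coef F f a g b)\<^sup>2 *
     exp (- t * (2 / 3 * (enL f + enR g) + real (j - j1 - j2) * (real (card X) / (6 * K)))))"
proof -
  let ?v = "\<lambda>((j1::nat,f,a),(j2::nat,g,b)). prodvec f a g b"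
  let ?c = "\<lambda>p. ip (Pow X) F (?v p)"
  let ?m = "\<lambda>n j. 2 * (real j * (real n - real j + 1))"
  let ?b = "\<lambda>((j1,f,a::nat),(j2,g,b::nat)). 2 / 3 * (enL f + enR g) + real (j - j1 - j2) * (real (card X) / (6 * K))"
  note fr0 = frame_tensor[OF frame_multiplet[OF finL BL] frame_multiplet[OF finR BR] disj]
  have fr: "frame (Pow X) indices ?v"
    using fr0 by (simp add: case_prod_unfold)
  have hw: "F \<in> highest X j" using eigenfamily_highest[OF finX B F] .
  have F1: "ip (Pow X) F F = 1" using eigenfamily_norm[OF finX B F] .
  have sum1: "(\<Sum>p\<in>indices. (?c p)\<^sup>2) = 1"
    using frame_parseval[OF fr, of F F] F1 by (simp add: power2_eq_square)
  have symX: "ip (Pow X) (exch P F) G = ip (Pow X) F (exch P G)" if "P \<subseteq> X \<times> X" for P G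
    by (rule exch_sym) fact
  have expand_L: "ip (Pow X) F (exch P F) = (\<Sum>p\<in>indices. (?c p)\<^sup>2 * e (fst (fst p)) (fst (snd (fst p))))"
    if P: "P \<subseteq> L \<times> L" and e: "\<And>j1 f A. f \<in> BL j1 \<Longrightarrow> exch P f A = e j1 f * f A" for P e
  proof (rule frame_sym_eigen[OF fr])
    show "ip (Pow X) (exch P F) (?v p) = ip (Pow X) F (exch P (?v p))" for p
      using P by (intro symX) auto
    fix p A assume p: "p \<in> indices"
    then obtain j1 f a j2 g b where p': "p = ((j1,f,a),(j2,g,b))" and f: "f \<in> BL j1"
      by (auto simp: multiplet_index_def[OF finL BL])
    show "exch P (?v p) A = e (fst (fst p)) (fst (snd (fst p))) * ?v p A"
      unfolding p' prod.case exch_tensor_left[OF disj P]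
      by (simp add: tensor_def exch_multiplet[OF P e[OF f]])
  qed
  have expand_R: "ip (Pow X) F (exch P F) = (\<Sum>p\<in>indices. (?c p)\<^sup>2 * e (fst (snd p)) (fst (snd (snd p))))"
    if P: "P \<subseteq> R \<times> R" and e: "\<And>j2 g A. g \<in> BR j2 \<Longrightarrow> exch P g A = e j2 g * g A" for P e
  proof (rule frame_sym_eigen[OF fr])
    show "ip (Pow X) (exch P F) (?v p) = ip (Pow X) F (exch P (?v p))" for p
      using P by (intro symX) auto
    fix p A assume p: "p \<in> indices"
    then obtain j1 f a j2 g b where p': "p = ((j1,f,a),(j2,g,b))" and g: "g \<in> BR j2"
      by (auto simp: multiplet_index_def[OF finR BR])
    show "exch P (?v p) A = e (fst (snd p)) (fst (snd (snd p))) * ?v p A"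
      unfolding p' prod.case exch_tensor_right[OF disj P]
      by (simp add: tensor_def exch_multiplet[OF P e[OF g]])
  qed
  have eigL: "exch EL f A = enL f * f A" if "f \<in> BL j1" for f j1 A
    using BL that unfolding eigenfamily_def by blast
  have eigR: "exch ER f A = enR f * f A" if "f \<in> BR j1" for f j1 A
    using BR that unfolding eigenfamily_def by blast
  let ?e1 = "\<lambda>p. enL (fst (snd (fst p)))" and ?e2 = "\<lambda>p. enR (fst (snd (snd p)))"
  let ?m1 = "\<lambda>p. ?m (card L) (fst (fst p))" and ?m2 = "\<lambda>p. ?m (card R) (fst (snd p))"
  have L1: "ip (Pow X) F (exch EL F) = (\<Sum>p\<in>indices. (?c p)\<^sup>2 * ?e1 p)"
    by (rule expand_L[OF EL]) (rule eigL)
  have R1: "ip (Pow X) F (exch ER F) = (\<Sum>p\<in>indices. (?c p)\<^sup>2 * ?e2 p)"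
    by (rule expand_R[OF ER]) (rule eigR)
  have L2: "ip (Pow X) F (exch (L \<times> L) F) = (\<Sum>p\<in>indices. (?c p)\<^sup>2 * ?m1 p)"
    by (rule expand_L) (auto intro: casimir_highest[OF finL eigenfamily_highest[OF finL BL]])
  have R2: "ip (Pow X) F (exch (R \<times> R) F) = (\<Sum>p\<in>indices. (?c p)\<^sup>2 * ?m2 p)"
    by (rule expand_R) (auto intro: casimir_highest[OF finR eigenfamily_highest[OF finR BR]])
  have X2: "ip (Pow X) F (exch (X \<times> X) F) = ?m (card X) j"
  proof -
    have "ip (Pow X) F (exch (X \<times> X) F) = ip (Pow X) F (\<lambda>A. ?m (card X) j * F A)"
      by (intro ip_cong refl casimir_highest[OF finX hw])
    then show ?thesis unfolding ip_scale_right F1 by simp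
  qed
  have cross: "2 * ip (Pow X) F (exch (L \<times> R) F)
    = ip (Pow X) F (exch (X \<times> X) F) - ip (Pow X) F (exch (L \<times> L) F) - ip (Pow X) F (exch (R \<times> R) F)"
    unfolding ip_scale_right[symmetric] ip_diff_right[symmetric]
    by (intro ip_cong refl exch_cross[OF finL finR disj])
  have finE: "finite E" using E(1) finX by (meson finite_SigmaI finite_subset)
  have "exch (EL \<union> ER) F A = 1 * exch EL F A + 1 * exch ER F A" for A
    using exch_Un[of EL ER F A] finite_subset[OF _ finE] E(2) EL ER disj by auto
  then have "ip (Pow X) F (exch (EL \<union> ER) F) = 1 * ip (Pow X) F (exch EL F) + 1 * ip (Pow X) F (exch ER F)"
    unfolding ip_comb_right[symmetric] by (intro ip_cong refl)
  then have split: "ip (Pow X) F (exch EL F) + ip (Pow X) F (exch ER F) \<le> enX F"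
    using exch_energy_mono[OF finE E(2) E(1), of F] by simp
  \<comment> \<open>The Casimir difference is twice the cross term, so dividing it by
    \<open>6 * K\<close> gives the cross term over \<open>3 * K\<close>.\<close>
  let ?g = "\<lambda>p. 2 / 3 * (?e1 p + ?e2 p) + (?m (card X) j - ?m1 p - ?m2 p) / (6 * K)"
  have "(\<Sum>p\<in>indices. (?c p)\<^sup>2 * ?b p) \<le> (\<Sum>p\<in>indices. (?c p)\<^sup>2 * ?g p)"
  proof (rule sum_mono)
    fix p assume "p \<in> indices"
    then obtain j1 f a j2 g b where p: "p = ((j1,f,a),(j2,g,b))" and f: "f \<in> BL j1" and g: "g \<in> BR j2"
      by (auto simp: multiplet_index_def[OF finL BL] multiplet_index_def[OF finR BR])
    show "(?c p)\<^sup>2 * ?b p \<le> (?c p)\<^sup>2 * ?g p"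
    \<comment> \<open>Matching levels give \<open>j1 + j2 \<le> j\<close>, which the gap estimate
      needs; otherwise the weight is zero and the truncated difference \<open>j - j1 - j2\<close> is
      harmless.\<close>
    proof (cases "j = j1 + a + (j2 + b)")
      case True
      have cX: "card X = card L + card R" using card_Un_disjoint[OF finL finR disj] .
      have "2 * j \<le> card L + card R" using highest_level_le[OF finX hw F1] unfolding cX .
      then have "real (j - j1 - j2) * real (card X) / 2 \<le> (?m (card X) j - ?m (card L) j1 - ?m (card R) j2) / 2"
        using casimir_gap[OF card_LR _ , of j j1 j2] True unfolding cX by (simp add: field_simps)
      then have "real (j - j1 - j2) * (real (card X) / (6 * K)) \<le> (?m (card X) j - ?m (card L) j1 - ?m (card R) j2) / (6 * K)"
        using K(1) by (simp add: field_simps)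
      then show ?thesis unfolding p by (intro mult_left_mono) auto
    next
      case False
      have "leveled X j F" using hw by (simp add: highest_def)
      from coef_level[OF this f g False] have "?c p = 0" unfolding p by simp
      then show ?thesis by simp
    qed
  qed
  also have "\<dots> = 2 / 3 * (ip (Pow X) F (exch EL F) + ip (Pow X) F (exch ER F))
     + (?m (card X) j * (\<Sum>p\<in>indices. (?c p)\<^sup>2) - ip (Pow X) F (exch (L \<times> L) F) - ip (Pow X) F (exch (R \<times> R) F)) / (6 * K)"
    unfolding L1 R1 L2 R2 sum_distrib_left sum.distrib[symmetric] sum_subtractf[symmetric] sum_divide_distrib
    using K(1) by (intro sum.cong refl) (simp add: field_simps)
  also have "\<dots> = 2 / 3 * (ip (Pow X) F (exch EL F) + ip (Pow X) F (exch ER F))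
     + ip (Pow X) F (exch (L \<times> R) F) / (3 * K)"
    unfolding sum1 X2[symmetric] mult_1_right cross[symmetric] by simp
  also have "\<dots> \<le> 2 / 3 * enX F + 1 / 3 * enX F"
  proof (rule add_mono)
    have "ip (Pow X) F (exch (L \<times> R) F) / (3 * K) \<le> K * enX F / (3 * K)"
      using K by (intro divide_right_mono) auto
    then show "ip (Pow X) F (exch (L \<times> R) F) / (3 * K) \<le> 1 / 3 * enX F" using K(1) by simp
  qed (use split in simp)
  also have "\<dots> = enX F" by simp
  finally have "(\<Sum>p\<in>indices. (?c p)\<^sup>2 * ?b p) \<le> enX F" .
  from jensen_exp[OF _ _ sum1 this t]
  have "exp (- t * enX F) \<le> (\<Sum>p\<in>indices. (?c p)\<^sup>2 * exp (- t * ?b p))"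
    using fr by (simp add: frame_def)
  then show ?thesis by (simp add: case_prod_unfold)
qed

text \<open>Sum the previous bound over all \<open>F\<close> and exchange the sums. For a fixed pair
  of multiplets the weights on each level total at most \<open>1\<close>, leaving a geometric series
  in the number of levels above \<open>j1 + j2\<close>.\<close>

lemma partition_fun_split:
  assumes t: "0 < t" and X: "X \<noteq> {}"
  shows "partition_fun X E B t
    \<le> partition_fun L EL BL (2 / 3 * t) * partition_fun R ER BR (2 / 3 * t) / (1 - exp (- t * (real (card X) / (6 * K))))"
proof -
  let ?q = "exp (- t * (real (card X) / (6 * K)))"
  have q: "0 \<le> ?q" "?q < 1" using t K(1) X finX by (auto simp: card_gt_0_iff)
  let ?SL = "Sigma {..card L} BL" and ?SR = "Sigma {..card R} BR"
  let ?w = "\<lambda>f g. exp (- (2 / 3 * t) * enL f) * exp (- (2 / 3 * t) * enR g)"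
  let ?C = "\<lambda>F f g. \<Sum>a\<le>card L. \<Sum>b\<le>card R. (coef F f a g b)\<^sup>2"
  have finB: "finite (B j)" for j using eigenfamily_finite[OF finX B] .
  have bound: "exp (- t * enX F) \<le> (\<Sum>(j1,f)\<in>?SL. \<Sum>(j2,g)\<in>?SR. ?w f g * ?q ^ (j - j1 - j2) * ?C F f g)"
    if F: "F \<in> B j" for j F
  proof -
    have e: "exp (- t * (2 / 3 * (u + v) + real n * s)) = exp (- (2 / 3 * t) * u) * exp (- (2 / 3 * t) * v) * exp (- t * s) ^ n"
      for u v s :: real and n
    proof -
      have "- t * (2 / 3 * (u + v) + real n * s) = (- (2 / 3 * t) * u + - (2 / 3 * t) * v) + real n * (- t * s)"
        by (simp add: field_simps)
      then show ?thesis by (simp only: exp_add exp_of_nat_mult)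
    qed
    have "exp (- t * enX F) \<le> (\<Sum>(j1,f,a)\<in>multiplet_index L BL. \<Sum>(j2,g,b)\<in>multiplet_index R BR.
        (coef F f a g b)\<^sup>2 * (?w f g * ?q ^ (j - j1 - j2)))"
      using exp_energy_le[OF F less_imp_le[OF t]] unfolding e
      by (simp add: sum.cartesian_product case_prod_unfold)
    also have "\<dots> = (\<Sum>(j1,f)\<in>?SL. \<Sum>a\<le>card L. \<Sum>(j2,g)\<in>?SR. \<Sum>b\<le>card R.
        (coef F f a g b)\<^sup>2 * (?w f g * ?q ^ (j - j1 - j2)))"
      unfolding sum_multiplet_index[OF finL BL] sum_multiplet_index[OF finR BR] ..
    also have "\<dots> = (\<Sum>(j1,f)\<in>?SL. \<Sum>(j2,g)\<in>?SR. ?w f g * ?q ^ (j - j1 - j2) * ?C F f g)"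
    proof (rule sum.cong[OF refl])
      fix p assume "p \<in> ?SL"
      obtain j1 f where p: "p = (j1, f)" by (cases p)
      have "(\<Sum>a\<le>card L. \<Sum>r\<in>?SR. \<Sum>b\<le>card R. (coef F f a (snd r) b)\<^sup>2 * (?w f (snd r) * ?q ^ (j - j1 - fst r)))
        = (\<Sum>r\<in>?SR. \<Sum>a\<le>card L. \<Sum>b\<le>card R. (coef F f a (snd r) b)\<^sup>2 * (?w f (snd r) * ?q ^ (j - j1 - fst r)))"
        by (rule sum.swap)
      also have "\<dots> = (\<Sum>r\<in>?SR. ?w f (snd r) * ?q ^ (j - j1 - fst r) * ?C F f (snd r))"
        by (simp only: sum_distrib_left) (intro sum.cong refl mult.commute)
      finally show "(case p of (j1, f) \<Rightarrow> \<Sum>a\<le>card L. \<Sum>(j2,g)\<in>?SR. \<Sum>b\<le>card R.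
          (coef F f a g b)\<^sup>2 * (?w f g * ?q ^ (j - j1 - j2)))
        = (case p of (j1, f) \<Rightarrow> \<Sum>(j2,g)\<in>?SR. ?w f g * ?q ^ (j - j1 - j2) * ?C F f g)"
        unfolding p case_prod_unfold fst_conv snd_conv .
    qed
    finally show ?thesis .
  qed
  have "partition_fun X E B t = (\<Sum>j\<le>card X. \<Sum>F\<in>B j. exp (- t * enX F))"
    unfolding partition_fun_def by (rule sum.Sigma[symmetric]) (auto simp: finB)
  also have "\<dots> \<le> (\<Sum>j\<le>card X. \<Sum>F\<in>B j. \<Sum>p\<in>?SL. \<Sum>r\<in>?SR.
      ?w (snd p) (snd r) * ?q ^ (j - fst p - fst r) * ?C F (snd p) (snd r))"
    using bound by (intro sum_mono) (simp add: case_prod_unfold)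
  also have "\<dots> = (\<Sum>j\<le>card X. \<Sum>p\<in>?SL. \<Sum>r\<in>?SR. \<Sum>F\<in>B j.
      ?w (snd p) (snd r) * ?q ^ (j - fst p - fst r) * ?C F (snd p) (snd r))"
    by (rule sum.cong[OF refl], subst sum.swap, rule sum.cong[OF refl], rule sum.swap)
  also have "\<dots> = (\<Sum>p\<in>?SL. \<Sum>j\<le>card X. \<Sum>r\<in>?SR. \<Sum>F\<in>B j.
      ?w (snd p) (snd r) * ?q ^ (j - fst p - fst r) * ?C F (snd p) (snd r))"
    by (rule sum.swap)
  also have "\<dots> = (\<Sum>p\<in>?SL. \<Sum>r\<in>?SR. \<Sum>j\<le>card X. \<Sum>F\<in>B j.
      ?w (snd p) (snd r) * ?q ^ (j - fst p - fst r) * ?C F (snd p) (snd r))"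
    by (rule sum.cong[OF refl], rule sum.swap)
  also have "\<dots> \<le> (\<Sum>p\<in>?SL. \<Sum>r\<in>?SR. ?w (snd p) (snd r) * (1 / (1 - ?q)))"
  proof (intro sum_mono)
    fix p r assume p: "p \<in> ?SL" and r: "r \<in> ?SR"
    obtain j1 f where p': "p = (j1, f)" by (cases p)
    obtain j2 g where r': "r = (j2, g)" by (cases r)
    have f: "f \<in> BL j1" "j1 \<le> card L" and g: "g \<in> BR j2" "j2 \<le> card R" using p r p' r' by auto
    \<comment> \<open>Below level \<open>j1 + j2\<close> the exponent would be truncated to
      \<open>0\<close>, but there all coefficients vanish, so the series really starts at
      \<open>j1 + j2\<close>.\<close>
    have "(\<Sum>F\<in>B j. ?q ^ (j - j1 - j2) * ?C F f g) \<le> (if j1 + j2 \<le> j then ?q ^ (j - (j1 + j2)) else 0)" for j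
    proof (cases "j1 + j2 \<le> j")
      case True
      have "?q ^ (j - j1 - j2) * (\<Sum>F\<in>B j. ?C F f g) \<le> ?q ^ (j - j1 - j2) * 1"
        by (intro mult_left_mono sum_coef_le_1[OF f g]) auto
      then show ?thesis using True by (simp add: sum_distrib_left)
    next
      case False
      have "coef F f a g b = 0" if "F \<in> B j" for F a b
        using False eigenfamily_leveled[OF finX B that] by (intro coef_level[OF _ f(1) g(1)]) auto
      then show ?thesis using False by simp
    qed
    then have "(\<Sum>j\<le>card X. \<Sum>F\<in>B j. ?q ^ (j - j1 - j2) * ?C F f g)
      \<le> (\<Sum>j\<le>card X. if j1 + j2 \<le> j then ?q ^ (j - (j1 + j2)) else 0)"
      by (rule sum_mono)
    also have "\<dots> \<le> 1 / (1 - ?q)" using q by (rule geometric_tail_le)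
    finally have "?w f g * (\<Sum>j\<le>card X. \<Sum>F\<in>B j. ?q ^ (j - j1 - j2) * ?C F f g) \<le> ?w f g * (1 / (1 - ?q))"
      by (rule mult_left_mono) simp
    then show "(\<Sum>j\<le>card X. \<Sum>F\<in>B j. ?w (snd p) (snd r) * ?q ^ (j - fst p - fst r) * ?C F (snd p) (snd r))
      \<le> ?w (snd p) (snd r) * (1 / (1 - ?q))"
      unfolding p' r' fst_conv snd_conv by (simp only: sum_distrib_left mult.assoc)
  qed
  also have "\<dots> = partition_fun L EL BL (2 / 3 * t) * partition_fun R ER BR (2 / 3 * t) / (1 - ?q)"
    unfolding partition_fun_def sum_product sum_divide_distrib
    by (intro sum.cong refl) (simp add: case_prod_unfold)
  finally show ?thesis .
qed

end

section \<open>The partition function of an interval\<close>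

definition disp :: "'a set \<Rightarrow> 'a \<Rightarrow> 'a \<Rightarrow> ('a set \<Rightarrow> real) \<Rightarrow> real" where
  "disp X x y F = L2_set (\<lambda>A. F A - F (transpose x y ` A)) (Pow X)"

lemma exch_energy_disp:
  "P \<subseteq> X \<times> X \<Longrightarrow> ip (Pow X) F (exch P F) = (\<Sum>(x,y)\<in>P. (disp X x y F)\<^sup>2) / 2"
  by (simp add: exch_energy disp_def L2_set_def sum_nonneg)

lemma L2_set_transpose:
  assumes "x \<in> X" "y \<in> X"
  shows "L2_set (\<lambda>A. G (transpose x y ` A)) (Pow X) = L2_set G (Pow X)"
  unfolding L2_set_def using sum_Pow_transpose[OF assms, of "\<lambda>A. (G A)\<^sup>2"] by simp

text \<open>Conjugation: the exchange of \<open>x\<close> and \<open>z\<close> is the exchange of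
  \<open>x\<close> and \<open>y\<close> between two exchanges of \<open>y\<close> and
  \<open>z\<close>. Telescoping along the three moves uses that permuting sites preserves the
  norm.\<close>

lemma disp_conjugate:
  assumes xyz: "x \<in> X" "y \<in> X" "z \<in> X" "x \<noteq> y" "x \<noteq> z" "y \<noteq> z"
  shows "disp X x z F \<le> disp X x y F + 2 * disp X y z F"
proof -
  let ?s = "image (transpose y z)" and ?t = "image (transpose x y)"
  have conj: "transpose x z ` A = ?s (?t (?s A))" for A
    using transpose_comp_triple[of z x y] xyz by (metis image_comp transpose_commute)
  have "disp X x z F = L2_set (\<lambda>A. ((F A - F (?s A)) + (F (?s A) - F (?t (?s A))))
      + (F (?t (?s A)) - F (?s (?t (?s A))))) (Pow X)"
    by (simp add: disp_def conj)
  also have "\<dots> \<le> L2_set (\<lambda>A. (F A - F (?s A)) + (F (?s A) - F (?t (?s A)))) (Pow X)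
      + L2_set (\<lambda>A. F (?t (?s A)) - F (?s (?t (?s A)))) (Pow X)"
    by (rule L2_set_triangle_ineq)
  also have "L2_set (\<lambda>A. (F A - F (?s A)) + (F (?s A) - F (?t (?s A)))) (Pow X)
      \<le> L2_set (\<lambda>A. F A - F (?s A)) (Pow X) + L2_set (\<lambda>A. F (?s A) - F (?t (?s A))) (Pow X)"
    by (rule L2_set_triangle_ineq)
  also have "L2_set (\<lambda>A. F (?s A) - F (?t (?s A))) (Pow X) = disp X x y F"
    using L2_set_transpose[of y X z "\<lambda>A. F A - F (?t A)"] xyz by (simp add: disp_def)
  also have "L2_set (\<lambda>A. F (?t (?s A)) - F (?s (?t (?s A)))) (Pow X) = disp X y z F"
    using L2_set_transpose[of y X z "\<lambda>A. F (?t A) - F (?s (?t A))"]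
      L2_set_transpose[of x X y "\<lambda>A. F A - F (?s A)"] xyz by (simp add: disp_def)
  finally show ?thesis by (simp add: disp_def)
qed

lemma disp_nonneg: "0 \<le> disp X x y F"
  by (simp add: disp_def)

lemma disp_path:
  fixes x d :: nat
  assumes "{x..x + Suc d} \<subseteq> X"
  shows "disp X x (x + Suc d) F \<le> 2 * (\<Sum>z\<in>{x..x + d}. disp X z (Suc z) F)"
  using assms
proof (induction d)
  case 0
  then show ?case using disp_nonneg[of X x "Suc x" F] by simp
next
  case (Suc d)
  have "disp X x (x + Suc (Suc d)) F \<le> disp X x (x + Suc d) F + 2 * disp X (x + Suc d) (x + Suc (Suc d)) F"
    using Suc.prems by (intro disp_conjugate) auto
  moreover have "disp X x (x + Suc d) F \<le> 2 * (\<Sum>z\<in>{x..x + d}. disp X z (Suc z) F)"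
    using Suc.prems by (intro Suc.IH) auto
  moreover have "(\<Sum>z\<in>{x..x + Suc d}. disp X z (Suc z) F)
     = (\<Sum>z\<in>{x..x + d}. disp X z (Suc z) F) + disp X (x + Suc d) (Suc (x + Suc d)) F"
    by simp
  ultimately show ?case by simp
qed

definition bonds :: "nat \<Rightarrow> nat \<Rightarrow> (nat \<times> nat) set" where
  "bonds p n = (\<lambda>z. (z, Suc z)) ` {z. p \<le> z \<and> Suc z < p + n}"

lemma bonds_subset: "bonds p n \<subseteq> {p..<p + n} \<times> {p..<p + n}"
  by (auto simp: bonds_def)

text \<open>Squaring the path bound gives \<open>4\<close>, Cauchy-Schwarz the number of bonds, at
  most \<open>n\<close>, and the sum of squared displacements is twice the energy:
  \<open>8 n\<close> in total.\<close>

lemma disp_le_energy: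
  assumes "p \<le> x" "x < y" "y < p + n"
  shows "(disp {p..<p + n} x y F)\<^sup>2 \<le> 8 * real n * ip (Pow {p..<p + n}) F (exch (bonds p n) F)"
proof -
  let ?X = "{p..<p + n}"
  obtain d where y: "y = x + Suc d" using assms(2) less_iff_Suc_add by auto
  let ?D = "\<lambda>z. disp ?X z (Suc z) F"
  have "disp ?X x y F \<le> 2 * (\<Sum>z\<in>{x..x + d}. ?D z)"
    unfolding y using assms y by (intro disp_path) auto
  then have "(disp ?X x y F)\<^sup>2 \<le> (2 * (\<Sum>z\<in>{x..x + d}. ?D z))\<^sup>2"
    by (intro power_mono disp_nonneg)
  also have "\<dots> = 4 * (\<Sum>z\<in>{x..x + d}. 1 * ?D z)\<^sup>2" by (simp add: power_mult_distrib)
  also have "\<dots> \<le> 4 * ((\<Sum>z\<in>{x..x + d}. 1\<^sup>2) * (\<Sum>z\<in>{x..x + d}. (?D z)\<^sup>2))"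
    by (intro mult_left_mono Cauchy_Schwarz_ineq_sum) auto
  also have "\<dots> \<le> 4 * (real n * (\<Sum>z\<in>{z. p \<le> z \<and> Suc z < p + n}. (?D z)\<^sup>2))"
    using assms y
    by (intro mult_left_mono mult_mono sum_mono2) (auto intro: sum_nonneg finite_subset[of _ "{..<p + n}"])
  also have "(\<Sum>z\<in>{z. p \<le> z \<and> Suc z < p + n}. (?D z)\<^sup>2) = (\<Sum>(x,y)\<in>bonds p n. (disp ?X x y F)\<^sup>2)"
    unfolding bonds_def by (subst sum.reindex) (auto simp: inj_on_def)
  also have "\<dots> = 2 * ip (Pow ?X) F (exch (bonds p n) F)"
    using exch_energy_disp[OF bonds_subset, of p n F] by simp
  finally show ?thesis by simp
qed

text \<open>There are \<open>m * (n - m)\<close> pairs across the cut, each costing half of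
  \<open>8 n\<close> times the energy; \<open>4 m (n - m) \<le> n^2\<close> then gives the
  cube.\<close>

lemma cross_energy_le:
  assumes "m \<le> n"
  shows "ip (Pow {p..<p + n}) F (exch ({p..<p + m} \<times> {p + m..<p + n}) F)
    \<le> real n ^ 3 * ip (Pow {p..<p + n}) F (exch (bonds p n) F)"
proof -
  let ?X = "{p..<p + n}" and ?P = "{p..<p + m} \<times> {p + m..<p + n}"
  let ?e = "ip (Pow ?X) F (exch (bonds p n) F)"
  have e: "0 \<le> ?e" by (intro exch_energy_nonneg bonds_subset)
  have "ip (Pow ?X) F (exch ?P F) = (\<Sum>(x,y)\<in>?P. (disp ?X x y F)\<^sup>2) / 2"
    using assms by (intro exch_energy_disp) auto
  also have "\<dots> \<le> (\<Sum>(x,y)\<in>?P. 8 * real n * ?e) / 2"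
    by (intro divide_right_mono sum_mono) (auto intro: disp_le_energy)
  also have "\<dots> = 4 * (real m * real (n - m)) * real n * ?e"
    by (simp add: card_cartesian_product)
  also have "\<dots> \<le> (real n)\<^sup>2 * real n * ?e"
  proof (intro mult_right_mono e)
    have "4 * (real m * (real n - real m)) = (real n)\<^sup>2 - (real n - 2 * real m)\<^sup>2"
      by (simp add: power2_eq_square algebra_simps)
    then show "4 * (real m * real (n - m)) \<le> (real n)\<^sup>2"
      using assms zero_le_power2[of "real n - 2 * real m"] unfolding of_nat_diff[OF assms] by linarith
  qed auto
  finally show ?thesis by (simp add: power2_eq_square power3_eq_cube)
qed

text \<open>The linear term of \<open>exp y - 1\<close> is discarded in favour of
  \<open>y^2 / 2\<close>, so that the exponent has the quadratic form \<open>(n^2 / t)^2\<close> on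
  which the recursion runs.\<close>

lemma geometric_exp_bound:
  fixes y :: real
  assumes "0 < y"
  shows "1 / (1 - exp (- y)) \<le> exp (2 / y\<^sup>2)"
proof -
  have e: "1 + y + y\<^sup>2 / 2 \<le> exp y" using assms by (intro exp_lower_Taylor_quadratic) simp
  then have e1: "y\<^sup>2 / 2 \<le> exp y - 1" using assms by linarith
  have "1 / (1 - exp (- y)) = 1 + 1 / (exp y - 1)"
    using assms by (simp add: exp_minus field_simps)
  also have "\<dots> \<le> exp (1 / (exp y - 1))" by (rule exp_ge_add_one_self)
  also have "\<dots> \<le> exp (1 / (y\<^sup>2 / 2))"
    using e1 assms by (intro exp_mono divide_left_mono) auto
  finally show ?thesis by simp
qed

lemma partition_fun_interval:
  assumes "1 \<le> n" "eigenfamily {p..<p + n} (bonds p n) B" "0 < t"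
  shows "partition_fun {p..<p + n} (bonds p n) B t \<le> exp (648 * ((real n)\<^sup>2 / t)\<^sup>2)"
  using assms
proof (induction n arbitrary: p B t rule: less_induct)
  case (less n)
  let ?X = "{p..<p + n}"
  show ?case
  proof (cases "n = 1")
    case True
    have "partition_fun ?X (bonds p n) B t \<le> (\<Sum>(j,f)\<in>Sigma {..card ?X} B. (f {})\<^sup>2)"
      unfolding partition_fun_def
    proof (rule sum_mono, clarify)
      fix j f assume f: "f \<in> B j"
      note hf = eigenfamily_highest[OF _ less.prems(2) f] and nf = eigenfamily_norm[OF _ less.prems(2) f]
      have j: "j = 0" using highest_level_le[OF _ hf nf] True by simp
      have "f A = 0" if "A \<in> Pow ?X - {{}}" for A
      proof -
        have "card A \<noteq> 0" using that by (auto simp: finite_subset)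
        then show ?thesis using hf j by (auto simp: highest_def leveled_def)
      qed
      then have "ip (Pow ?X) f f = ip {{}} f f"
        unfolding ip_def by (intro sum.mono_neutral_right) auto
      then have "(f {})\<^sup>2 = 1" using nf by (simp add: ip_def power2_eq_square)
      moreover have "0 \<le> ip (Pow ?X) f (exch (bonds p n) f)" by (intro exch_energy_nonneg bonds_subset)
      ultimately show "exp (- t * ip (Pow ?X) f (exch (bonds p n) f)) \<le> (f {})\<^sup>2"
        using less.prems(3) by (simp add: mult_nonneg_nonneg)
    qed
    also have "\<dots> = (\<Sum>j\<le>card ?X. \<Sum>f\<in>B j. (f {})\<^sup>2)"
      using eigenfamily_finite[OF _ less.prems(2)] by (intro sum.Sigma[symmetric]) auto
    also have "\<dots> = (\<Sum>j\<in>{0}. \<Sum>f\<in>B j. (f {})\<^sup>2)"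
    proof (rule sum.mono_neutral_right)
      show "\<forall>j\<in>{..card ?X} - {0}. (\<Sum>f\<in>B j. (f {})\<^sup>2) = 0"
        using eigenfamily_leveled[OF _ less.prems(2)] by (intro ballI sum.neutral) (auto simp: leveled_def)
    qed auto
    \<comment> \<open>On one site only level \<open>0\<close> occurs, and a unit vector there has
      value \<open>1\<close> or \<open>-1\<close> at the empty set. Bessel for the indicator of the
      empty set then allows at most one of them.\<close>
    also have "\<dots> = (\<Sum>f\<in>B 0. (ip (Pow ?X) (indicator {{}}) f)\<^sup>2)"
      by (simp add: ip_delta)
    also have "\<dots> \<le> ip (Pow ?X) (indicator {{}}) (indicator {{}})"
      using less.prems(2) by (intro bessel) (auto simp: eigenfamily_def)
    also have "\<dots> = 1" by (simp add: ip_delta)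
    also have "\<dots> \<le> exp (648 * ((real n)\<^sup>2 / t)\<^sup>2)" by simp
    finally show ?thesis .
  next
    case False
    define m where "m = n div 2"
    have n2: "2 \<le> n" using False less.prems(1) by linarith
    \<comment> \<open>Rounding makes a part at most \<open>2 n / 3\<close> long; equality occurs for
      \<open>n = 3\<close>, cut into \<open>1\<close> and \<open>2\<close>.\<close>
    have m: "1 \<le> m" "m < n" "m \<le> n - m" "n - m \<le> Suc m" "3 * m \<le> 2 * n" "3 * (n - m) \<le> 2 * n"
      using n2 unfolding m_def by linarith+
    let ?L = "{p..<p + m}" and ?R = "{p + m..<(p + m) + (n - m)}"
    have R: "?R = {p + m..<p + n}" using m by simp
    have X: "?L \<union> ?R = ?X" using m by auto
    obtain BL where BL: "eigenfamily ?L (bonds p m) BL"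
      using eigenfamily_exists[OF _ bonds_subset] by blast
    obtain BR where BR: "eigenfamily ?R (bonds (p + m) (n - m)) BR"
      using eigenfamily_exists[OF _ bonds_subset] by blast
    let ?q = "exp (- t * (real (card (?L \<union> ?R)) / (6 * real n ^ 3)))"
    interpret bisection ?L ?R "bonds p m" "bonds (p + m) (n - m)" "bonds p n" BL BR B "real n ^ 3"
    proof
      show "bonds p n \<subseteq> (?L \<union> ?R) \<times> (?L \<union> ?R)" unfolding X by (rule bonds_subset)
      show "bonds p m \<union> bonds (p + m) (n - m) \<subseteq> bonds p n" using m by (auto simp: bonds_def)
      show "eigenfamily (?L \<union> ?R) (bonds p n) B" unfolding X by (rule less.prems(2))
      show "ip (Pow (?L \<union> ?R)) F (exch (?L \<times> ?R) F) \<le> real n ^ 3 * ip (Pow (?L \<union> ?R)) F (exch (bonds p n) F)" for F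
        unfolding X using cross_energy_le[of m n p F] m(2) unfolding R by simp
      show "bonds p m \<subseteq> ?L \<times> ?L" "bonds (p + m) (n - m) \<subseteq> ?R \<times> ?R" by (rule bonds_subset)+
      show "eigenfamily ?L (bonds p m) BL" "eigenfamily ?R (bonds (p + m) (n - m)) BR" by (rule BL, rule BR)
    qed (use m n2 in auto)
    have "partition_fun (?L \<union> ?R) (bonds p n) B t
      \<le> partition_fun ?L (bonds p m) BL (2 / 3 * t) * partition_fun ?R (bonds (p + m) (n - m)) BR (2 / 3 * t) / (1 - ?q)"
      using less.prems(3) n2 unfolding X by (intro partition_fun_split[unfolded X]) auto
    also have "\<dots> \<le> exp (648 * (2 / 3 * ((real n)\<^sup>2 / t))\<^sup>2) * exp (648 * (2 / 3 * ((real n)\<^sup>2 / t))\<^sup>2) * exp (2 / (t / (6 * (real n)\<^sup>2))\<^sup>2)"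
    proof -
      have half: "partition_fun {p'..<p' + k} (bonds p' k) B' (2 / 3 * t) \<le> exp (648 * (2 / 3 * ((real n)\<^sup>2 / t))\<^sup>2)"
        if k: "1 \<le> k" "k < n" "3 * k \<le> 2 * n" and B': "eigenfamily {p'..<p' + k} (bonds p' k) B'" for p' k B'
      proof -
        have "partition_fun {p'..<p' + k} (bonds p' k) B' (2 / 3 * t) \<le> exp (648 * ((real k)\<^sup>2 / (2 / 3 * t))\<^sup>2)"
          using less.IH[OF k(2) k(1) B', of "2 / 3 * t"] less.prems(3) by simp
        also have "\<dots> \<le> exp (648 * ((2 / 3 * real n)\<^sup>2 / (2 / 3 * t))\<^sup>2)"
          using k less.prems(3) by (intro exp_mono mult_left_mono power_mono divide_right_mono) auto
        also have "(2 / 3 * real n)\<^sup>2 / (2 / 3 * t) = 2 / 3 * ((real n)\<^sup>2 / t)"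
          using less.prems(3) by (simp add: power2_eq_square field_simps)
        finally show ?thesis .
      qed
      have "t * (real (card (?L \<union> ?R)) / (6 * real n ^ 3)) = t / (6 * (real n)\<^sup>2)"
        unfolding X using n2 by (simp add: power3_eq_cube power2_eq_square)
      then have q: "1 / (1 - ?q) \<le> exp (2 / (t / (6 * (real n)\<^sup>2))\<^sup>2)"
        using geometric_exp_bound[of "t / (6 * (real n)\<^sup>2)"] less.prems(3) n2 by simp
      have q1: "0 \<le> 1 / (1 - ?q)" using less.prems(3) by simp
      have nonneg: "0 \<le> partition_fun Y P B' s" for Y :: "nat set" and P B' s
        unfolding partition_fun_def by (auto intro!: sum_nonneg)
      have "partition_fun ?L (bonds p m) BL (2 / 3 * t) * partition_fun ?R (bonds (p + m) (n - m)) BR (2 / 3 * t) * (1 / (1 - ?q))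
        \<le> exp (648 * (2 / 3 * ((real n)\<^sup>2 / t))\<^sup>2) * exp (648 * (2 / 3 * ((real n)\<^sup>2 / t))\<^sup>2) * exp (2 / (t / (6 * (real n)\<^sup>2))\<^sup>2)"
        using m half[OF _ _ _ BL] half[OF _ _ _ BR] q q1 nonneg by (intro mult_mono mult_nonneg_nonneg) auto
      then show ?thesis by simp
    qed
    \<comment> \<open>Origin of \<open>648\<close>: the two halves use
      \<open>2 * (2/3)^2 = 8/9\<close> of the exponent, the geometric factor contributes
      \<open>2 * 6^2 = 72\<close>, and \<open>72\<close> is a ninth of \<open>648\<close>.\<close>
    also have "\<dots> = exp (648 * ((real n)\<^sup>2 / t)\<^sup>2)"
      using less.prems(3) n2 by (simp add: exp_add[symmetric] power2_eq_square field_simps)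
    finally show ?thesis unfolding X .
  qed
qed

section \<open>The spectrum of the exclusion process\<close>

text \<open>Translates between sets, on which raising and lowering act, and the extensional
  configurations of the process.\<close>

definition occupy :: "nat \<Rightarrow> nat set \<Rightarrow> nat \<Rightarrow> nat" where
  "occupy N A = (\<lambda>x\<in>{..<N}. if x \<in> A then 1 else 0)"

lemma occupy_bij: "bij_betw (occupy N) {A. A \<subseteq> {..<N} \<and> card A = k} (config_space N k)"
proof (rule bij_betwI[where g = "\<lambda>\<eta>. {x \<in> {..<N}. \<eta> x = 1}"])
  show "occupy N \<in> {A. A \<subseteq> {..<N} \<and> card A = k} \<rightarrow> config_space N k"
  proof
    fix A assume A: "A \<in> {A. A \<subseteq> {..<N} \<and> card A = k}"
    have "(\<Sum>x<N. occupy N A x) = (\<Sum>x\<in>A. 1)"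
      using A by (intro sum.mono_neutral_cong_right) (auto simp: occupy_def)
    then show "occupy N A \<in> config_space N k"
      using A by (auto simp: config_space_def occupy_def)
  qed
  have 01: "\<eta> x = 0 \<or> \<eta> x = 1" if "\<eta> \<in> config_space N k" "x < N" for \<eta> x
    using that by (auto simp: config_space_def PiE_iff)
  show "(\<lambda>\<eta>. {x \<in> {..<N}. \<eta> x = 1}) \<in> config_space N k \<rightarrow> {A. A \<subseteq> {..<N} \<and> card A = k}"
  proof
    fix \<eta> assume \<eta>: "\<eta> \<in> config_space N k"
    have "card {x \<in> {..<N}. \<eta> x = 1} = (\<Sum>x\<in>{x \<in> {..<N}. \<eta> x = 1}. \<eta> x)" by simp
    also have "\<dots> = (\<Sum>x<N. \<eta> x)"
      by (intro sum.mono_neutral_left) (auto dest: 01[OF \<eta>])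
    finally show "{x \<in> {..<N}. \<eta> x = 1} \<in> {A. A \<subseteq> {..<N} \<and> card A = k}"
      using \<eta> by (auto simp: config_space_def)
  qed
  show "{x \<in> {..<N}. occupy N A x = 1} = A" if "A \<in> {A. A \<subseteq> {..<N} \<and> card A = k}" for A
    using that by (auto simp: occupy_def)
  show "occupy N {x \<in> {..<N}. \<eta> x = 1} = \<eta>" if "\<eta> \<in> config_space N k" for \<eta>
  proof
    fix x show "occupy N {x \<in> {..<N}. \<eta> x = 1} x = \<eta> x"
      using 01[OF that, of x] that by (cases "x < N") (auto simp: occupy_def config_space_def PiE_def extensional_def)
  qed
qed

lemma finite_config_space: "finite (config_space N k)"
  by (rule finite_subset[of _ "{..<N} \<rightarrow>\<^sub>E {0, 1}"]) (auto simp: config_space_def intro: finite_PiE)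

lemma card_config_space: "card (config_space N k) = N choose k"
  using bij_betw_same_card[OF occupy_bij] n_subsets[of "{..<N}" k] by simp

lemma exchange_exchange [simp]: "exchange N x (exchange N x \<eta>) = \<eta>"
  by (simp add: exchange_def comp_assoc)

lemma exchange_in_config_space:
  assumes "x < N" "\<eta> \<in> config_space N k"
  shows "exchange N x \<eta> \<in> config_space N k"
proof -
  let ?t = "transpose x (Suc x mod N)"
  have y: "Suc x mod N < N" using assms by auto
  have t: "?t z < N \<longleftrightarrow> z < N" for z using assms y by (auto simp: transpose_def)
  have "(\<Sum>z<N. \<eta> (?t z)) = (\<Sum>z<N. \<eta> z)"
    by (rule sum.reindex_bij_witness[where i = ?t and j = ?t]) (auto simp: t)
  then show ?thesis
    using assms t unfolding config_space_def exchange_def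
    by (auto simp: PiE_iff extensional_def)
qed

lemma exchange_in_config_space_iff:
  "x < N \<Longrightarrow> exchange N x \<eta> \<in> config_space N k \<longleftrightarrow> \<eta> \<in> config_space N k"
  using exchange_in_config_space[of x N] by (metis exchange_exchange)

lemma sum_exchange:
  "x < N \<Longrightarrow> (\<Sum>\<eta>\<in>config_space N k. G (exchange N x \<eta>)) = (\<Sum>\<eta>\<in>config_space N k. G \<eta>)"
  by (rule sum.reindex_bij_witness[where i = "exchange N x" and j = "exchange N x"])
     (auto simp: exchange_in_config_space)

lemma sep_generator_ip:
  "ip (config_space N k) f (sep_generator N g)
    = - (\<Sum>x<N. \<Sum>\<eta>\<in>config_space N k. (f (exchange N x \<eta>) - f \<eta>) * (g (exchange N x \<eta>) - g \<eta>)) / 2"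
proof -
  let ?S = "config_space N k"
  have "(\<Sum>\<eta>\<in>?S. f \<eta> * (g (exchange N x \<eta>) - g \<eta>))
    = - (\<Sum>\<eta>\<in>?S. (f (exchange N x \<eta>) - f \<eta>) * (g (exchange N x \<eta>) - g \<eta>)) / 2" if "x < N" for x
  proof -
    have "(\<Sum>\<eta>\<in>?S. f \<eta> * (g (exchange N x \<eta>) - g \<eta>)) = (\<Sum>\<eta>\<in>?S. f (exchange N x \<eta>) * (g \<eta> - g (exchange N x \<eta>)))"
      using sum_exchange[OF that, of "\<lambda>\<eta>. f (exchange N x \<eta>) * (g \<eta> - g (exchange N x \<eta>))" k] by simp
    moreover have "(\<Sum>\<eta>\<in>?S. (f (exchange N x \<eta>) - f \<eta>) * (g (exchange N x \<eta>) - g \<eta>))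
      = - (\<Sum>\<eta>\<in>?S. f (exchange N x \<eta>) * (g \<eta> - g (exchange N x \<eta>))) - (\<Sum>\<eta>\<in>?S. f \<eta> * (g (exchange N x \<eta>) - g \<eta>))"
      unfolding sum_negf[symmetric] sum_subtractf[symmetric] by (intro sum.cong refl) (simp add: algebra_simps)
    ultimately show ?thesis by simp
  qed
  then have "(\<Sum>x<N. \<Sum>\<eta>\<in>?S. f \<eta> * (g (exchange N x \<eta>) - g \<eta>))
    = (\<Sum>x<N. - (\<Sum>\<eta>\<in>?S. (f (exchange N x \<eta>) - f \<eta>) * (g (exchange N x \<eta>) - g \<eta>)) / 2)" by simp
  then show ?thesis
    unfolding ip_def sep_generator_def sum_distrib_left
    by (subst sum.swap) (simp add: sum_divide_distrib sum_negf)
qed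

lemma sep_generator_sym:
  "ip (config_space N k) (sep_generator N f) g = ip (config_space N k) f (sep_generator N g)"
  by (subst ip_commute) (simp add: sep_generator_ip mult.commute)

lemma sep_generator_sum: "sep_generator N (\<lambda>\<eta>. \<Sum>i\<in>I. c i * f i \<eta>) = (\<lambda>\<eta>. \<Sum>i\<in>I. c i * sep_generator N (f i) \<eta>)"
  unfolding sep_generator_def
  by (rule ext) (simp add: sum_subtractf[symmetric] sum_distrib_left right_diff_distrib, rule sum.swap)

text \<open>\<open>frame\<close> expresses completeness of \<Phi>. Requiring support in the
  configuration space makes the eigenvalue equation valid for all arguments, so that powers of the
  generator act termwise.\<close>

locale sep_spectrum =
  fixes N k :: nat and \<Phi> :: "((nat \<Rightarrow> nat) \<Rightarrow> real) set" and E :: "((nat \<Rightarrow> nat) \<Rightarrow> real) \<Rightarrow> real"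
  assumes orthonormal: "orthonormal (config_space N k) \<Phi>"
    and frame: "frame (config_space N k) \<Phi> (\<lambda>\<phi>. \<phi>)"
    and eigen: "\<And>\<phi> \<eta>. \<phi> \<in> \<Phi> \<Longrightarrow> sep_generator N \<phi> \<eta> = - E \<phi> * \<phi> \<eta>"
    and support: "\<And>\<phi> \<eta>. \<phi> \<in> \<Phi> \<Longrightarrow> \<eta> \<notin> config_space N k \<Longrightarrow> \<phi> \<eta> = 0"

lemma sep_spectrum_exists: "\<exists>\<Phi> E. sep_spectrum N k \<Phi> E"
proof -
  let ?S = "config_space N k"
  define V where "V = {f :: (nat \<Rightarrow> nat) \<Rightarrow> real. \<forall>\<eta>. \<eta> \<notin> ?S \<longrightarrow> f \<eta> = 0}"
  have "\<exists>B \<subseteq> V. orthonormal ?S B \<and> (\<forall>b\<in>B. \<forall>x. sep_generator N b x = ip ?S b (sep_generator N b) * b x) \<and>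
           (\<forall>f\<in>V. \<forall>x\<in>?S. f x = (\<Sum>b\<in>B. ip ?S f b * b x))"
  proof (rule orthonormal_eigenbasis[where A = "sep_generator N" and V = V and S = ?S])
    show "finite ?S" by (rule finite_config_space)
    have "V = (\<Inter>\<eta>\<in>- ?S. {f. f \<eta> = 0})" by (auto simp: V_def)
    moreover have "closed {f. f \<eta> = (0::real)}" for \<eta> :: "nat \<Rightarrow> nat"
      by (intro closed_Collect_eq continuous_intros continuous_on_product_coordinates)
    ultimately show "closed V" by (simp only:) (intro closed_INT ballI)
    show "sep_generator N f \<in> V" if "f \<in> V" for f
      using that by (auto simp: V_def sep_generator_def exchange_in_config_space_iff intro!: sum.neutral)
    show "sep_generator N (\<lambda>x. a * f x + b * g x) = (\<lambda>x. a * sep_generator N f x + b * sep_generator N g x)" for f g a b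
      unfolding sep_generator_def by (rule ext) (simp add: sum_distrib_left sum.distrib[symmetric] algebra_simps)
    show "continuous_on UNIV (\<lambda>f. sep_generator N f x)" for x
      unfolding sep_generator_def by (intro continuous_intros continuous_on_product_coordinates)
  qed (auto simp: V_def sep_generator_sym)
  then obtain B where B: "B \<subseteq> V" "orthonormal ?S B"
    "\<And>b x. b \<in> B \<Longrightarrow> sep_generator N b x = ip ?S b (sep_generator N b) * b x"
    "\<And>f x. f \<in> V \<Longrightarrow> x \<in> ?S \<Longrightarrow> f x = (\<Sum>b\<in>B. ip ?S f b * b x)" by blast
  have "sep_spectrum N k B (\<lambda>b. - ip ?S b (sep_generator N b))"
  proof
    show "frame ?S B (\<lambda>\<phi>. \<phi>)"
      unfolding frame_def
    proof (intro conjI ballI)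
      show "finite ?S" by (rule finite_config_space)
      show "finite B" using B(2) by (simp add: orthonormal_def)
      fix x y assume x: "x \<in> ?S" and y: "y \<in> ?S"
      have "indicator {x} \<in> V" using x by (auto simp: V_def indicator_def)
      from B(4)[OF this y] have "(indicator {x} y :: real) = (\<Sum>b\<in>B. b x * b y)"
        by (simp add: ip_delta[OF finite_config_space x])
      then show "(\<Sum>b\<in>B. b x * b y) = (if x = y then 1 else 0)" by (auto simp: indicator_def)
    qed
    show "\<phi> \<eta> = 0" if "\<phi> \<in> B" "\<eta> \<notin> ?S" for \<phi> \<eta> using that B(1) by (auto simp: V_def)
    show "sep_generator N \<phi> \<eta> = - (- ip ?S \<phi> (sep_generator N \<phi>)) * \<phi> \<eta>" if "\<phi> \<in> B" for \<phi> \<eta>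
      using B(3)[OF that] by simp
  qed (rule B(2))
  then show ?thesis by blast
qed

context sep_spectrum
begin

lemma law_expand:
  assumes \<omega>: "\<omega> \<in> config_space N k" and \<chi>: "\<chi> \<in> config_space N k"
  shows "sep_law N t \<chi> \<omega> = (\<Sum>\<phi>\<in>\<Phi>. exp (- t * E \<phi>) * (\<phi> \<chi> * \<phi> \<omega>))"
proof -
  have ind: "indicator {\<omega>} = (\<lambda>\<eta>. \<Sum>\<phi>\<in>\<Phi>. \<phi> \<omega> * \<phi> \<eta>)"
  proof
    fix \<eta> show "indicator {\<omega>} \<eta> = (\<Sum>\<phi>\<in>\<Phi>. \<phi> \<omega> * \<phi> \<eta>)"
    proof (cases "\<eta> \<in> config_space N k")
      case True
      then show ?thesis using frame \<omega> by (simp add: frame_def indicator_def)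
    next
      case False
      then show ?thesis using support \<omega> by (auto simp: indicator_def intro!: sum.neutral)
    qed
  qed
  have pow: "(sep_generator N ^^ n) (indicator {\<omega>}) = (\<lambda>\<eta>. \<Sum>\<phi>\<in>\<Phi>. ((- E \<phi>) ^ n * \<phi> \<omega>) * \<phi> \<eta>)" for n
  proof (induction n)
    case (Suc n)
    show ?case unfolding funpow.simps o_apply Suc sep_generator_sum
      by (intro ext sum.cong refl) (simp add: eigen)
  qed (simp add: ind)
  have "(\<lambda>n. \<Sum>\<phi>\<in>\<Phi>. (\<phi> \<chi> * \<phi> \<omega>) * ((- t * E \<phi>) ^ n /\<^sub>R fact n)) sums (\<Sum>\<phi>\<in>\<Phi>. (\<phi> \<chi> * \<phi> \<omega>) * exp (- t * E \<phi>))"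
    by (intro sums_sum sums_mult exp_converges)
  moreover have "(\<Sum>\<phi>\<in>\<Phi>. (\<phi> \<chi> * \<phi> \<omega>) * ((- t * E \<phi>) ^ n /\<^sub>R fact n))
      = (sep_generator N ^^ n) (indicator {\<omega>}) \<chi> / fact n * t ^ n" for n
  proof -
    have "(- t * E \<phi>) ^ n = (- E \<phi>) ^ n * t ^ n" for \<phi> by (simp add: power_mult_distrib[symmetric] mult.commute)
    then show ?thesis
      unfolding pow by (simp add: sum_distrib_left sum_distrib_right sum_divide_distrib divide_inverse mult_ac)
  qed
  ultimately have "(\<lambda>n. (sep_generator N ^^ n) (indicator {\<omega>}) \<chi> / fact n * t ^ n) sums (\<Sum>\<phi>\<in>\<Phi>. (\<phi> \<chi> * \<phi> \<omega>) * exp (- t * E \<phi>))"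
    by simp
  then show ?thesis
    unfolding sep_law_def sep_semigroup_def by (simp add: sums_iff mult.commute)
qed

lemma law_sym:
  "\<omega> \<in> config_space N k \<Longrightarrow> \<chi> \<in> config_space N k \<Longrightarrow> sep_law N t \<chi> \<omega> = sep_law N t \<omega> \<chi>"
  by (simp add: law_expand mult.commute)

text \<open>By symmetry of the generator \<open>F\<close> is orthogonal to every \<phi> whose
  eigenvalue differs from \<open>c\<close>. The equation for \<open>F\<close> is asked for only on
  the configuration space, as test functions need not vanish outside it.\<close>

lemma law_eigenfunction:
  assumes F: "\<And>\<eta>. \<eta> \<in> config_space N k \<Longrightarrow> sep_generator N F \<eta> = - c * F \<eta>" and \<chi>: "\<chi> \<in> config_space N k"
  shows "(\<Sum>\<omega>\<in>config_space N k. sep_law N t \<chi> \<omega> * F \<omega>) = exp (- t * c) * F \<chi>"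
proof -
  let ?S = "config_space N k"
  have E: "exp (- t * E \<phi>) * ip ?S F \<phi> = exp (- t * c) * ip ?S F \<phi>" if \<phi>: "\<phi> \<in> \<Phi>" for \<phi>
  proof -
    have "- c * ip ?S F \<phi> = ip ?S (sep_generator N F) \<phi>"
      unfolding ip_scale_left[symmetric] by (intro ip_cong) (simp_all add: F)
    also have "\<dots> = ip ?S F (\<lambda>\<eta>. - E \<phi> * \<phi> \<eta>)"
      unfolding sep_generator_sym by (intro ip_cong) (simp_all add: eigen \<phi>)
    also have "\<dots> = - E \<phi> * ip ?S F \<phi>" by (rule ip_scale_right)
    finally show ?thesis by auto
  qed
  have "(\<Sum>\<omega>\<in>?S. sep_law N t \<chi> \<omega> * F \<omega>) = (\<Sum>\<omega>\<in>?S. \<Sum>\<phi>\<in>\<Phi>. \<phi> \<chi> * (exp (- t * E \<phi>) * (F \<omega> * \<phi> \<omega>)))"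
    by (intro sum.cong refl) (simp add: law_expand \<chi> sum_distrib_left sum_distrib_right mult_ac)
  also have "\<dots> = (\<Sum>\<phi>\<in>\<Phi>. \<phi> \<chi> * (exp (- t * E \<phi>) * ip ?S F \<phi>))"
    by (subst sum.swap) (simp add: ip_def sum_distrib_left)
  also have "\<dots> = (\<Sum>\<phi>\<in>\<Phi>. \<phi> \<chi> * (exp (- t * c) * ip ?S F \<phi>))"
    by (intro sum.cong refl) (simp only: E)
  also have "\<dots> = exp (- t * c) * (\<Sum>\<phi>\<in>\<Phi>. ip ?S F \<phi> * \<phi> \<chi>)"
    by (simp add: sum_distrib_left mult_ac)
  also have "(\<Sum>\<phi>\<in>\<Phi>. ip ?S F \<phi> * \<phi> \<chi>) = F \<chi>"
    using frame_parseval[OF frame, of F "indicator {\<chi>}"] \<chi>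
    by (simp add: ip_delta finite_config_space ip_commute[of _ F "indicator _"])
  finally show ?thesis .
qed

lemma law_sum: "\<chi> \<in> config_space N k \<Longrightarrow> (\<Sum>\<omega>\<in>config_space N k. sep_law N t \<chi> \<omega>) = 1"
  using law_eigenfunction[of "\<lambda>_. 1" 0 \<chi> t] by (simp add: sep_generator_def)

text \<open>By symmetry of the law the inner sum is the return mass at time \<open>2 * t\<close>,
  and return masses add up to the trace.\<close>

lemma law_sum_squares:
  "(\<Sum>\<chi>\<in>config_space N k. \<Sum>\<omega>\<in>config_space N k. (sep_law N t \<chi> \<omega>)\<^sup>2) = (\<Sum>\<phi>\<in>\<Phi>. exp (- (2 * t) * E \<phi>))"
proof -
  let ?S = "config_space N k"
  have "(\<Sum>\<chi>\<in>?S. \<Sum>\<omega>\<in>?S. (sep_law N t \<chi> \<omega>)\<^sup>2) = (\<Sum>\<chi>\<in>?S. \<Sum>\<omega>\<in>?S. sep_law N t \<omega> \<chi> * sep_law N t \<chi> \<omega>)"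
    by (intro sum.cong refl) (simp add: power2_eq_square law_sym)
  also have "\<dots> = (\<Sum>\<chi>\<in>?S. \<Sum>\<phi>\<in>\<Phi>. exp (- (2 * t) * E \<phi>) * (\<phi> \<chi> * \<phi> \<chi>))"
  proof (rule sum.cong[OF refl])
    fix \<chi> assume \<chi>: "\<chi> \<in> ?S"
    have "(\<Sum>\<omega>\<in>?S. sep_law N t \<omega> \<chi> * sep_law N t \<chi> \<omega>)
      = (\<Sum>\<omega>\<in>?S. \<Sum>\<phi>\<in>\<Phi>. exp (- t * E \<phi>) * \<phi> \<chi> * (sep_law N t \<chi> \<omega> * \<phi> \<omega>))"
      by (intro sum.cong refl) (simp add: law_expand[of \<chi>] \<chi> sum_distrib_left sum_distrib_right mult_ac)
    also have "\<dots> = (\<Sum>\<phi>\<in>\<Phi>. exp (- t * E \<phi>) * \<phi> \<chi> * (exp (- t * E \<phi>) * \<phi> \<chi>))"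
      by (subst sum.swap) (simp add: sum_distrib_left[symmetric] law_eigenfunction[OF eigen \<chi>])
    also have "\<dots> = (\<Sum>\<phi>\<in>\<Phi>. exp (- (2 * t) * E \<phi>) * (\<phi> \<chi> * \<phi> \<chi>))"
    proof (rule sum.cong[OF refl])
      fix \<phi>
      have "exp (- (2 * t) * E \<phi>) = exp (- t * E \<phi>) * exp (- t * E \<phi>)"
        unfolding exp_add[symmetric] by simp
      then show "exp (- t * E \<phi>) * \<phi> \<chi> * (exp (- t * E \<phi>) * \<phi> \<chi>) = exp (- (2 * t) * E \<phi>) * (\<phi> \<chi> * \<phi> \<chi>)"
        by (simp add: mult_ac)
    qed
    finally show "(\<Sum>\<omega>\<in>?S. sep_law N t \<omega> \<chi> * sep_law N t \<chi> \<omega>) = (\<Sum>\<phi>\<in>\<Phi>. exp (- (2 * t) * E \<phi>) * (\<phi> \<chi> * \<phi> \<chi>))" .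
  qed
  also have "\<dots> = (\<Sum>\<phi>\<in>\<Phi>. exp (- (2 * t) * E \<phi>) * ip ?S \<phi> \<phi>)"
    by (subst sum.swap) (simp add: ip_def sum_distrib_left)
  also have "\<dots> = (\<Sum>\<phi>\<in>\<Phi>. exp (- (2 * t) * E \<phi>))"
    using orthonormal by (simp add: orthonormal_def)
  finally show ?thesis .
qed

lemma law_nonneg:
  assumes t: "0 \<le> t" and \<omega>: "\<omega> \<in> config_space N k" and \<chi>: "\<chi> \<in> config_space N k"
  shows "0 \<le> sep_law N t \<chi> \<omega>"
proof -
  \<comment> \<open>\<open>Q n\<close> is the \<open>n\<close>-th power of generator plus
    \<open>N\<close> applied to the indicator of \<omega>. That operator is a sum of exchanges, so
    it preserves positivity; the shift by \<open>N\<close> only multiplies the law by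
    \<open>exp (t * N)\<close>.\<close>
  define Q where "Q n \<eta> = (\<Sum>\<phi>\<in>\<Phi>. (real N - E \<phi>) ^ n * \<phi> \<omega> * \<phi> \<eta>)" for n \<eta>
  have Q: "0 \<le> Q n \<eta>" if "\<eta> \<in> config_space N k" for n \<eta>
    using that
  proof (induction n arbitrary: \<eta>)
    case 0
    then show ?case using frame \<omega> by (simp add: Q_def frame_def)
  next
    case (Suc n)
    have "real N * Q n \<eta> + sep_generator N (Q n) \<eta> = (\<Sum>x<N. Q n (exchange N x \<eta>))"
      by (simp add: sep_generator_def sum_subtractf)
    moreover have "sep_generator N (Q n) \<eta> = (\<Sum>\<phi>\<in>\<Phi>. ((real N - E \<phi>) ^ n * \<phi> \<omega>) * (- E \<phi> * \<phi> \<eta>))"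
      unfolding Q_def[abs_def] sep_generator_sum by (intro sum.cong refl) (simp add: eigen)
    ultimately have "Q (Suc n) \<eta> = (\<Sum>x<N. Q n (exchange N x \<eta>))"
      unfolding Q_def[of n \<eta>] Q_def[of "Suc n" \<eta>] sum_distrib_left
      by (simp add: sum.distrib[symmetric] algebra_simps)
    also have "0 \<le> \<dots>" using Suc by (intro sum_nonneg) (simp add: exchange_in_config_space)
    finally show ?case .
  qed
  have "(\<lambda>n. \<Sum>\<phi>\<in>\<Phi>. (\<phi> \<omega> * \<phi> \<chi>) * ((t * (real N - E \<phi>)) ^ n /\<^sub>R fact n)) sums (\<Sum>\<phi>\<in>\<Phi>. (\<phi> \<omega> * \<phi> \<chi>) * exp (t * (real N - E \<phi>)))"
    by (intro sums_sum sums_mult exp_converges)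
  moreover have "(\<Sum>\<phi>\<in>\<Phi>. (\<phi> \<omega> * \<phi> \<chi>) * ((t * (real N - E \<phi>)) ^ n /\<^sub>R fact n)) = t ^ n / fact n * Q n \<chi>" for n
    unfolding Q_def sum_distrib_left
    by (intro sum.cong refl) (simp add: power_mult_distrib divide_inverse mult_ac)
  ultimately have "(\<lambda>n. t ^ n / fact n * Q n \<chi>) sums (\<Sum>\<phi>\<in>\<Phi>. (\<phi> \<omega> * \<phi> \<chi>) * exp (t * (real N - E \<phi>)))"
    by simp
  then have "0 \<le> (\<Sum>\<phi>\<in>\<Phi>. (\<phi> \<omega> * \<phi> \<chi>) * exp (t * (real N - E \<phi>)))"
  proof (rule sums_le[OF _ sums_zero, rotated])
    show "0 \<le> t ^ n / fact n * Q n \<chi>" for n using Q[OF \<chi>, of n] t by simp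
  qed
  also have "\<dots> = exp (t * real N) * sep_law N t \<chi> \<omega>"
  proof -
    have "exp (t * (real N - E \<phi>)) = exp (t * real N) * exp (- t * E \<phi>)" for \<phi>
      unfolding exp_add[symmetric] by (simp add: right_diff_distrib)
    then show ?thesis
      unfolding law_expand[OF \<omega> \<chi>] sum_distrib_left by (intro sum.cong refl) (simp add: mult_ac)
  qed
  finally show ?thesis by (simp add: zero_le_mult_iff)
qed

end

section \<open>The trace of the semigroup\<close>

lemma occupy_transpose:
  assumes "x < N" "y < N"
  shows "occupy N (transpose x y ` A) = occupy N A \<circ> transpose x y"
proof
  fix z
  have "z \<in> transpose x y ` A \<longleftrightarrow> transpose x y z \<in> A"
    by (metis imageE image_eqI transpose_involutory)
  moreover have "transpose x y z < N \<longleftrightarrow> z < N" using assms by (auto simp: transpose_def)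
  ultimately show "occupy N (transpose x y ` A) z = (occupy N A \<circ> transpose x y) z"
    using assms by (cases "z < N") (auto simp: occupy_def)
qed

lemma occupy_outside:
  assumes "A \<subseteq> {..<N}" "card A \<noteq> k"
  shows "occupy N A \<notin> config_space N k"
proof -
  have "occupy N A \<in> config_space N (card A)"
    using bij_betwE[OF occupy_bij, of N "card A"] assms(1) by blast
  then show ?thesis using assms(2) by (auto simp: config_space_def)
qed

lemma sum_Pow_occupy:
  assumes "\<And>\<eta>. \<eta> \<notin> config_space N k \<Longrightarrow> G \<eta> = (0::real)"
  shows "(\<Sum>A\<in>Pow {..<N}. G (occupy N A)) = (\<Sum>\<eta>\<in>config_space N k. G \<eta>)"
proof -
  have "(\<Sum>A\<in>Pow {..<N}. G (occupy N A)) = (\<Sum>A\<in>{A. A \<subseteq> {..<N} \<and> card A = k}. G (occupy N A))"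
    using occupy_outside assms by (intro sum.mono_neutral_right) auto
  also have "\<dots> = (\<Sum>\<eta>\<in>config_space N k. G \<eta>)" by (rule sum.reindex_bij_betw[OF occupy_bij])
  finally show ?thesis .
qed

context sep_spectrum
begin

lemma eigenvalue_energy:
  assumes "\<phi> \<in> \<Phi>"
  shows "E \<phi> = (\<Sum>x<N. \<Sum>\<eta>\<in>config_space N k. (\<phi> (exchange N x \<eta>) - \<phi> \<eta>)\<^sup>2) / 2"
proof -
  have "ip (config_space N k) \<phi> (sep_generator N \<phi>) = ip (config_space N k) \<phi> (\<lambda>\<eta>. - E \<phi> * \<phi> \<eta>)"
    by (intro ip_cong refl) (simp add: eigen assms)
  also have "\<dots> = - E \<phi>" unfolding ip_scale_right using orthonormal assms by (simp add: orthonormal_def)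
  finally show ?thesis unfolding sep_generator_ip by (simp add: power2_eq_square)
qed

text \<open>The energy on the cycle is a sum of squares over bonds; dropping the bond that closes
  the cycle can only decrease it.\<close>

lemma eigenvalue_ge_segment:
  assumes \<phi>: "\<phi> \<in> \<Phi>"
  shows "ip (Pow {..<N}) (\<lambda>A. \<phi> (occupy N A)) (exch (bonds 0 N) (\<lambda>A. \<phi> (occupy N A))) \<le> E \<phi>"
proof -
  let ?g = "\<lambda>x. \<Sum>\<eta>\<in>config_space N k. (\<phi> (exchange N x \<eta>) - \<phi> \<eta>)\<^sup>2"
  have "(\<Sum>A\<in>Pow {..<N}. (\<phi> (occupy N A) - \<phi> (occupy N (transpose x (Suc x) ` A)))\<^sup>2) = ?g x" if x: "Suc x < N" for x
  proof -
    have "occupy N (transpose x (Suc x) ` A) = exchange N x (occupy N A)" for A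
      using occupy_transpose[of x N "Suc x" A] x by (simp add: exchange_def)
    moreover have "\<phi> (exchange N x \<eta>) - \<phi> \<eta> = 0" if "\<eta> \<notin> config_space N k" for \<eta>
      using that x support[OF \<phi>] by (simp add: exchange_in_config_space_iff)
    ultimately show ?thesis
      using sum_Pow_occupy[of N k "\<lambda>\<eta>. (\<phi> (exchange N x \<eta>) - \<phi> \<eta>)\<^sup>2"] by (simp add: power2_commute)
  qed
  then have "ip (Pow {..<N}) (\<lambda>A. \<phi> (occupy N A)) (exch (bonds 0 N) (\<lambda>A. \<phi> (occupy N A)))
    = (\<Sum>x\<in>{x. Suc x < N}. ?g x) / 2"
    using exch_energy[OF bonds_subset, of 0 N "\<lambda>A. \<phi> (occupy N A)"]
    by (simp add: bonds_def sum.reindex inj_on_def atLeast0LessThan)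
  also have "\<dots> \<le> (\<Sum>x<N. ?g x) / 2"
    by (intro divide_right_mono sum_mono2 sum_nonneg) auto
  finally show ?thesis using eigenvalue_energy[OF \<phi>] by simp
qed

lemma ip_occupy:
  assumes "\<phi> \<in> \<Phi>"
  shows "ip (Pow {..<N}) (\<lambda>A. \<phi> (occupy N A)) g
    = ip (config_space N k) \<phi> (\<lambda>\<eta>. g {x \<in> {..<N}. \<eta> x = 1})"
proof -
  have "{x \<in> {..<N}. occupy N A x = 1} = A" if "A \<subseteq> {..<N}" for A
    using that by (auto simp: occupy_def)
  then have "ip (Pow {..<N}) (\<lambda>A. \<phi> (occupy N A)) g
     = (\<Sum>A\<in>Pow {..<N}. (\<lambda>\<eta>. \<phi> \<eta> * g {x \<in> {..<N}. \<eta> x = 1}) (occupy N A))"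
    unfolding ip_def by (intro sum.cong refl) simp
  also have "\<dots> = ip (config_space N k) \<phi> (\<lambda>\<eta>. g {x \<in> {..<N}. \<eta> x = 1})"
    unfolding ip_def by (rule sum_Pow_occupy) (simp add: support assms)
  finally show ?thesis .
qed

text \<open>The functions in \<Phi>, carried over to sets, form an orthonormal basis of level
  \<open>k\<close>. By Parseval the sum is the squared norm of the level \<open>k\<close> part of
  \<open>g\<close>.\<close>

lemma sum_coefficient_squares:
  assumes g: "leveled {..<N} i g" "ip (Pow {..<N}) g g \<le> 1"
  shows "(\<Sum>\<phi>\<in>\<Phi>. (ip (Pow {..<N}) (\<lambda>A. \<phi> (occupy N A)) g)\<^sup>2) \<le> (if i = k then 1 else 0)"
proof -
  let ?h = "\<lambda>\<eta>. g {x \<in> {..<N}. \<eta> x = 1}"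
  have "(\<Sum>\<phi>\<in>\<Phi>. (ip (Pow {..<N}) (\<lambda>A. \<phi> (occupy N A)) g)\<^sup>2)
    = (\<Sum>\<phi>\<in>\<Phi>. ip (config_space N k) ?h \<phi> * ip (config_space N k) ?h \<phi>)"
    by (intro sum.cong refl) (simp only: ip_occupy power2_eq_square ip_commute[of _ ?h])
  also have "\<dots> = ip (config_space N k) ?h ?h" by (rule frame_parseval[OF frame])
  also have "\<dots> = (\<Sum>A\<in>{A. A \<subseteq> {..<N} \<and> card A = k}. ?h (occupy N A) * ?h (occupy N A))"
    unfolding ip_def by (rule sum.reindex_bij_betw[OF occupy_bij, symmetric])
  also have "\<dots> = (\<Sum>A\<in>{A. A \<subseteq> {..<N} \<and> card A = k}. g A * g A)"
  proof (rule sum.cong[OF refl])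
    fix A assume "A \<in> {A. A \<subseteq> {..<N} \<and> card A = k}"
    then have "{x \<in> {..<N}. occupy N A x = 1} = A" by (auto simp: occupy_def)
    then show "?h (occupy N A) * ?h (occupy N A) = g A * g A" by simp
  qed
  also have "\<dots> \<le> (if i = k then 1 else 0)"
  proof (cases "i = k")
    case True
    have "(\<Sum>A\<in>{A. A \<subseteq> {..<N} \<and> card A = k}. g A * g A) \<le> ip (Pow {..<N}) g g"
      unfolding ip_def by (intro sum_mono2) auto
    then show ?thesis using True g(2) by simp
  next
    case False
    then show ?thesis using g(1) by (auto simp: leveled_def intro!: sum_nonpos)
  qed
  finally show ?thesis .
qed

text \<open>Peierls' inequality in the multiplet frame of the segment: Jensen for every \<phi>, then
  summation over \<phi>, where each multiplet vector receives total weight at most \<open>1\<close>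
  and only on level \<open>k\<close>.\<close>

lemma trace_le:
  assumes N: "1 \<le> N" and t: "0 < t"
  shows "(\<Sum>\<phi>\<in>\<Phi>. exp (- t * E \<phi>)) \<le> exp (648 * ((real N)\<^sup>2 / t)\<^sup>2)"
proof -
  let ?X = "{..<N}" and ?P = "bonds 0 N"
  have P: "?P \<subseteq> ?X \<times> ?X" using bonds_subset[of 0 N] by (simp add: atLeast0LessThan)
  obtain B where B: "eigenfamily ?X ?P B" using eigenfamily_exists[OF finite_lessThan P] by blast
  note X = finite_lessThan[of N]
  let ?I = "multiplet_index ?X B"
  let ?en = "\<lambda>f. ip (Pow ?X) f (exch ?P f)"
  let ?c = "\<lambda>\<phi> f a. ip (Pow ?X) (\<lambda>A. \<phi> (occupy N A)) (multiplet ?X f a)"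
  note fr = frame_multiplet[OF X B]
  have "exp (- t * E \<phi>) \<le> (\<Sum>(j,f,a)\<in>?I. (?c \<phi> f a)\<^sup>2 * exp (- t * ?en f))" if \<phi>: "\<phi> \<in> \<Phi>" for \<phi>
  proof -
    let ?\<psi> = "\<lambda>A. \<phi> (occupy N A)"
    let ?e = "\<lambda>(j::nat,f,a). multiplet ?X f a"
    have "ip (Pow ?X) ?\<psi> ?\<psi> = ip (config_space N k) \<phi> \<phi>"
      unfolding ip_def by (rule sum_Pow_occupy) (simp add: support \<phi>)
    then have n: "ip (Pow ?X) ?\<psi> ?\<psi> = 1" using orthonormal \<phi> by (simp add: orthonormal_def)
    have "(\<Sum>i\<in>?I. (ip (Pow ?X) ?\<psi> (?e i))\<^sup>2 * ?en (fst (snd i))) = ip (Pow ?X) ?\<psi> (exch ?P ?\<psi>)"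
    proof (rule frame_sym_eigen[OF fr, symmetric])
      show "ip (Pow ?X) (exch ?P ?\<psi>) (?e i) = ip (Pow ?X) ?\<psi> (exch ?P (?e i))" for i
        by (rule exch_sym[OF P])
      fix i A assume "i \<in> ?I"
      then obtain j f a where i: "i = (j, f, a)" and f: "f \<in> B j"
        by (auto simp: multiplet_index_def[OF X B])
      have "exch ?P f A = ?en f * f A" for A using B f by (auto simp: eigenfamily_def)
      from exch_multiplet[OF P this] show "exch ?P (?e i) A = ?en (fst (snd i)) * ?e i A"
        by (simp add: i)
    qed
    also have "\<dots> \<le> E \<phi>" by (rule eigenvalue_ge_segment[OF \<phi>])
    finally have "(\<Sum>i\<in>?I. (ip (Pow ?X) ?\<psi> (?e i))\<^sup>2 * ?en (fst (snd i))) \<le> E \<phi>" .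
    from jensen_exp[OF _ _ _ this less_imp_le[OF t]]
    have "exp (- t * E \<phi>) \<le> (\<Sum>i\<in>?I. (ip (Pow ?X) ?\<psi> (?e i))\<^sup>2 * exp (- t * ?en (fst (snd i))))"
      using frame_parseval[OF fr, of ?\<psi> ?\<psi>] n finite_multiplet_index[OF X B] by (simp add: power2_eq_square)
    then show ?thesis by (simp add: case_prod_unfold)
  qed
  then have "(\<Sum>\<phi>\<in>\<Phi>. exp (- t * E \<phi>)) \<le> (\<Sum>\<phi>\<in>\<Phi>. \<Sum>(j,f,a)\<in>?I. (?c \<phi> f a)\<^sup>2 * exp (- t * ?en f))"
    by (rule sum_mono)
  also have "\<dots> = (\<Sum>(j,f,a)\<in>?I. exp (- t * ?en f) * (\<Sum>\<phi>\<in>\<Phi>. (?c \<phi> f a)\<^sup>2))"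
    by (subst sum.swap) (simp add: sum_distrib_left case_prod_unfold mult.commute)
  also have "\<dots> \<le> (\<Sum>(j,f,a)\<in>?I. exp (- t * ?en f) * (if j + a = k then 1 else 0))"
  proof (rule sum_mono)
    fix i assume "i \<in> ?I"
    then obtain j f a where i: "i = (j, f, a)" and f: "f \<in> B j"
      by (auto simp: multiplet_index_def[OF X B])
    have "ip (Pow ?X) (multiplet ?X f a) (multiplet ?X f a) \<le> 1"
    proof (cases "\<exists>A\<subseteq>?X. multiplet ?X f a A \<noteq> 0")
      case True
      then show ?thesis using ip_multiplet_self[OF X eigenfamily_highest[OF X B f]] by fastforce
    next
      case False
      then show ?thesis by (simp add: ip_def)
    qed
    then have "(\<Sum>\<phi>\<in>\<Phi>. (?c \<phi> f a)\<^sup>2) \<le> (if j + a = k then 1 else 0)"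
      by (rule sum_coefficient_squares[OF leveled_multiplet[OF X eigenfamily_leveled[OF X B f]]])
    then show "(case i of (j,f,a) \<Rightarrow> exp (- t * ?en f) * (\<Sum>\<phi>\<in>\<Phi>. (?c \<phi> f a)\<^sup>2))
      \<le> (case i of (j,f,a) \<Rightarrow> exp (- t * ?en f) * (if j + a = k then 1 else 0))"
      unfolding i prod.case by (rule mult_left_mono) simp
  qed
  also have "\<dots> = (\<Sum>(j,f)\<in>Sigma {..card ?X} B. \<Sum>a\<le>card ?X. exp (- t * ?en f) * (if j + a = k then 1 else 0))"
    by (rule sum_multiplet_index[OF X B])
  also have "\<dots> \<le> (\<Sum>(j,f)\<in>Sigma {..card ?X} B. exp (- t * ?en f))"
  proof (rule sum_mono, clarify)
    fix j f
    \<comment> \<open>A multiplet starting on level \<open>j\<close> meets level \<open>k\<close>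
      only at \<open>a = k - j\<close>; this removes the dependence on \<open>k\<close>.\<close>
    have "(\<Sum>a\<le>card ?X. if j + a = k then 1 else (0::real)) \<le> (\<Sum>a\<le>card ?X. if a = k - j then 1 else 0)"
      by (intro sum_mono) auto
    also have "\<dots> \<le> 1" by simp
    finally have "exp (- t * ?en f) * (\<Sum>a\<le>card ?X. if j + a = k then 1 else 0) \<le> exp (- t * ?en f) * 1"
      by (rule mult_left_mono) simp
    then show "(\<Sum>a\<le>card ?X. exp (- t * ?en f) * (if j + a = k then 1 else 0)) \<le> exp (- t * ?en f)"
      by (simp add: sum_distrib_left)
  qed
  also have "\<dots> = partition_fun ?X ?P B t" by (simp add: partition_fun_def)
  also have "\<dots> \<le> exp (648 * ((real N)\<^sup>2 / t)\<^sup>2)"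
    using partition_fun_interval[of N 0 B t] B N t by (simp add: atLeast0LessThan)
  finally show ?thesis .
qed

end

section \<open>Bounds on the typical distance\<close>

context sep_spectrum
begin

abbreviation (input) "\<Omega> \<equiv> config_space N k"
abbreviation (input) "n \<equiv> real (card (config_space N k))"
abbreviation (input) "Z t \<equiv> \<Sum>\<phi>\<in>\<Phi>. exp (- t * E \<phi>)"

lemma typical_dist_sum:
  "2 * n * typical_dist N k t = (\<Sum>\<chi>\<in>\<Omega>. \<Sum>\<omega>\<in>\<Omega>. \<bar>sep_law N t \<chi> \<omega> - 1 / n\<bar>)"
proof (cases "\<Omega> = {}")
  case False
  then have n: "n \<noteq> 0" using finite_config_space by simp
  have "typical_dist N k t = 1 / n * (\<Sum>\<chi>\<in>\<Omega>. 1 / 2 * (\<Sum>\<omega>\<in>\<Omega>. \<bar>sep_law N t \<chi> \<omega> - 1 / n\<bar>))"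
    unfolding typical_dist_def tv_dist_def uniform_mass_def by (simp cong: sum.cong)
  then show ?thesis using n by (simp add: sum_distrib_left[symmetric] sum_divide_distrib[symmetric])
qed simp

text \<open>Cauchy-Schwarz over all pairs. Rows have mass \<open>1\<close>, so the squared
  deviations from \<open>1 / n\<close> sum to the trace at time \<open>2 * t\<close> minus
  \<open>1\<close>.\<close>

lemma typical_dist_le_trace:
  assumes "n > 0"
  shows "(2 * typical_dist N k t)\<^sup>2 \<le> Z (2 * t) - 1"
proof -
  let ?d = "\<lambda>p. sep_law N t (fst p) (snd p) - 1 / n"
  have S: "2 * n * typical_dist N k t = (\<Sum>p\<in>\<Omega> \<times> \<Omega>. 1 * \<bar>?d p\<bar>)"
    unfolding typical_dist_sum sum.cartesian_product by (simp add: case_prod_unfold)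
  have "(\<Sum>p\<in>\<Omega> \<times> \<Omega>. (?d p)\<^sup>2) = (\<Sum>\<chi>\<in>\<Omega>. \<Sum>\<omega>\<in>\<Omega>. (sep_law N t \<chi> \<omega>)\<^sup>2 - 2 / n * sep_law N t \<chi> \<omega> + (1 / n)\<^sup>2)"
    unfolding sum.cartesian_product
    by (intro sum.cong refl) (simp add: power2_eq_square case_prod_unfold algebra_simps)
  also have "\<dots> = Z (2 * t) - 2 / n * n + n * n * (1 / n)\<^sup>2"
    by (simp add: sum.distrib sum_subtractf law_sum_squares sum_distrib_left[symmetric] sum_divide_distrib[symmetric] law_sum)
  also have "\<dots> = Z (2 * t) - 1" using assms by (simp add: power2_eq_square)
  finally have sq: "(\<Sum>p\<in>\<Omega> \<times> \<Omega>. (?d p)\<^sup>2) = Z (2 * t) - 1" .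
  have "(2 * n * typical_dist N k t)\<^sup>2 \<le> (\<Sum>p\<in>\<Omega> \<times> \<Omega>. 1\<^sup>2) * (\<Sum>p\<in>\<Omega> \<times> \<Omega>. \<bar>?d p\<bar>\<^sup>2)"
    unfolding S by (rule Cauchy_Schwarz_ineq_sum)
  also have "\<dots> = n\<^sup>2 * (Z (2 * t) - 1)" using sq by (simp add: card_cartesian_product power2_eq_square)
  finally have "n\<^sup>2 * (2 * typical_dist N k t)\<^sup>2 \<le> n\<^sup>2 * (Z (2 * t) - 1)"
    by (simp add: power_mult_distrib mult_ac)
  then show ?thesis using assms by simp
qed

text \<open>The overlap \<open>min p q\<close> is bounded below by the quadratic \<open>2 c p - c\<^sup>2 p (p + q) / q\<close> for every \<open>c\<close>;
  the choice \<open>c = 1 / (Z + 1)\<close> is optimal after averaging.\<close>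

lemma typical_dist_less_1:
  assumes n: "n > 0" and t: "0 \<le> t"
  shows "typical_dist N k t \<le> 1 - 1 / (Z (2 * t) + 1)"
proof -
  define c where "c = 1 / (Z (2 * t) + 1)"
  have Z: "Z (2 * t) \<ge> 0" by (intro sum_nonneg) simp
  \<comment> \<open>The left side is \<open>p + q - 2 * min p q\<close> with
    \<open>q = 1 / n\<close>. In each case the slack is a nonnegative multiple of a square plus a
    nonnegative term: \<open>(1 - c)^2\<close> if the minimum is \<open>p\<close>,
    \<open>(1 - c * n * p)^2\<close> if it is \<open>q\<close>.\<close>
  have "\<bar>p - 1 / n\<bar> \<le> 1 / n + (1 - 4 * c + 2 * c\<^sup>2) * p + 2 * c\<^sup>2 * n * p\<^sup>2" if p: "0 \<le> p" for p
  proof (cases "n * p \<le> 1")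
    case True
    have "0 \<le> 2 * p * ((1 - c)\<^sup>2 + c\<^sup>2 * (n * p))" using p n by (intro mult_nonneg_nonneg add_nonneg_nonneg) auto
    moreover have "p - 1 / n \<le> 0" using True n by (simp add: field_simps)
    ultimately show ?thesis using n by (simp add: power2_eq_square algebra_simps)
  next
    case False
    have "0 \<le> (1 - c * (n * p))\<^sup>2 + c\<^sup>2 * (n * p)" using p n by simp
    then have "0 \<le> 2 / n * ((1 - c * (n * p))\<^sup>2 + c\<^sup>2 * (n * p))" using n by simp
    also have "\<dots> = 2 / n - 4 * c * p + 2 * c\<^sup>2 * n * p\<^sup>2 + 2 * c\<^sup>2 * p"
      using n by (simp add: power2_eq_square field_simps)
    finally have "p - 1 / n \<le> 1 / n + (1 - 4 * c + 2 * c\<^sup>2) * p + 2 * c\<^sup>2 * n * p\<^sup>2"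
      by (simp add: algebra_simps)
    moreover have "p - 1 / n \<ge> 0" using False n by (simp add: field_simps)
    ultimately show ?thesis by simp
  qed
  then have "2 * n * typical_dist N k t \<le> (\<Sum>\<chi>\<in>\<Omega>. \<Sum>\<omega>\<in>\<Omega>. 1 / n + (1 - 4 * c + 2 * c\<^sup>2) * sep_law N t \<chi> \<omega>
      + 2 * c\<^sup>2 * n * (sep_law N t \<chi> \<omega>)\<^sup>2)"
    unfolding typical_dist_sum using law_nonneg[OF t] by (intro sum_mono) auto
  also have "\<dots> = n + (1 - 4 * c + 2 * c\<^sup>2) * n + 2 * c\<^sup>2 * n * Z (2 * t)"
    using n by (simp add: sum.distrib sum_distrib_left[symmetric] law_sum law_sum_squares) (simp add: algebra_simps)
  also have "\<dots> = 2 * n * (1 - 2 * c + c * (c * (Z (2 * t) + 1)))"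
    by (simp add: power2_eq_square algebra_simps)
  also have "c * (Z (2 * t) + 1) = 1" using Z by (simp add: c_def)
  finally show ?thesis using n by (simp add: c_def)
qed

text \<open>\<open>F\<close> has mean zero because \<open>c \<noteq> 0\<close>, so
  \<open>exp (- t * c) * F\<close> is the integral of \<open>F\<close> against the deviation of the
  law from uniform. Keeping the first absolute moment of \<open>F\<close> avoids any
  truncation.\<close>

lemma typical_dist_ge:
  assumes n: "n > 0" and t: "0 \<le> t" and c: "c \<noteq> 0"
    and F: "\<And>\<eta>. \<eta> \<in> \<Omega> \<Longrightarrow> sep_generator N F \<eta> = - c * F \<eta>"
  shows "exp (- (2 * t) * c) * (\<Sum>\<eta>\<in>\<Omega>. \<bar>F \<eta>\<bar>)\<^sup>2 \<le> 4 * n * typical_dist N k t * (\<Sum>\<eta>\<in>\<Omega>. (F \<eta>)\<^sup>2)"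
proof -
  let ?p = "sep_law N t" and ?D = "typical_dist N k t"
  let ?d = "\<lambda>p. \<bar>?p (fst p) (snd p) - 1 / n\<bar>"
  have "- c * ip \<Omega> F (\<lambda>_. 1) = ip \<Omega> (sep_generator N F) (\<lambda>_. 1)"
    unfolding ip_scale_left[symmetric] by (intro ip_cong) (simp_all add: F)
  also have "\<dots> = 0" unfolding sep_generator_sym by (simp add: sep_generator_def ip_def)
  finally have F0: "(\<Sum>\<eta>\<in>\<Omega>. F \<eta>) = 0" using c by (simp add: ip_def)
  have "exp (- t * c) * \<bar>F \<chi>\<bar> \<le> (\<Sum>\<omega>\<in>\<Omega>. \<bar>?p \<chi> \<omega> - 1 / n\<bar> * \<bar>F \<omega>\<bar>)" if \<chi>: "\<chi> \<in> \<Omega>" for \<chi>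
  proof -
    have "exp (- t * c) * F \<chi> = (\<Sum>\<omega>\<in>\<Omega>. ?p \<chi> \<omega> * F \<omega>) - 1 / n * (\<Sum>\<omega>\<in>\<Omega>. F \<omega>)"
      using law_eigenfunction[OF F \<chi>] F0 by simp
    also have "\<dots> = (\<Sum>\<omega>\<in>\<Omega>. (?p \<chi> \<omega> - 1 / n) * F \<omega>)"
      by (simp only: sum_distrib_left sum_subtractf left_diff_distrib)
    finally have "exp (- t * c) * \<bar>F \<chi>\<bar> = \<bar>\<Sum>\<omega>\<in>\<Omega>. (?p \<chi> \<omega> - 1 / n) * F \<omega>\<bar>"
      by (metis abs_exp_cancel abs_mult)
    also have "\<dots> \<le> (\<Sum>\<omega>\<in>\<Omega>. \<bar>(?p \<chi> \<omega> - 1 / n) * F \<omega>\<bar>)" by (rule sum_abs)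
    finally show ?thesis by (simp add: abs_mult)
  qed
  then have "(\<Sum>\<chi>\<in>\<Omega>. exp (- t * c) * \<bar>F \<chi>\<bar>) \<le> (\<Sum>\<chi>\<in>\<Omega>. \<Sum>\<omega>\<in>\<Omega>. \<bar>?p \<chi> \<omega> - 1 / n\<bar> * \<bar>F \<omega>\<bar>)"
    by (rule sum_mono)
  \<comment> \<open>The deviation is split into two square roots: one factor of Cauchy-Schwarz
    becomes \<open>2 * n\<close> times the typical distance, the other the second moment of
    \<open>F\<close> up to a factor \<open>2\<close>, as law and uniform mass both sum to
    \<open>1\<close>.\<close>
  also have "\<dots> = (\<Sum>p\<in>\<Omega> \<times> \<Omega>. sqrt (?d p) * (sqrt (?d p) * \<bar>F (snd p)\<bar>))"
    unfolding sum.cartesian_product by (intro sum.cong refl) (simp add: case_prod_unfold mult.assoc[symmetric])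
  finally have "exp (- t * c) * (\<Sum>\<chi>\<in>\<Omega>. \<bar>F \<chi>\<bar>) \<le> (\<Sum>p\<in>\<Omega> \<times> \<Omega>. sqrt (?d p) * (sqrt (?d p) * \<bar>F (snd p)\<bar>))"
    by (simp only: sum_distrib_left)
  then have "(exp (- t * c) * (\<Sum>\<chi>\<in>\<Omega>. \<bar>F \<chi>\<bar>))\<^sup>2 \<le> (\<Sum>p\<in>\<Omega> \<times> \<Omega>. sqrt (?d p) * (sqrt (?d p) * \<bar>F (snd p)\<bar>))\<^sup>2"
    by (rule power_mono) (auto intro!: mult_nonneg_nonneg sum_nonneg)
  also have "\<dots> \<le> (\<Sum>p\<in>\<Omega> \<times> \<Omega>. (sqrt (?d p))\<^sup>2) * (\<Sum>p\<in>\<Omega> \<times> \<Omega>. (sqrt (?d p) * \<bar>F (snd p)\<bar>)\<^sup>2)"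
    by (rule Cauchy_Schwarz_ineq_sum)
  finally have cs: "(exp (- t * c) * (\<Sum>\<chi>\<in>\<Omega>. \<bar>F \<chi>\<bar>))\<^sup>2
    \<le> (\<Sum>p\<in>\<Omega> \<times> \<Omega>. (sqrt (?d p))\<^sup>2) * (\<Sum>p\<in>\<Omega> \<times> \<Omega>. (sqrt (?d p) * \<bar>F (snd p)\<bar>)\<^sup>2)" .
  have D: "(\<Sum>p\<in>\<Omega> \<times> \<Omega>. (sqrt (?d p))\<^sup>2) = 2 * n * ?D"
    unfolding typical_dist_sum sum.cartesian_product by (simp add: case_prod_unfold)
  have D0: "0 \<le> 2 * n * ?D" unfolding D[symmetric] by (intro sum_nonneg) simp
  have "(\<Sum>p\<in>\<Omega> \<times> \<Omega>. (sqrt (?d p) * \<bar>F (snd p)\<bar>)\<^sup>2) \<le> 2 * (\<Sum>\<eta>\<in>\<Omega>. (F \<eta>)\<^sup>2)"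
  proof -
    have "(\<Sum>p\<in>\<Omega> \<times> \<Omega>. (sqrt (?d p) * \<bar>F (snd p)\<bar>)\<^sup>2) = (\<Sum>\<chi>\<in>\<Omega>. \<Sum>\<omega>\<in>\<Omega>. \<bar>?p \<omega> \<chi> - 1 / n\<bar> * (F \<omega>)\<^sup>2)"
      unfolding sum.cartesian_product
      by (intro sum.cong refl) (auto simp: case_prod_unfold power_mult_distrib law_sym)
    also have "\<dots> \<le> (\<Sum>\<chi>\<in>\<Omega>. \<Sum>\<omega>\<in>\<Omega>. (?p \<omega> \<chi> + 1 / n) * (F \<omega>)\<^sup>2)"
    proof (intro sum_mono mult_right_mono)
      fix \<chi> \<omega> assume "\<chi> \<in> \<Omega>" "\<omega> \<in> \<Omega>"
      then have "0 \<le> ?p \<omega> \<chi>" using law_nonneg[OF t] by blast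
      then show "\<bar>?p \<omega> \<chi> - 1 / n\<bar> \<le> ?p \<omega> \<chi> + 1 / n" by (simp add: abs_le_iff)
    qed simp
    also have "\<dots> = (\<Sum>\<omega>\<in>\<Omega>. (\<Sum>\<chi>\<in>\<Omega>. ?p \<omega> \<chi> + 1 / n) * (F \<omega>)\<^sup>2)"
      by (subst sum.swap) (simp only: sum_distrib_right)
    also have "\<dots> = (\<Sum>\<omega>\<in>\<Omega>. 2 * (F \<omega>)\<^sup>2)"
      using n by (intro sum.cong refl) (simp add: sum.distrib law_sum)
    finally show ?thesis by (simp add: sum_distrib_left)
  qed
  from mult_left_mono[OF this D0] cs
  have "(exp (- t * c) * (\<Sum>\<chi>\<in>\<Omega>. \<bar>F \<chi>\<bar>))\<^sup>2 \<le> 2 * n * ?D * (2 * (\<Sum>\<eta>\<in>\<Omega>. (F \<eta>)\<^sup>2))"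
    unfolding D by linarith
  moreover have "(exp (- t * c) * (\<Sum>\<chi>\<in>\<Omega>. \<bar>F \<chi>\<bar>))\<^sup>2 = exp (- (2 * t) * c) * (\<Sum>\<eta>\<in>\<Omega>. \<bar>F \<eta>\<bar>)\<^sup>2"
    by (simp add: power_mult_distrib exp_double[symmetric])
  ultimately show ?thesis by (simp add: mult_ac)
qed

end

section \<open>The slowest Fourier mode\<close>

text \<open>The free phase turns cyclic shifts into changes of \<delta> and later allows a choice
  between cosine and sine.\<close>

definition wave :: "nat \<Rightarrow> real \<Rightarrow> nat \<Rightarrow> real" where
  "wave N \<delta> x = cos (2 * pi / real N * real x + \<delta>)"

definition wave_eigenvalue :: "nat \<Rightarrow> real" where
  "wave_eigenvalue N = 2 - 2 * cos (2 * pi / real N)"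

definition wave_sum :: "nat \<Rightarrow> real \<Rightarrow> (nat \<Rightarrow> nat) \<Rightarrow> real" where
  "wave_sum N \<delta> \<eta> = (\<Sum>x<N. wave N \<delta> x * real (\<eta> x))"

lemma sum_cyclic_shift: "(\<Sum>x<N. h (Suc x mod N)) = (\<Sum>x<N. h x :: real)"
proof (cases N)
  case (Suc m)
  have "(\<Sum>x<Suc m. h (Suc x mod Suc m)) = (\<Sum>x<m. h (Suc x)) + h 0"
    by (simp cong: sum.cong_simp)
  also have "\<dots> = (\<Sum>x<Suc m. h x)" by (simp only: sum.lessThan_Suc_shift add.commute)
  finally show ?thesis using Suc by simp
qed simp

lemma wave_shift:
  assumes "x < N"
  shows "wave N \<delta> (Suc x mod N) = wave N (2 * pi / real N + \<delta>) x"
proof (cases "Suc x = N")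
  case True
  have "2 * pi / real N * (real x + 1) = 2 * pi"
  proof -
    have N: "real N = real x + 1" using True by auto
    show ?thesis unfolding N[symmetric] using assms by simp
  qed
  then have eq: "2 * pi / real N * real x + (2 * pi / real N + \<delta>) = \<delta> + 2 * pi"
    by (simp add: distrib_left)
  show ?thesis unfolding wave_def eq using True by simp
next
  case False
  then have "Suc x mod N = Suc x" using assms by simp
  then show ?thesis by (simp add: wave_def algebra_simps add_divide_distrib)
qed

lemma wave_laplacian:
  "wave N (2 * pi / real N + \<delta>) x + wave N (\<delta> - 2 * pi / real N) x - 2 * wave N \<delta> x = - wave_eigenvalue N * wave N \<delta> x"
proof -
  let ?a = "2 * pi / real N * real x + \<delta>" and ?t = "2 * pi / real N"
  have "cos (?a + ?t) + cos (?a - ?t) = 2 * cos ?t * cos ?a" by (simp add: cos_add cos_diff)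
  moreover have "?a + ?t = 2 * pi / real N * real x + (?t + \<delta>)" "?a - ?t = 2 * pi / real N * real x + (\<delta> - ?t)"
    by simp_all
  ultimately show ?thesis by (simp add: wave_def wave_eigenvalue_def algebra_simps)
qed

lemma wave_sum_exchange:
  assumes "x < N" "2 \<le> N"
  shows "wave_sum N \<delta> (exchange N x \<eta>) - wave_sum N \<delta> \<eta>
    = (wave N \<delta> x - wave N \<delta> (Suc x mod N)) * (real (\<eta> (Suc x mod N)) - real (\<eta> x))"
proof -
  let ?y = "Suc x mod N"
  have y: "?y < N" "?y \<noteq> x" using assms by (auto simp: mod_Suc)
  have "wave_sum N \<delta> (exchange N x \<eta>) - wave_sum N \<delta> \<eta>
    = (\<Sum>z<N. wave N \<delta> z * (real (\<eta> (transpose x ?y z)) - real (\<eta> z)))"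
    by (simp add: wave_sum_def exchange_def sum_subtractf[symmetric] right_diff_distrib)
  also have "\<dots> = (\<Sum>z\<in>{x, ?y}. wave N \<delta> z * (real (\<eta> (transpose x ?y z)) - real (\<eta> z)))"
    using assms y by (intro sum.mono_neutral_right) auto
  also have "\<dots> = (wave N \<delta> x - wave N \<delta> ?y) * (real (\<eta> ?y) - real (\<eta> x))"
    using y by (simp add: algebra_simps)
  finally show ?thesis .
qed

text \<open>The increments of a linear statistic are linear in the occupation, so the exclusion rule
  drops out and the discrete Laplacian of the cycle acts on the weights.\<close>

lemma wave_sum_eigenfunction:
  assumes "2 \<le> N"
  shows "sep_generator N (wave_sum N \<delta>) \<eta> = - wave_eigenvalue N * wave_sum N \<delta> \<eta>"
proof -
  let ?s = "\<lambda>x. Suc x mod N" and ?f = "wave N \<delta>" and ?t = "2 * pi / real N"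
  have "sep_generator N (wave_sum N \<delta>) \<eta> = (\<Sum>x<N. (?f x - ?f (?s x)) * (real (\<eta> (?s x)) - real (\<eta> x)))"
    unfolding sep_generator_def using assms by (intro sum.cong refl) (simp add: wave_sum_exchange)
  also have "\<dots> = (\<Sum>x<N. wave N (\<delta> - ?t) (?s x) * real (\<eta> (?s x))) - (\<Sum>x<N. ?f (?s x) * real (\<eta> (?s x)))
      - (\<Sum>x<N. ?f x * real (\<eta> x)) + (\<Sum>x<N. wave N (?t + \<delta>) x * real (\<eta> x))"
    unfolding sum_subtractf[symmetric] sum.distrib[symmetric]
    by (intro sum.cong refl) (simp add: wave_shift algebra_simps)
  also have "\<dots> = (\<Sum>x<N. (wave N (?t + \<delta>) x + wave N (\<delta> - ?t) x - 2 * ?f x) * real (\<eta> x))"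
    unfolding sum_cyclic_shift[of "\<lambda>x. wave N (\<delta> - ?t) x * real (\<eta> x)"] sum_cyclic_shift[of "\<lambda>x. ?f x * real (\<eta> x)"]
    by (simp add: algebra_simps sum.distrib sum_subtractf sum_distrib_left)
  also have "\<dots> = - wave_eigenvalue N * wave_sum N \<delta> \<eta>"
    unfolding wave_laplacian by (simp add: wave_sum_def sum_distrib_left mult_ac)
  finally show ?thesis .
qed

lemma wave_dirichlet:
  "(\<Sum>x<N. (wave N \<delta> x - wave N \<delta> (Suc x mod N))\<^sup>2) = wave_eigenvalue N * (\<Sum>x<N. (wave N \<delta> x)\<^sup>2)"
proof -
  let ?s = "\<lambda>x. Suc x mod N" and ?f = "wave N \<delta>" and ?t = "2 * pi / real N"
  have 1: "(\<Sum>x<N. ?f x * ?f (?s x)) = (\<Sum>x<N. wave N (?t + \<delta>) x * ?f x)"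
    by (intro sum.cong refl) (simp add: wave_shift)
  have "(\<Sum>x<N. ?f x * ?f (?s x)) = (\<Sum>x<N. wave N (\<delta> - ?t) (?s x) * ?f (?s x))"
    by (intro sum.cong refl) (simp add: wave_shift)
  also have "\<dots> = (\<Sum>x<N. wave N (\<delta> - ?t) x * ?f x)"
    by (rule sum_cyclic_shift)
  finally have 2: "(\<Sum>x<N. ?f x * ?f (?s x)) = (\<Sum>x<N. wave N (\<delta> - ?t) x * ?f x)" .
  have "(\<Sum>x<N. (?f x - ?f (?s x))\<^sup>2) = (\<Sum>x<N. (?f x)\<^sup>2) + (\<Sum>x<N. (?f (?s x))\<^sup>2) - 2 * (\<Sum>x<N. ?f x * ?f (?s x))"
    by (simp add: power2_diff sum.distrib sum_subtractf sum_distrib_left mult.assoc)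
  also have "\<dots> = (\<Sum>x<N. 2 * (?f x)\<^sup>2) - (\<Sum>x<N. wave N (?t + \<delta>) x * ?f x) - (\<Sum>x<N. wave N (\<delta> - ?t) x * ?f x)"
    using 1 2 sum_cyclic_shift[of "\<lambda>x. (?f x)\<^sup>2"] by (simp add: sum_distrib_left[symmetric])
  also have "\<dots> = (\<Sum>x<N. - ((wave N (?t + \<delta>) x + wave N (\<delta> - ?t) x - 2 * ?f x) * ?f x))"
    unfolding sum_subtractf[symmetric] by (intro sum.cong refl) (simp add: power2_eq_square algebra_simps)
  also have "\<dots> = wave_eigenvalue N * (\<Sum>x<N. (?f x)\<^sup>2)"
    unfolding wave_laplacian by (simp add: sum_distrib_left power2_eq_square mult_ac)
  finally show ?thesis .
qed

lemma wave_eigenvalue_sin: "wave_eigenvalue N = 4 * (sin (pi / real N))\<^sup>2"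
  using cos_double_sin[of "pi / real N"] by (simp add: wave_eigenvalue_def)

lemma wave_eigenvalue_pos: "2 \<le> N \<Longrightarrow> 0 < wave_eigenvalue N"
proof -
  assume N: "2 \<le> N"
  then have "pi / real N < pi" using pi_gt_zero by (simp add: field_simps)
  then have "0 < sin (pi / real N)" using N by (intro sin_gt_zero) auto
  then show ?thesis by (simp add: wave_eigenvalue_sin)
qed

lemma wave_eigenvalue_le: "wave_eigenvalue N \<le> 4 * (pi / real N)\<^sup>2"
proof -
  have "\<bar>sin (pi / real N)\<bar> \<le> \<bar>pi / real N\<bar>" by (rule abs_sin_x_le_abs_x)
  then show ?thesis unfolding wave_eigenvalue_sin by (simp only: abs_le_square_iff) 
qed

lemma wave_difference_le:
  assumes "x < N"
  shows "(wave N \<delta> x - wave N \<delta> (Suc x mod N))\<^sup>2 \<le> wave_eigenvalue N"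
proof -
  let ?a = "2 * pi / real N * real x + \<delta>" and ?b = "2 * pi / real N * real x + (2 * pi / real N + \<delta>)"
  have "wave N \<delta> x - wave N \<delta> (Suc x mod N) = cos ?a - cos ?b"
    by (simp only: wave_shift[OF assms]) (simp only: wave_def)
  also have "\<dots> = 2 * sin ((?a + ?b) / 2) * sin ((?b - ?a) / 2)" by (rule cos_diff_cos)
  also have "(?b - ?a) / 2 = pi / real N" by simp
  finally have "(wave N \<delta> x - wave N \<delta> (Suc x mod N))\<^sup>2 = 4 * (sin ((?a + ?b) / 2))\<^sup>2 * (sin (pi / real N))\<^sup>2"
    by (simp only: power_mult_distrib) simp
  also have "\<dots> \<le> 4 * 1 * (sin (pi / real N))\<^sup>2"
    by (intro mult_right_mono mult_left_mono) (auto simp: abs_square_le_1)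
  finally show ?thesis by (simp add: wave_eigenvalue_sin)
qed

lemma card_separating_subsets:
  assumes "x < N" "y < N" "x \<noteq> y" "1 \<le> k"
  shows "card {A. A \<subseteq> {..<N} \<and> card A = k \<and> x \<in> A \<and> y \<notin> A} = (N - 2) choose (k - 1)"
proof -
  let ?T = "{A. A \<subseteq> {..<N} - {x, y} \<and> card A = k - 1}"
  have fin: "finite A" if "A \<subseteq> {..<N}" for A using that finite_subset by blast
  have "bij_betw (insert x) ?T {A. A \<subseteq> {..<N} \<and> card A = k \<and> x \<in> A \<and> y \<notin> A}"
  proof (rule bij_betwI[where g = "\<lambda>A. A - {x}"])
    show "insert x \<in> ?T \<rightarrow> {A. A \<subseteq> {..<N} \<and> card A = k \<and> x \<in> A \<and> y \<notin> A}"
    proof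
      fix A assume A: "A \<in> ?T"
      then have "finite A" "x \<notin> A" using fin by blast+
      then show "insert x A \<in> {A. A \<subseteq> {..<N} \<and> card A = k \<and> x \<in> A \<and> y \<notin> A}" using A assms by auto
    qed
    show "(\<lambda>A. A - {x}) \<in> {A. A \<subseteq> {..<N} \<and> card A = k \<and> x \<in> A \<and> y \<notin> A} \<rightarrow> ?T"
      using fin by (auto simp: card_Diff_singleton)
  qed auto
  then have "card {A. A \<subseteq> {..<N} \<and> card A = k \<and> x \<in> A \<and> y \<notin> A} = card ?T"
    by (rule bij_betw_same_card[symmetric])
  also have "\<dots> = card ({..<N} - {x, y}) choose (k - 1)" by (rule n_subsets) simp
  also have "card ({..<N} - {x, y}) = N - 2" using assms by (simp add: card_Diff_subset)
  finally show ?thesis .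
qed

lemma sum_occupation_difference:
  assumes "x < N" "y < N" "x \<noteq> y" "1 \<le> k"
  shows "(\<Sum>\<eta>\<in>config_space N k. (real (\<eta> y) - real (\<eta> x))\<^sup>2) = 2 * real ((N - 2) choose (k - 1))"
proof -
  let ?S = "{A. A \<subseteq> {..<N} \<and> card A = k}"
  let ?D = "\<lambda>x y. {A. A \<subseteq> {..<N} \<and> card A = k \<and> x \<in> A \<and> y \<notin> A}"
  have fin: "finite ?S" by (rule finite_subset[of _ "Pow {..<N}"]) auto
  have "(\<Sum>\<eta>\<in>config_space N k. (real (\<eta> y) - real (\<eta> x))\<^sup>2)
    = (\<Sum>A\<in>?S. (real (occupy N A y) - real (occupy N A x))\<^sup>2)"
    by (rule sum.reindex_bij_betw[OF occupy_bij, symmetric])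
  also have "\<dots> = (\<Sum>A\<in>?D x y \<union> ?D y x. 1)"
    using assms fin by (intro sum.mono_neutral_cong_right) (auto simp: occupy_def)
  also have "\<dots> = real (card (?D x y) + card (?D y x))"
    using fin by (subst card_Un_disjoint[symmetric]) (auto intro: finite_subset[OF _ fin])
  also have "\<dots> = 2 * real ((N - 2) choose (k - 1))"
    using card_separating_subsets[of x N y k] card_separating_subsets[of y N x k] assms by simp
  finally show ?thesis .
qed

text \<open>\<open>k * (N choose k)\<close> equals \<open>N * ((N - 1) choose (k - 1))\<close>, and
  removing one more site costs at most a factor \<open>2\<close> because at least half of the sites
  are empty.\<close>

lemma binomial_pair_ratio:
  assumes "2 \<le> N" "1 \<le> k" "2 * k \<le> N"
  shows "real k * real (N choose k) \<le> 2 * real N * real ((N - 2) choose (k - 1))"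
proof -
  obtain m where m: "N = Suc (Suc m)" using assms(1) by (metis add_2_eq_Suc le_Suc_ex)
  obtain j where j: "k = Suc j" using assms(2) by (metis Suc_le_D One_nat_def)
  have a: "k * (N choose k) = N * (Suc m choose j)"
    unfolding m j by (rule Suc_times_binomial)
  have b: "(Suc m - j) * (Suc m choose j) = Suc m * (m choose j)"
    using binomial_absorb_comp[of "Suc m" j] by simp
  have jm: "Suc m \<le> 2 * (Suc m - j)" using assms m j by linarith
  have "Suc m * (Suc m choose j) \<le> 2 * (Suc m - j) * (Suc m choose j)"
    using jm by (rule mult_right_mono) simp
  also have "\<dots> = Suc m * (2 * (m choose j))" using b by simp
  finally have "(Suc m choose j) \<le> 2 * (m choose j)" by (simp only: mult_le_cancel1)
  then have "N * (Suc m choose j) \<le> N * (2 * (m choose j))" by (rule mult_left_mono) simp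
  then have "k * (N choose k) \<le> 2 * N * (m choose j)" unfolding a by (simp add: mult_ac)
  then have le: "real (k * (N choose k)) \<le> real (2 * N * (m choose j))" by (simp only: of_nat_le_iff)
  have "N - 2 = m" "k - 1 = j" using m j by simp_all
  then show ?thesis using le unfolding of_nat_mult by simp
qed


text \<open>For an eigenfunction the second moment is the Dirichlet form over the eigenvalue. The
  form only needs the variance of a difference of neighbouring occupations, the same for all bonds;
  summation by parts then cancels the eigenvalue.\<close>

lemma wave_sum_second_moment:
  assumes "2 \<le> N" "1 \<le> k"
  shows "(\<Sum>\<eta>\<in>config_space N k. (wave_sum N \<delta> \<eta>)\<^sup>2) = real ((N - 2) choose (k - 1)) * (\<Sum>x<N. (wave N \<delta> x)\<^sup>2)"
proof -
  let ?S = "config_space N k" and ?F = "wave_sum N \<delta>" and ?c = "wave_eigenvalue N" and ?C = "real ((N - 2) choose (k - 1))"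
  let ?f = "wave N \<delta>"
  have "- ?c * ip ?S ?F ?F = ip ?S ?F (sep_generator N ?F)"
    unfolding ip_scale_right[symmetric] by (intro ip_cong refl) (simp add: wave_sum_eigenfunction assms)
  also have "\<dots> = - (\<Sum>x<N. \<Sum>\<eta>\<in>?S. (?f x - ?f (Suc x mod N))\<^sup>2 * (real (\<eta> (Suc x mod N)) - real (\<eta> x))\<^sup>2) / 2"
  proof -
    have "(?F (exchange N x \<eta>) - ?F \<eta>) * (?F (exchange N x \<eta>) - ?F \<eta>)
      = (?f x - ?f (Suc x mod N))\<^sup>2 * (real (\<eta> (Suc x mod N)) - real (\<eta> x))\<^sup>2" if "x < N" for x \<eta>
      unfolding wave_sum_exchange[OF that assms(1)] by (simp add: power2_eq_square mult_ac)
    then show ?thesis unfolding sep_generator_ip by simp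
  qed
  also have "\<dots> = - (\<Sum>x<N. (?f x - ?f (Suc x mod N))\<^sup>2 * (2 * ?C)) / 2"
  proof -
    have "(\<Sum>\<eta>\<in>?S. (real (\<eta> (Suc x mod N)) - real (\<eta> x))\<^sup>2) = 2 * ?C" if "x < N" for x
      using that assms by (intro sum_occupation_difference) (auto simp: mod_Suc)
    then show ?thesis by (simp add: sum_distrib_left[symmetric])
  qed
  also have "\<dots> = - ?c * (?C * (\<Sum>x<N. (?f x)\<^sup>2))"
    unfolding sum_distrib_right[symmetric] wave_dirichlet by simp
  finally have "?c * ip ?S ?F ?F = ?c * (?C * (\<Sum>x<N. (?f x)\<^sup>2))" by simp
  then have "ip ?S ?F ?F = ?C * (\<Sum>x<N. (?f x)\<^sup>2)"
    using wave_eigenvalue_pos[OF assms(1)] by simp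
  then show ?thesis by (simp add: ip_def power2_eq_square)
qed

lemma cube_difference_le: "(b ^ 3 - a ^ 3) * (b - a) \<le> 3 / 2 * (b - a)\<^sup>2 * (a\<^sup>2 + b\<^sup>2)" for a b :: real
proof -
  have "3 / 2 * (b - a)\<^sup>2 * (a\<^sup>2 + b\<^sup>2) - (b ^ 3 - a ^ 3) * (b - a) = ((b - a)\<^sup>2)\<^sup>2 / 2"
    by (simp add: power2_eq_square power3_eq_cube field_simps)
  also have "\<dots> \<ge> 0" by simp
  finally show ?thesis by simp
qed

lemma config_space_le_1: "\<eta> \<in> config_space N k \<Longrightarrow> x < N \<Longrightarrow> \<eta> x = 0 \<or> \<eta> x = 1"
  by (auto simp: config_space_def PiE_iff)

text \<open>Pair the eigenvalue equation with the cube of the statistic. Squared increments are at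
  most the eigenvalue on bonds with different occupations, of which there are at most
  \<open>2 * k\<close>, so the eigenvalue cancels again.\<close>

lemma wave_sum_fourth_moment:
  assumes "2 \<le> N" "1 \<le> k"
  shows "(\<Sum>\<eta>\<in>config_space N k. (wave_sum N \<delta> \<eta>) ^ 4)
    \<le> 3 * real k * (\<Sum>\<eta>\<in>config_space N k. (wave_sum N \<delta> \<eta>)\<^sup>2)"
proof -
  let ?S = "config_space N k" and ?F = "wave_sum N \<delta>" and ?c = "wave_eigenvalue N"
  let ?d = "\<lambda>x \<eta>. (real (\<eta> (Suc x mod N)) - real (\<eta> x))\<^sup>2"
  have c: "0 < ?c" using wave_eigenvalue_pos[OF assms(1)] .
  have y: "Suc x mod N < N" "Suc x mod N \<noteq> x" if "x < N" for x using that assms by (auto simp: mod_Suc)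
  have step: "(?F (exchange N x \<eta>) - ?F \<eta>)\<^sup>2 \<le> ?c * ?d x \<eta>" if "x < N" for x \<eta>
    unfolding wave_sum_exchange[OF that assms(1)] power_mult_distrib
    by (intro mult_right_mono wave_difference_le that) simp
  have dsum: "(\<Sum>x<N. ?d x \<eta>) \<le> 2 * real k" if \<eta>: "\<eta> \<in> ?S" for \<eta>
  proof -
    have "(\<Sum>x<N. ?d x \<eta>) \<le> (\<Sum>x<N. real (\<eta> (Suc x mod N)) + real (\<eta> x))"
    proof (rule sum_mono)
      fix x assume "x \<in> {..<N}"
      then have "x < N" by simp
      from config_space_le_1[OF \<eta> this] config_space_le_1[OF \<eta> y(1)[OF this]]
      show "?d x \<eta> \<le> real (\<eta> (Suc x mod N)) + real (\<eta> x)" by auto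
    qed
    also have "\<dots> = 2 * (\<Sum>x<N. real (\<eta> x))"
      unfolding sum.distrib sum_cyclic_shift[of "\<lambda>x. real (\<eta> x)"] by simp
    also have "(\<Sum>x<N. real (\<eta> x)) = real k" using \<eta> by (simp add: config_space_def flip: of_nat_sum)
    finally show ?thesis .
  qed
  have sym: "(\<Sum>\<eta>\<in>?S. ?d x \<eta> * (?F (exchange N x \<eta>))\<^sup>2) = (\<Sum>\<eta>\<in>?S. ?d x \<eta> * (?F \<eta>)\<^sup>2)" if "x < N" for x
  proof -
    have "?d x (exchange N x \<eta>) = ?d x \<eta>" for \<eta> by (simp add: exchange_def power2_commute)
    then show ?thesis using sum_exchange[OF that, of "\<lambda>\<eta>. ?d x \<eta> * (?F \<eta>)\<^sup>2" k] by simp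
  qed
  have "- ?c * ip ?S (\<lambda>\<eta>. ?F \<eta> ^ 3) ?F = ip ?S (\<lambda>\<eta>. ?F \<eta> ^ 3) (sep_generator N ?F)"
    unfolding ip_scale_right[symmetric] by (intro ip_cong refl) (simp add: wave_sum_eigenfunction assms)
  then have "?c * ip ?S (\<lambda>\<eta>. ?F \<eta> ^ 3) ?F
     = (\<Sum>x<N. \<Sum>\<eta>\<in>?S. (?F (exchange N x \<eta>) ^ 3 - ?F \<eta> ^ 3) * (?F (exchange N x \<eta>) - ?F \<eta>)) / 2"
    unfolding sep_generator_ip by simp
  also have "\<dots> \<le> (\<Sum>x<N. \<Sum>\<eta>\<in>?S. 3 / 2 * (?c * ?d x \<eta>) * ((?F \<eta>)\<^sup>2 + (?F (exchange N x \<eta>))\<^sup>2)) / 2"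
  proof (intro divide_right_mono sum_mono)
    fix x \<eta> assume x: "x \<in> {..<N}"
    have "(?F (exchange N x \<eta>) ^ 3 - ?F \<eta> ^ 3) * (?F (exchange N x \<eta>) - ?F \<eta>)
      \<le> 3 / 2 * (?F (exchange N x \<eta>) - ?F \<eta>)\<^sup>2 * ((?F \<eta>)\<^sup>2 + (?F (exchange N x \<eta>))\<^sup>2)"
      by (rule cube_difference_le)
    also have "\<dots> \<le> 3 / 2 * (?c * ?d x \<eta>) * ((?F \<eta>)\<^sup>2 + (?F (exchange N x \<eta>))\<^sup>2)"
      using x by (intro mult_right_mono mult_left_mono step) auto
    finally show "(?F (exchange N x \<eta>) ^ 3 - ?F \<eta> ^ 3) * (?F (exchange N x \<eta>) - ?F \<eta>)
      \<le> 3 / 2 * (?c * ?d x \<eta>) * ((?F \<eta>)\<^sup>2 + (?F (exchange N x \<eta>))\<^sup>2)" .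
  qed simp
  also have "\<dots> = (\<Sum>x<N. 3 / 4 * ?c * ((\<Sum>\<eta>\<in>?S. ?d x \<eta> * (?F \<eta>)\<^sup>2) + (\<Sum>\<eta>\<in>?S. ?d x \<eta> * (?F (exchange N x \<eta>))\<^sup>2)))"
    unfolding sum_divide_distrib sum.distrib[symmetric] sum_distrib_left
    by (intro sum.cong refl) (simp add: field_simps)
  also have "\<dots> = (\<Sum>x<N. 3 / 2 * ?c * (\<Sum>\<eta>\<in>?S. ?d x \<eta> * (?F \<eta>)\<^sup>2))"
    by (intro sum.cong refl) (simp add: sym)
  also have "\<dots> = 3 / 2 * ?c * (\<Sum>\<eta>\<in>?S. (\<Sum>x<N. ?d x \<eta>) * (?F \<eta>)\<^sup>2)"
    unfolding sum_distrib_left[symmetric] sum_distrib_right by (subst sum.swap) (rule refl)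
  also have "\<dots> \<le> 3 / 2 * ?c * (\<Sum>\<eta>\<in>?S. 2 * real k * (?F \<eta>)\<^sup>2)"
    using c by (intro mult_left_mono sum_mono mult_right_mono dsum) auto
  also have "\<dots> = ?c * (3 * real k * (\<Sum>\<eta>\<in>?S. (?F \<eta>)\<^sup>2))"
    by (simp add: sum_distrib_left[symmetric])
  finally have "ip ?S (\<lambda>\<eta>. ?F \<eta> ^ 3) ?F \<le> 3 * real k * (\<Sum>\<eta>\<in>?S. (?F \<eta>)\<^sup>2)"
    using c by simp
  then show ?thesis by (simp add: ip_def power4_eq_xxxx power3_eq_cube)
qed

text \<open>Interpolation through the third absolute moment by two applications of Cauchy-Schwarz,
  between moments one and three and between two and four.\<close>

lemma sum_abs_ge_fourth_moment:
  fixes F :: "'a \<Rightarrow> real"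
  assumes "0 \<le> m" "(\<Sum>x\<in>S. F x ^ 4) \<le> m * (\<Sum>x\<in>S. (F x)\<^sup>2)"
  shows "(\<Sum>x\<in>S. (F x)\<^sup>2)\<^sup>2 \<le> m * (\<Sum>x\<in>S. \<bar>F x\<bar>)\<^sup>2"
proof -
  let ?A = "\<Sum>x\<in>S. \<bar>F x\<bar>" and ?B = "\<Sum>x\<in>S. (F x)\<^sup>2" and ?C = "\<Sum>x\<in>S. \<bar>F x\<bar> ^ 3"
  have B0: "0 \<le> ?B" and A0: "0 \<le> ?A" by (auto intro: sum_nonneg)
  have "?B\<^sup>2 = (\<Sum>x\<in>S. sqrt \<bar>F x\<bar> * (sqrt \<bar>F x\<bar> * \<bar>F x\<bar>))\<^sup>2"
    by (simp add: mult.assoc[symmetric] power2_eq_square)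
  also have "\<dots> \<le> (\<Sum>x\<in>S. (sqrt \<bar>F x\<bar>)\<^sup>2) * (\<Sum>x\<in>S. (sqrt \<bar>F x\<bar> * \<bar>F x\<bar>)\<^sup>2)"
    by (rule Cauchy_Schwarz_ineq_sum)
  also have "\<dots> = ?A * ?C"
  proof -
    have "(sqrt \<bar>F x\<bar> * \<bar>F x\<bar>)\<^sup>2 = \<bar>F x\<bar> ^ 3" for x
      unfolding power_mult_distrib real_sqrt_pow2[OF abs_ge_zero]
      by (simp only: power2_eq_square power3_eq_cube mult.assoc)
    then show ?thesis by simp
  qed
  finally have BAC: "?B\<^sup>2 \<le> ?A * ?C" .
  have "\<bar>F x\<bar> ^ 3 = \<bar>F x\<bar> * \<bar>F x\<bar>\<^sup>2" for x
    by (simp only: power2_eq_square power3_eq_cube mult.assoc)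
  then have "?C\<^sup>2 = (\<Sum>x\<in>S. \<bar>F x\<bar> * \<bar>F x\<bar>\<^sup>2)\<^sup>2" by (simp only:)
  also have "\<dots> \<le> (\<Sum>x\<in>S. \<bar>F x\<bar>\<^sup>2) * (\<Sum>x\<in>S. (\<bar>F x\<bar>\<^sup>2)\<^sup>2)" by (rule Cauchy_Schwarz_ineq_sum)
  also have "\<dots> = ?B * (\<Sum>x\<in>S. F x ^ 4)" by (simp flip: power_mult)
  also have "\<dots> \<le> ?B * (m * ?B)" by (rule mult_left_mono[OF assms(2) B0])
  finally have C: "?C\<^sup>2 \<le> m * ?B\<^sup>2" by (simp add: power2_eq_square mult_ac)
  have "?B\<^sup>2 * ?B\<^sup>2 \<le> (?A * ?C)\<^sup>2"
    using power_mono[OF BAC, of 2] by (simp add: power2_eq_square)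
  also have "\<dots> \<le> ?A\<^sup>2 * (m * ?B\<^sup>2)" unfolding power_mult_distrib by (rule mult_left_mono[OF C]) simp
  also have "\<dots> = ?B\<^sup>2 * (m * ?A\<^sup>2)" by (simp only: mult_ac)
  finally have le: "?B\<^sup>2 * ?B\<^sup>2 \<le> ?B\<^sup>2 * (m * ?A\<^sup>2)" .
  show ?thesis
  proof (cases "?B = 0")
    case False
    then have "0 < ?B\<^sup>2" by simp
    with le show ?thesis by (rule mult_left_le_imp_le)
  qed (use assms(1) in simp)
qed

context sep_spectrum
begin

lemma typical_dist_ge_exp:
  assumes N: "2 \<le> N" and k: "1 \<le> k" "2 * k \<le> N" and t: "0 \<le> t"
  shows "exp (- (2 * t) * wave_eigenvalue N) / 48 \<le> typical_dist N k t"
proof -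
  let ?f = "\<lambda>\<delta>. \<Sum>x<N. (wave N \<delta> x)\<^sup>2" and ?n = "real (card (config_space N k))"
  \<comment> \<open>Cosine and sine squares add up to \<open>N\<close>, so one of the two phases has
    at least half; this covers all \<open>N\<close> from \<open>2\<close> on without evaluating
    either sum.\<close>
  have "(wave N 0 x)\<^sup>2 + (wave N (- (pi / 2)) x)\<^sup>2 = 1" for x
  proof -
    have "wave N (- (pi / 2)) x = sin (2 * pi / real N * real x)"
      by (simp add: wave_def cos_diff)
    then show ?thesis by (simp add: wave_def)
  qed
  then have "?f 0 + ?f (- (pi / 2)) = real N"
    by (simp flip: sum.distrib)
  then have "real N / 2 \<le> ?f 0 \<or> real N / 2 \<le> ?f (- (pi / 2))" by linarith
  then obtain \<delta> where \<delta>: "real N / 2 \<le> ?f \<delta>" by blast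
  let ?F = "wave_sum N \<delta>"
  let ?B = "\<Sum>\<eta>\<in>config_space N k. (?F \<eta>)\<^sup>2" and ?A = "\<Sum>\<eta>\<in>config_space N k. \<bar>?F \<eta>\<bar>"
  have n: "?n = real (N choose k)" "0 < ?n" using k by (auto simp: card_config_space)
  have "real k * ?n \<le> 2 * real N * real ((N - 2) choose (k - 1))"
    unfolding n by (rule binomial_pair_ratio[OF N k])
  also have "\<dots> = 4 * (real ((N - 2) choose (k - 1)) * (real N / 2))" by simp
  also have "\<dots> \<le> 4 * ?B"
    unfolding wave_sum_second_moment[OF N k(1)] by (intro mult_left_mono \<delta>) auto
  finally have B: "real k * ?n \<le> 4 * ?B" .
  moreover have "0 < real k * ?n" using k n(2) by (intro mult_pos_pos) auto
  ultimately have B0: "0 < ?B" by linarith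
  have A: "?B\<^sup>2 \<le> 3 * real k * ?A\<^sup>2"
    by (rule sum_abs_ge_fourth_moment[OF _ wave_sum_fourth_moment[OF N k(1)]]) simp
  let ?e = "exp (- (2 * t) * wave_eigenvalue N)"
  have "?e * ?A\<^sup>2 \<le> 4 * ?n * typical_dist N k t * ?B"
    using wave_eigenvalue_pos[OF N] wave_sum_eigenfunction[OF N] n(2) t
    by (intro typical_dist_ge) auto
  then have eA: "3 * real k * (?e * ?A\<^sup>2) \<le> 3 * real k * (4 * ?n * typical_dist N k t * ?B)"
    by (rule mult_left_mono) simp
  have "?B * (?e * ?B) = ?e * ?B\<^sup>2" by (simp only: power2_eq_square mult_ac)
  also have "\<dots> \<le> ?e * (3 * real k * ?A\<^sup>2)" using A by (rule mult_left_mono) simp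
  also have "\<dots> = 3 * real k * (?e * ?A\<^sup>2)" by (simp only: mult_ac)
  also note eA
  also have "3 * real k * (4 * ?n * typical_dist N k t * ?B) = ?B * (12 * real k * ?n * typical_dist N k t)"
    by algebra
  finally have "?B * (?e * ?B) \<le> ?B * (12 * real k * ?n * typical_dist N k t)" .
  then have "?e * ?B \<le> 12 * real k * ?n * typical_dist N k t" using B0 by (rule mult_left_le_imp_le)
  then have eB: "4 * (?e * ?B) \<le> 4 * (12 * real k * ?n * typical_dist N k t)"
    by (rule mult_left_mono) simp
  have "(real k * ?n) * ?e = ?e * (real k * ?n)" by (rule mult.commute)
  also have "\<dots> \<le> ?e * (4 * ?B)" using B by (rule mult_left_mono) simp
  also have "\<dots> = 4 * (?e * ?B)" by (rule mult.left_commute)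
  also note eB
  also have "4 * (12 * real k * ?n * typical_dist N k t) = (real k * ?n) * (48 * typical_dist N k t)"
    by algebra
  \<comment> \<open>\<open>48 = 4 * 3 * 4\<close>: from the bound by the typical distance, from the
    fourth moment, and from the lower bound on the second moment.\<close>
  finally have "?e \<le> 48 * typical_dist N k t"
    by (rule mult_left_le_imp_le) (use k n(2) in auto)
  then show ?thesis by simp
qed

end

section \<open>The diffusive time scale\<close>

text \<open>Everything at time \<open>N^2 * u\<close>. The trace enters at twice that time, so
  \<open>648\<close> becomes \<open>648 / 4 = 162\<close>; the lower exponent is
  \<open>2 * t\<close> times \<open>4 * pi^2 / N^2\<close>, which bounds the eigenvalue of the
  wave.\<close>

lemma typical_dist_bounds:
  assumes N: "2 \<le> N" and k: "1 \<le> k" "real k \<le> real N / 2" and u: "0 < u"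
  defines "M \<equiv> exp (162 / u\<^sup>2)"
  shows "exp (- 8 * pi\<^sup>2 * u) / 48 \<le> typical_dist N k ((real N)\<^sup>2 * u)"
    and "typical_dist N k ((real N)\<^sup>2 * u) \<le> 1 - 1 / (M + 1)"
    and "typical_dist N k ((real N)\<^sup>2 * u) \<le> sqrt (M - 1) / 2"
proof -
  let ?t = "(real N)\<^sup>2 * u"
  obtain \<Phi> E where "sep_spectrum N k \<Phi> E" using sep_spectrum_exists by blast
  then interpret sep_spectrum N k \<Phi> E .
  have k2: "2 * k \<le> N" using k(2) by linarith
  have n: "0 < real (card (config_space N k))" using k2 by (simp add: card_config_space)
  have t: "0 < ?t" using N u by simp
  have "(\<Sum>\<phi>\<in>\<Phi>. exp (- (2 * ?t) * E \<phi>)) \<le> exp (648 * ((real N)\<^sup>2 / (2 * ?t))\<^sup>2)"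
    using N t by (intro trace_le) auto
  also have "648 * ((real N)\<^sup>2 / (2 * ?t))\<^sup>2 = 162 / u\<^sup>2"
    using N u by (simp add: power_divide power_mult_distrib)
  finally have Z: "(\<Sum>\<phi>\<in>\<Phi>. exp (- (2 * ?t) * E \<phi>)) \<le> M" by (simp add: M_def)
  have Z0: "0 \<le> (\<Sum>\<phi>\<in>\<Phi>. exp (- (2 * ?t) * E \<phi>))" by (intro sum_nonneg) simp
  have "typical_dist N k ?t \<le> 1 - 1 / ((\<Sum>\<phi>\<in>\<Phi>. exp (- (2 * ?t) * E \<phi>)) + 1)"
    using n t by (intro typical_dist_less_1) auto
  also have "\<dots> \<le> 1 - 1 / (M + 1)"
    using Z Z0 by (intro diff_left_mono divide_left_mono) auto
  finally show "typical_dist N k ?t \<le> 1 - 1 / (M + 1)" .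
  have "(2 * typical_dist N k ?t)\<^sup>2 \<le> M - 1" using typical_dist_le_trace[OF n, of ?t] Z by linarith
  then have "2 * typical_dist N k ?t \<le> sqrt (M - 1)" by (rule real_le_rsqrt)
  then show "typical_dist N k ?t \<le> sqrt (M - 1) / 2" by simp
  have "(2 * ?t) * wave_eigenvalue N \<le> (2 * ?t) * (4 * (pi / real N)\<^sup>2)"
    using t by (intro mult_left_mono wave_eigenvalue_le) auto
  also have "\<dots> = 8 * pi\<^sup>2 * u" using N by (simp add: power_divide)
  finally have "exp (- 8 * pi\<^sup>2 * u) / 48 \<le> exp (- (2 * ?t) * wave_eigenvalue N) / 48" by simp
  also have "\<dots> \<le> typical_dist N k ?t" using N k k2 t by (intro typical_dist_ge_exp) auto
  finally show "exp (- 8 * pi\<^sup>2 * u) / 48 \<le> typical_dist N k ?t" .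
qed

theorem theorem1p4:
  fixes k :: "nat \<Rightarrow> nat"
  assumes "\<And>N. N \<ge> 2 \<Longrightarrow> 1 \<le> k N \<and> real (k N) \<le> real N / 2"
    and "filterlim k at_top sequentially"
  shows "(\<forall>u::real. u > 0 \<longrightarrow>
            0 < liminf (\<lambda>N. ereal (typical_dist N (k N) ((real N)\<^sup>2 * u)))
          \<and> liminf (\<lambda>N. ereal (typical_dist N (k N) ((real N)\<^sup>2 * u)))
              \<le> limsup (\<lambda>N. ereal (typical_dist N (k N) ((real N)\<^sup>2 * u)))
          \<and> limsup (\<lambda>N. ereal (typical_dist N (k N) ((real N)\<^sup>2 * u))) < 1)
       \<and> ((\<lambda>s::real. limsup (\<lambda>N. ereal (typical_dist N (k N) ((real N)\<^sup>2 * s)))) \<longlongrightarrow> 0) at_top"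
proof -
  let ?d = "\<lambda>u N. ereal (typical_dist N (k N) ((real N)\<^sup>2 * u))"
  let ?M = "\<lambda>u::real. exp (162 / u\<^sup>2)"
  note bounds = typical_dist_bounds[OF _ conjunct1[OF assms(1)] conjunct2[OF assms(1)]]
  have ev: "eventually P sequentially" if "\<And>N. 2 \<le> N \<Longrightarrow> P N" for P :: "nat \<Rightarrow> bool"
    using that eventually_ge_at_top[of 2] by (rule eventually_mono[rotated])
  have le: "liminf (?d u) \<le> limsup (?d u)" for u
    by (rule Liminf_le_Limsup) simp
  have lower: "ereal (exp (- 8 * pi\<^sup>2 * u) / 48) \<le> liminf (?d u)" if "0 < u" for u
    using bounds(1)[OF _ _ _ that] by (intro Liminf_bounded ev) auto
  have upper: "limsup (?d u) \<le> ereal (1 - 1 / (?M u + 1))" if "0 < u" for u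
    using bounds(2)[OF _ _ _ that] by (intro Limsup_bounded ev) auto
  have upper': "limsup (?d u) \<le> ereal (sqrt (?M u - 1) / 2)" if "0 < u" for u
    using bounds(3)[OF _ _ _ that] by (intro Limsup_bounded ev) auto
  have "0 < liminf (?d u)" "limsup (?d u) < 1" if u: "0 < u" for u
  proof -
    show "0 < liminf (?d u)" by (rule less_le_trans[OF _ lower[OF u]]) simp
    have "0 < ?M u + 1" by (simp add: add_pos_pos)
    then show "limsup (?d u) < 1"
      by (intro le_less_trans[OF upper[OF u]]) (simp add: one_ereal_def)
  qed
  moreover have "((\<lambda>s. limsup (?d s)) \<longlongrightarrow> 0) at_top"
  proof (rule tendsto_sandwich[OF _ _ tendsto_const])
    have "0 \<le> limsup (?d u)" if "0 < u" for u
    proof -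
      have "0 \<le> ereal (exp (- 8 * pi\<^sup>2 * u) / 48)" by simp
      also have "\<dots> \<le> limsup (?d u)" using lower[OF that] le by (rule order_trans)
      finally show ?thesis .
    qed
    then show "eventually (\<lambda>s. 0 \<le> limsup (?d s)) at_top"
      using eventually_gt_at_top[of 0] by (rule eventually_mono[rotated])
    show "eventually (\<lambda>s. limsup (?d s) \<le> ereal (sqrt (?M s - 1) / 2)) at_top"
      using eventually_gt_at_top[of 0] by (rule eventually_mono) (rule upper')
    \<comment> \<open>As \<open>s\<close> grows the bound on the trace tends to
      \<open>exp 0 = 1\<close>, the contribution of the invariant measure, and the chi-square bound
      vanishes.\<close>
    have "((\<lambda>s::real. sqrt (?M s - 1) / 2) \<longlongrightarrow> sqrt (exp 0 - 1) / 2) at_top"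
      by (intro tendsto_intros tendsto_divide_0[OF tendsto_const] filterlim_at_top_imp_at_infinity
          filterlim_pow_at_top filterlim_ident) auto
    then show "((\<lambda>s. ereal (sqrt (?M s - 1) / 2)) \<longlongrightarrow> 0) at_top"
      by (simp add: zero_ereal_def)
  qed
  ultimately show ?thesis using le by blast
qed

end
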